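(* Let $F=\mathbb{F}_{p^m}$ be a finite field ($p$ prime, $m\ge 1$), let $q$ be a non-degenerate quadratic form over $F$ of dimension at least $1$, and let $a\in F$. Then the diameter of $\mathcal{G}_{q,a}$ is as follows. (i) If $a=0$: $\mathrm{diam}(\mathcal{G}_{q,0})=2$ if $q$ is isotropic, and $\mathrm{diam}(\mathcal{G}_{q,0})=\infty$ if $q$ is anisotropic. (ii) If $a\neq 0$ and $\dim(q)=1$: $\mathrm{diam}(\mathcal{G}_{q,a})=\frac{p-1}{2}$ if $a\det(q)$ is a square in $F^\ast$ and $m=1$; otherwise $\mathrm{diam}(\mathcal{G}_{q,a})=\infty$. (iii) If $a\neq 0$, $\dim(q)=2$ and $q\cong\mathbb{H}$: $\mathrm{diam}(\mathcal{G}_{q,a})=\infty$ if $|F|\le 4$, and $\mathrm{diam}(\mathcal{G}_{q,a})\in\{3,4\}$ if $|F|\ge 5$. (iv) If $a\neq 0$, $\dim(q)=2$ and $q\not\cong\mathbb{H}$: $\mathrm{diam}(\mathcal{G}_{q,a})=1$ if $F=\mathbb{F}_2$; $=2$ if $F\in\{\mathbb{F}_3,\mathbb{F}_4\}$; and $=3$ otherwise. (v) If $a\neq 0$ and $\dim(q)=3$: $\mathrm{diam}(\mathcal{G}_{q,a})=2$ if $\det(q)=-a$ (in $F^\ast/F^{\ast2}$), and $=3$ otherwise. (vi) If $a\ne 0$ and $\dim(q)\ge 4$: $\mathrm{diam}(\mathcal{G}_{q,a})=2$.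
   Context: A quadratic form on a finite-dimensional $F$-vector space $V$ is a map $q:V\to F$ with $q(\lambda x)=\lambda^2q(x)$ such that $b_q(x,y)=q(x+y)-q(x)-q(y)$ is bilinear; $\dim(q)=\dim V$. Non-degenerate means $\{x\in V: b_q(x,y)=0\ \forall y\in V\}=\{0\}$ (so in characteristic 2 non-degenerate forms have even dimension). $q$ is isotropic if $q(v)=0$ for some $v\neq 0$, anisotropic otherwise. $\langle a_1,\dots,a_n\rangle$ denotes $(x_i)\mapsto\sum a_ix_i^2$, $[\alpha,\beta]$ denotes $(x,y)\mapsto \alpha x^2+xy+\beta y^2$, $\mathbb{H}=[0,0]$ is the hyperbolic plane, $\cong$ is isometry. For $\mathrm{char}(F)\ne 2$, $\det(q)\in F^\ast/F^{\ast 2}$ is the class of $\det A$ where $q(x)=x^TAx$ with $A$ symmetric (so $\det\langle a_1,\dots,a_n\rangle=\prod a_i$). The representation graph $\mathcal{G}_{q,a}$ has vertex set $V$, with distinct $x,y$ adjacent iff $q(x-y)=a$. The distance $\mathsf d(u,v)$ is the length of a shortest $u$-$v$ path ($\infty$ if none), and the diameter is the supremum of distances, in $\mathbb{N}_0\cup\{\infty\}$. *)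

theory Defs
  imports
    "HOL-Library.Extended_Nat"
    "HOL-Library.Cardinality"
    "HOL-Library.Product_Plus"
    "HOL-Computational_Algebra.Primes"
    "Jordan_Normal_Form.Determinant"
    "Graph_Theory.Graph_Theory"
begin

definition polar_form :: "('v::ab_group_add \<Rightarrow> 'a::field) \<Rightarrow> 'v \<Rightarrow> 'v \<Rightarrow> 'a" where
  "polar_form q x y = q (x + y) - q x - q y"

definition quadratic_form ::
    "('a::field \<Rightarrow> 'v::ab_group_add \<Rightarrow> 'v) \<Rightarrow> ('v \<Rightarrow> 'a) \<Rightarrow> bool" where
  "quadratic_form scale q \<longleftrightarrow>
     (\<forall>c x. q (scale c x) = c\<^sup>2 * q x) \<and>
     (\<forall>x. Vector_Spaces.linear scale (*) (\<lambda>y. polar_form q x y)) \<and>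
     (\<forall>y. Vector_Spaces.linear scale (*) (\<lambda>x. polar_form q x y))"

definition nondegenerate :: "('v::ab_group_add \<Rightarrow> 'a::field) \<Rightarrow> bool" where
  "nondegenerate q \<longleftrightarrow> {x. \<forall>y. polar_form q x y = 0} = {0}"

definition isotropic :: "('v::ab_group_add \<Rightarrow> 'a::field) \<Rightarrow> bool" where
  "isotropic q \<longleftrightarrow> (\<exists>v. v \<noteq> 0 \<and> q v = 0)"

abbreviation anisotropic :: "('v::ab_group_add \<Rightarrow> 'a::field) \<Rightarrow> bool" where
  "anisotropic q \<equiv> \<not> isotropic q"

definition isometric ::
    "('a::field \<Rightarrow> 'v::ab_group_add \<Rightarrow> 'v) \<Rightarrow> ('v \<Rightarrow> 'a) \<Rightarrow>
     ('a \<Rightarrow> 'w::ab_group_add \<Rightarrow> 'w) \<Rightarrow> ('w \<Rightarrow> 'a) \<Rightarrow> bool" where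
  "isometric s\<^sub>1 q\<^sub>1 s\<^sub>2 q\<^sub>2 \<longleftrightarrow>
     (\<exists>f. Vector_Spaces.linear s\<^sub>1 s\<^sub>2 f \<and> bij f \<and> (\<forall>x. q\<^sub>2 (f x) = q\<^sub>1 x))"

definition plane_scale :: "'a::field \<Rightarrow> 'a \<times> 'a \<Rightarrow> 'a \<times> 'a" where
  "plane_scale c v = (c * fst v, c * snd v)"

text \<open>The binary form \<open>[\<alpha>, \<beta>]\<close> on the coordinate plane.\<close>

definition binary_form :: "'a::field \<Rightarrow> 'a \<Rightarrow> 'a \<times> 'a \<Rightarrow> 'a" where
  "binary_form \<alpha> \<beta> v = \<alpha> * (fst v)\<^sup>2 + fst v * snd v + \<beta> * (snd v)\<^sup>2"

definition hyperbolic_plane :: "'a::field \<times> 'a \<Rightarrow> 'a" where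
  "hyperbolic_plane = binary_form 0 0"

definition ordered_basis ::
    "('a::field \<Rightarrow> 'v::ab_group_add \<Rightarrow> 'v) \<Rightarrow> 'v list \<Rightarrow> bool" where
  "ordered_basis scale vs \<longleftrightarrow>
     distinct vs \<and> \<not> module.dependent scale (set vs) \<and> module.span scale (set vs) = UNIV"

text \<open>\<open>A\<close> is a symmetric matrix with \<open>q x = x\<^sup>T A x\<close> in the coordinates given by \<open>vs\<close>.\<close>

definition symmetric_matrix_of ::
    "('a::field \<Rightarrow> 'v::ab_group_add \<Rightarrow> 'v) \<Rightarrow> ('v \<Rightarrow> 'a) \<Rightarrow> 'v list \<Rightarrow> 'a mat \<Rightarrow> bool" where
  "symmetric_matrix_of scale q vs A \<longleftrightarrow>
     A \<in> carrier_mat (length vs) (length vs) \<and> transpose_mat A = A \<and>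
     (\<forall>x \<in> carrier_vec (length vs).
        q (\<Sum>i<length vs. scale (x $ i) (vs ! i)) = x \<bullet> (A *\<^sub>v x))"

text \<open>Elements of \<open>F\<^sup>*/F\<^sup>*\<^sup>2\<close> are represented as cosets, that is, as subsets of \<open>F\<close>.\<close>

definition square_class :: "'a::field \<Rightarrow> 'a set" where
  "square_class d = {d * c\<^sup>2 | c. c \<noteq> 0}"

text \<open>
  A change of basis multiplies the determinant of the matrix by a non-zero square, so for
  non-degenerate \<open>q\<close> in characteristic other than 2 the union below consists of a single square
  class. The notion is not meaningful in characteristic 2.
\<close>

definition det_class ::
    "('a::field \<Rightarrow> 'v::ab_group_add \<Rightarrow> 'v) \<Rightarrow> ('v \<Rightarrow> 'a) \<Rightarrow> 'a set" where
  "det_class scale q =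
     \<Union> {square_class (det A) | A vs. ordered_basis scale vs \<and> symmetric_matrix_of scale q vs A}"

text \<open>
  A simple graph is encoded as a symmetric, loop-free digraph. The relation below is symmetric
  when \<open>q\<close> is a quadratic form, since then \<open>q (- x) = q x\<close>.
\<close>

definition representation_graph ::
    "('v::ab_group_add \<Rightarrow> 'a::field) \<Rightarrow> 'a \<Rightarrow> 'v pair_pre_digraph" where
  "representation_graph q a =
     \<lparr> pverts = UNIV, parcs = {(x, y). x \<noteq> y \<and> q (x - y) = a} \<rparr>"

text \<open>The infimum of the empty set in \<^typ>\<open>enat\<close> is \<open>\<infinity>\<close>.\<close>

definition graph_dist :: "('v, 'e) pre_digraph \<Rightarrow> 'v \<Rightarrow> 'v \<Rightarrow> enat" where
  "graph_dist G u v = (INF p \<in> {p. pre_digraph.apath G u p v}. enat (length p))"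

definition graph_diameter :: "('v, 'e) pre_digraph \<Rightarrow> enat" where
  "graph_diameter G = (SUP u \<in> verts G. SUP v \<in> verts G. graph_dist G u v)"

definition representation_diameter :: "('v::ab_group_add \<Rightarrow> 'a::field) \<Rightarrow> 'a \<Rightarrow> enat" where
  "representation_diameter q a = graph_diameter (with_proj (representation_graph q a))"

end

theory Submission imports Defs begin

text \<open>
  The distance from \<open>v\<close> to \<open>0\<close> is the least number of vectors of value \<open>a\<close> with sum \<open>v\<close>. A vector \<open>w\<close>
  is a sum of two of them iff the affine hyperplane \<open>b w v = q w\<close> contains a vector \<open>v\<close> of value \<open>a\<close>;
  in dimension at least 3 this reduces to universality of non-degenerate forms on the orthogonal
  complement of \<open>w\<close>, or of a plane containing \<open>w\<close>. In an anisotropic plane, \<open>v \<mapsto> b w v\<close> is at most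
  two-to-one on the \<open>|F| + 1\<close> vectors of value \<open>a\<close>, so by pigeonhole some \<open>w - v\<close> has the same value as
  a sum of two such vectors, and a reflection maps the latter to the former.

  In the hyperbolic plane the vectors of value \<open>a\<close> become the hyperbola \<open>(x, 1 / x)\<close>. Sums of two have
  product of coordinates in \<open>S = {s + 2 + 1 / s}\<close>, and a vector of product \<open>c\<close> is a sum of four as soon as
  \<open>(1 - t) * (c - d / t) \<in> S\<close> for some \<open>d \<in> S\<close> and some \<open>t\<close>. If this always fails in odd characteristic, then,
  whenever \<open>c * d\<close> is a square, these elements and \<open>S\<close> partition \<open>F\<close>, and comparing the sums of all
  elements forces \<open>c + d + 2 = 0\<close>, which cannot hold for all such \<open>d\<close>. In characteristic 2, \<open>S\<close> consists of
  the inverses of the index-2 subgroup \<open>H = {z\<^sup>2 + z}\<close> without \<open>0\<close>; if \<open>c\<close> is not a sum of two elements of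
  \<open>S\<close>, then the complement of \<open>H\<close> is \<open>(1 / c) * (S \<union> {1})\<close>, and its invariance under squaring gives \<open>c = 1\<close>.
\<close>

subsection \<open>Cayley graphs of representation sets\<close>

text \<open>Lower bounds come from single vectors. A nonzero vector of value other than
  \<open>a\<close> needs two summands, which accounts for every diameter 2. A nonzero vector on a
  coordinate axis of the hyperbolic plane needs three, since two hyperbola points with opposite
  first coordinates cancel. In dimension 3 the critical vectors are the isotropic ones: the
  hyperplane orthogonal to such a \<open>w\<close> contains \<open>w\<close> itself, so modulo
  \<open>w\<close> it is a line, and only one square class of nonzero values occurs on it. That
  class is that of \<open>- det\<close>, whence the condition on \<open>- a\<close>. The hyperbola
  resists counting alone because the two sets compared have sizes adding up to exactly
  \<open>|F|\<close>; comparing their sums supplies the missing information. It still leaves the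
  fields of 5 and 7 elements to direct computation. In characteristic 2 the comparison uses
  \<open>8 dvd |F|\<close>. For \<open>|F| \<le> 4\<close> inversion agrees on nonzero elements with
  an additive map, so the hyperbola lies in a proper subgroup and the graph is disconnected. In
  dimension one the connection set is empty or \<open>{h, - h}\<close>, and in the second case the
  graph is a union of cycles of length \<open>p\<close>.\<close>

primrec ksum :: "'v::ab_group_add set \<Rightarrow> nat \<Rightarrow> 'v set" where
  "ksum C 0 = {0}"
| "ksum C (Suc k) = {x + y | x y. x \<in> C \<and> y \<in> ksum C k}"

text \<open>The condition \<open>v \<noteq> 0\<close> excludes loops and only matters for \<open>a = 0\<close>.\<close>

definition connection_set :: "('v::ab_group_add \<Rightarrow> 'a::field) \<Rightarrow> 'a \<Rightarrow> 'v set" where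
  "connection_set q a = {v. v \<noteq> 0 \<and> q v = a}"

lemma ksum_add: "x \<in> ksum C i \<Longrightarrow> y \<in> ksum C j \<Longrightarrow> x + y \<in> ksum C (i + j)"
proof (induction i arbitrary: x)
  case (Suc i)
  then obtain c z where "c \<in> C" "z \<in> ksum C i" "x = c + z" by auto
  with Suc show ?case by (auto simp: add.assoc)
qed auto

lemma ksum_1: "ksum C 1 = C" by auto

lemma ksum_2: "ksum C 2 = {x + y | x y. x \<in> C \<and> y \<in> C}"
  by (auto simp: numeral_2_eq_2)

lemma ksum_empty: "ksum {} k \<subseteq> {0}"
  by (cases k) auto

text \<open>Serves to carry reachability from the standard hyperbola to any hyperbolic plane along
  an additive bijection.\<close>

lemma ksum_image:
  assumes "\<And>x y. f (x + y) = f x + f y"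
  shows "ksum (f ` C) k = f ` ksum C k"
proof (induction k)
  case 0
  have "f 0 = 0" using assms[of 0 0] by simp
  then show ?case by simp
next
  case (Suc k)
  have "ksum (f ` C) (Suc k) = {f x + f y | x y. x \<in> C \<and> y \<in> ksum C k}"
    unfolding ksum.simps Suc by blast
  also have "\<dots> = f ` ksum C (Suc k)"
    unfolding ksum.simps assms[symmetric] by blast
  finally show ?case .
qed

abbreviation rep_digraph where "rep_digraph q a \<equiv> with_proj (representation_graph q a)"

lemma rep_graph_simps [simp]:
  "pverts (representation_graph q a) = UNIV"
  "(x, y) \<in> parcs (representation_graph q a) \<longleftrightarrow> x - y \<in> connection_set q a"
  by (auto simp: representation_graph_def connection_set_def)

lemma wf_rep_digraph: "wf_digraph (rep_digraph q a)"
  by unfold_locales auto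

lemma rep_awalk_imp_ksum:
  "pre_digraph.awalk (rep_digraph q a) u p v \<Longrightarrow> u - v \<in> ksum (connection_set q a) (length p)"
proof (induction p arbitrary: u)
  case Nil
  then show ?case
    by (auto simp: wf_digraph.awalk_Nil_iff[OF wf_rep_digraph])
next
  case (Cons e p)
  obtain x y where e: "e = (x, y)" by fastforce
  have "x = u" "(x, y) \<in> parcs (representation_graph q a)"
    "pre_digraph.awalk (rep_digraph q a) y p v"
    using Cons.prems unfolding e by (simp_all add: wf_digraph.awalk_Cons_iff[OF wf_rep_digraph])
  then have "u - y \<in> connection_set q a" "y - v \<in> ksum (connection_set q a) (length p)"
    using Cons.IH by auto
  moreover have "u - v = (u - y) + (y - v)" by simp
  ultimately show ?case unfolding length_Cons ksum.simps by blast
qed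

lemma ksum_imp_rep_awalk:
  "u - v \<in> ksum (connection_set q a) k \<Longrightarrow>
     \<exists>p. pre_digraph.awalk (rep_digraph q a) u p v \<and> length p = k"
proof (induction k arbitrary: u)
  case 0
  then show ?case
    by (intro exI[of _ "[]"])
      (auto simp: wf_digraph.awalk_Nil_iff[OF wf_rep_digraph])
next
  case (Suc k)
  then obtain c z where c: "c \<in> connection_set q a" and z: "z \<in> ksum (connection_set q a) k"
    and uv: "u - v = c + z" by auto
  then have "(u - c) - v = z" by (simp add: algebra_simps)
  with Suc.IH[of "u - c"] z obtain p where p: "pre_digraph.awalk (rep_digraph q a) (u - c) p v"
    "length p = k" by auto
  have "pre_digraph.awalk (rep_digraph q a) u ((u, u - c) # p) v"
    using p c by (auto simp: wf_digraph.awalk_Cons_iff[OF wf_rep_digraph])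
  then show ?case using p(2) by (intro exI[of _ "(u, u - c) # p"]) auto
qed

text \<open>Sums of vectors produce walks, whereas \<open>graph_dist\<close> ranges over paths
  without repeated vertices. Cutting out a closed subwalk shortens a walk and keeps its ends, so
  strong induction on the length bridges the gap.\<close>

lemma (in wf_digraph) shorter_apath:
  assumes "awalk u p v" shows "\<exists>p'. apath u p' v \<and> length p' \<le> length p"
  using assms
proof (induction "length p" arbitrary: p rule: less_induct)
  case less
  show ?case
  proof (cases "distinct (awalk_verts u p)")
    case True
    with less.prems show ?thesis by (auto simp: apath_def)
  next
    case False
    then obtain a b c where "awalk_cyc_decomp p = (a, b, c)" by (cases "awalk_cyc_decomp p") auto
    with less.prems False have d: "is_awalk_cyc_decomp p (a, b, c)"
      using awalk_cyc_decomp_has_prop[OF less.prems] by fastforce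
    then obtain w where "p = a @ b @ c" "awalk w b w" "b \<noteq> []"
      by (auto simp: closed_w_def)
    with less.prems have "awalk u (a @ c) v"
      by (auto simp: awalk_append_iff) (metis awalk_ends)
    moreover have "length (a @ c) < length p" using \<open>p = a @ b @ c\<close> \<open>b \<noteq> []\<close> by simp
    ultimately show ?thesis using less.hyps[of "a @ c"] by (meson less_imp_le order.trans)
  qed
qed

lemma graph_dist_le:
  assumes "u - v \<in> ksum (connection_set q a) k"
  shows "graph_dist (rep_digraph q a) u v \<le> enat k"
proof -
  obtain p where p: "pre_digraph.awalk (rep_digraph q a) u p v" "length p = k"
    using ksum_imp_rep_awalk[OF assms] by blast
  obtain p' where p': "pre_digraph.apath (rep_digraph q a) u p' v" "length p' \<le> k"
    using wf_digraph.shorter_apath[OF wf_rep_digraph p(1)] p(2) by blast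
  then have "graph_dist (rep_digraph q a) u v \<le> enat (length p')"
    unfolding graph_dist_def by (intro INF_lower) auto
  with p' show ?thesis by (meson enat_ord_simps(1) order_trans)
qed

lemma graph_dist_ge:
  assumes "\<And>j. j < k \<Longrightarrow> u - v \<notin> ksum (connection_set q a) j"
  shows "enat k \<le> graph_dist (rep_digraph q a) u v"
  unfolding graph_dist_def
proof (rule INF_greatest)
  fix p assume "p \<in> {p. pre_digraph.apath (rep_digraph q a) u p v}"
  then have "u - v \<in> ksum (connection_set q a) (length p)"
    by (auto simp: pre_digraph.apath_def intro: rep_awalk_imp_ksum)
  then show "enat k \<le> enat (length p)" using assms[of "length p"] by force
qed

text \<open>The graph is translation invariant, so differences \<open>w\<close> represent all pairs
  of vertices. Since \<open>ksum\<close> uses exactly \<open>k\<close> summands and these sets need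
  not be nested, a bound on the distance is phrased with some \<open>j \<le> k\<close>.\<close>

lemma diameter_le:
  assumes "\<And>w. \<exists>j\<le>k. w \<in> ksum (connection_set q a) j"
  shows "representation_diameter q a \<le> enat k"
  unfolding representation_diameter_def graph_diameter_def
proof (intro SUP_least)
  fix u v
  obtain j where "j \<le> k" "u - v \<in> ksum (connection_set q a) j" using assms by blast
  then show "graph_dist (rep_digraph q a) u v \<le> enat k"
    using graph_dist_le by (metis enat_ord_simps(1) order_trans)
qed

lemma diameter_ge:
  assumes "\<And>j. j < k \<Longrightarrow> w \<notin> ksum (connection_set q a) j"
  shows "enat k \<le> representation_diameter q a"
proof -
  have "enat k \<le> graph_dist (rep_digraph q a) w 0" using assms by (intro graph_dist_ge) auto
  also have "\<dots> \<le> representation_diameter q a"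
    unfolding representation_diameter_def graph_diameter_def
    by (intro SUP_upper2[of w] SUP_upper2[of 0]) auto
  finally show ?thesis .
qed

lemma diameter_infinity:
  assumes "\<And>j. w \<notin> ksum (connection_set q a) j"
  shows "representation_diameter q a = \<infinity>"
proof -
  have "enat k \<le> representation_diameter q a" for k using diameter_ge assms by blast
  then show ?thesis
    by (metis Suc_ile_eq enat.exhaust less_irrefl)
qed

lemma diameter_eq:
  assumes "\<And>w. \<exists>j\<le>k. w \<in> ksum (connection_set q a) j"
    and "\<And>j. j < k \<Longrightarrow> w \<notin> ksum (connection_set q a) j"
  shows "representation_diameter q a = enat k"
  using diameter_le[OF assms(1)] diameter_ge[OF assms(2)] by (rule antisym) auto

subsection \<open>Sums and counts in finite fields\<close>

lemma card_le_fibres: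
  assumes "finite A" "\<And>y. card {x \<in> A. f x = y} \<le> k"
  shows "card A \<le> k * card (f ` A)"
proof -
  have "card A = (\<Sum>x\<in>A. 1)" by simp
  also have "\<dots> = (\<Sum>y\<in>f ` A. \<Sum>x\<in>{x \<in> A. f x = y}. 1)" using assms(1) by (rule sum.image_gen)
  also have "\<dots> \<le> (\<Sum>y\<in>f ` A. k)" using assms(2) by (intro sum_mono) simp
  finally show ?thesis by (simp add: mult.commute)
qed

text \<open>The fibres of \<open>g\<close> on \<open>A\<close> are the orbits of the involution
  \<open>\<iota>\<close>, hence of size 2 or 1; adding the fixed points once more makes every orbit
  count twice. The weight \<open>h\<close> is arbitrary so that the constant 1 gives cardinalities
  and the identity gives sums of elements.\<close>

lemma sum_orbit_image:
  fixes h :: "'b \<Rightarrow> 'c::comm_monoid_add"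
  assumes "finite A"
    and inv: "\<And>x. x \<in> A \<Longrightarrow> \<iota> x \<in> A" "\<And>x. x \<in> A \<Longrightarrow> \<iota> (\<iota> x) = x"
      "\<And>x. x \<in> A \<Longrightarrow> g (\<iota> x) = g x"
    and fib: "\<And>x y. x \<in> A \<Longrightarrow> y \<in> A \<Longrightarrow> g x = g y \<Longrightarrow> y = x \<or> y = \<iota> x"
  shows "(\<Sum>y\<in>g ` A. h y + h y) = (\<Sum>x\<in>A. h (g x)) + (\<Sum>x\<in>{x \<in> A. \<iota> x = x}. h (g x))"
proof -
  let ?B = "{x \<in> A. \<iota> x = x}"
  have "(\<Sum>x\<in>A. h (g x)) + (\<Sum>x\<in>?B. h (g x)) =
      (\<Sum>x\<in>A. h (g x) + (if \<iota> x = x then h (g x) else 0))"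
    unfolding sum.inter_filter[OF assms(1)] sum.distrib ..
  also have "\<dots> = (\<Sum>y\<in>g ` A. \<Sum>x\<in>{x \<in> A. g x = y}. h (g x) + (if \<iota> x = x then h (g x) else 0))"
    using assms(1) by (rule sum.image_gen)
  also have "\<dots> = (\<Sum>y\<in>g ` A. h y + h y)"
  proof (rule sum.cong[OF refl])
    fix y assume "y \<in> g ` A"
    then obtain x where x: "x \<in> A" "y = g x" by auto
    have i: "\<iota> x \<in> A" "\<iota> (\<iota> x) = x" "g (\<iota> x) = y" using inv[OF x(1)] x(2) by simp_all
    have f: "{z \<in> A. g z = y} = {x, \<iota> x}"
    proof (intro equalityI subsetI)
      fix z assume "z \<in> {z \<in> A. g z = y}"
      then show "z \<in> {x, \<iota> x}" using fib[OF x(1), of z] x(2) by simp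
    next
      fix z assume "z \<in> {x, \<iota> x}"
      then show "z \<in> {z \<in> A. g z = y}"
      proof
        assume "z = x" then show ?thesis using x by simp
      next
        assume "z \<in> {\<iota> x}" then show ?thesis using i by simp
      qed
    qed
    have e: "h (g x) = h y" "h (g (\<iota> x)) = h y" unfolding i(3) x(2) by (rule refl)+
    show "(\<Sum>x\<in>{x \<in> A. g x = y}. h (g x) + (if \<iota> x = x then h (g x) else 0)) = h y + h y"
    proof (cases "\<iota> x = x")
      case True
      then show ?thesis unfolding f using e by simp
    next
      case False
      then have "x \<noteq> \<iota> x" by simp
      then show ?thesis unfolding f using e i(2) by simp
    qed
  qed
  finally show ?thesis ..
qed

lemma card_orbit_image:
  assumes "finite A"
    and "\<And>x. x \<in> A \<Longrightarrow> \<iota> x \<in> A" "\<And>x. x \<in> A \<Longrightarrow> \<iota> (\<iota> x) = x"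
      "\<And>x. x \<in> A \<Longrightarrow> g (\<iota> x) = g x"
    and "\<And>x y. x \<in> A \<Longrightarrow> y \<in> A \<Longrightarrow> g x = g y \<Longrightarrow> y = x \<or> y = \<iota> x"
  shows "2 * card (g ` A) = card A + card {x \<in> A. \<iota> x = x}"
  using sum_orbit_image[of A \<iota> g "\<lambda>_. 1 :: nat"] assms by (simp add: mult_2)

lemma of_nat_CARD_eq_0: "of_nat CARD('a::{field,finite}) = (0::'a)"
proof -
  have "(\<Sum>x\<in>UNIV. x + 1) = (\<Sum>x\<in>UNIV. x :: 'a)"
    by (rule sum.reindex_bij_witness[of _ "\<lambda>x. x - 1" "\<lambda>x. x + 1"]) auto
  then show ?thesis by (simp add: sum.distrib)
qed

lemma card_squares:
  assumes "(2::'a::{field,finite}) \<noteq> 0"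
  shows "2 * card (range (\<lambda>x::'a. x\<^sup>2)) = CARD('a) + 1"
proof -
  have "x = 0" if "- x = x" for x :: 'a
    using that assms by (metis add.right_inverse mult_2 mult_eq_0_iff)
  then have f: "{x \<in> (UNIV::'a set). - x = x} = {0}" by fastforce
  have "2 * card (range (\<lambda>x::'a. x\<^sup>2)) = CARD('a) + card {x \<in> (UNIV::'a set). - x = x}"
    by (rule card_orbit_image) (auto simp: power2_eq_iff)
  then show ?thesis unfolding f by simp
qed

lemma odd_CARD: "(2::'a::{field,finite}) \<noteq> 0 \<Longrightarrow> odd CARD('a)"
  using card_squares[where 'a='a] by presburger

text \<open>In characteristic 2 the fibres of \<open>z \<mapsto> z * z + z\<close> are the pairs
  \<open>{z, z + 1}\<close>, the orbits of a translation without fixed points.\<close>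

lemma card_artin_schreier:
  assumes "(2::'a::{field,finite}) = 0"
  shows "2 * card (range (\<lambda>z::'a. z\<^sup>2 + z)) = CARD('a)"
proof -
  have a: "y = x \<or> y = x + 1" if "x\<^sup>2 + x = y\<^sup>2 + y" for x y :: 'a
  proof -
    have "(y - x) * (y - (x + 1)) = 2 * (x\<^sup>2 - x * y + x - y)"
      using that by (simp add: algebra_simps power2_eq_square)
    then show ?thesis using assms by simp
  qed
  have b: "(x + 1)\<^sup>2 + (x + 1) = x\<^sup>2 + x" "(x + 1) + 1 = x" for x :: 'a
  proof -
    have "(x + 1)\<^sup>2 + (x + 1) = x\<^sup>2 + x + 2 * (x + 1)" "(x + 1) + 1 = x + 2"
      by (simp_all add: algebra_simps power2_eq_square)
    then show "(x + 1)\<^sup>2 + (x + 1) = x\<^sup>2 + x" "(x + 1) + 1 = x" using assms by simp_all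
  qed
  have "2 * card (range (\<lambda>z::'a. z\<^sup>2 + z)) = CARD('a) + card {x \<in> (UNIV::'a set). x + 1 = x}"
    by (rule card_orbit_image) (use a b in auto)
  then show ?thesis by simp
qed

lemma even_CARD: "(2::'a::{field,finite}) = 0 \<Longrightarrow> even CARD('a)"
  using card_artin_schreier[where 'a='a] by (metis dvd_triv_left)

lemma surj_square_char2:
  assumes "(2::'a::{field,finite}) = 0"
  shows "surj (\<lambda>x::'a. x\<^sup>2)"
proof -
  have "inj (\<lambda>x::'a. x\<^sup>2)"
  proof (rule injI)
    fix x y :: 'a assume "x\<^sup>2 = y\<^sup>2"
    then have "(x - y)\<^sup>2 = 2 * (y\<^sup>2 - x * y)" by (simp add: algebra_simps power2_eq_square)
    then show "x = y" using assms by simp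
  qed
  then show ?thesis by (simp add: finite_UNIV_inj_surj)
qed

text \<open>Both \<open>\<alpha> * x * x\<close> and \<open>c - \<beta> * y * y\<close> take
  \<open>(|F| + 1) / 2\<close> values, so the two sets of values meet.\<close>

lemma binary_diagonal_universal:
  fixes \<alpha> \<beta> c :: "'a::{field,finite}"
  assumes "(2::'a) \<noteq> 0" "\<alpha> \<noteq> 0" "\<beta> \<noteq> 0"
  shows "\<exists>x y. \<alpha> * x\<^sup>2 + \<beta> * y\<^sup>2 = c"
proof -
  let ?S = "range (\<lambda>x::'a. x\<^sup>2)"
  let ?X = "(\<lambda>t. \<alpha> * t) ` ?S" and ?Y = "(\<lambda>t. c - \<beta> * t) ` ?S"
  have "card ?X = card ?S" "card ?Y = card ?S"
    using assms by (auto intro!: card_image simp: inj_on_def)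
  then have "card ?X + card ?Y > CARD('a)" using card_squares[OF assms(1)] by linarith
  moreover have "card (?X \<union> ?Y) \<le> CARD('a)" by (intro card_mono) auto
  ultimately have "?X \<inter> ?Y \<noteq> {}"
    using card_Un_disjoint[of ?X ?Y] by auto
  then obtain x y where "\<alpha> * x\<^sup>2 = c - \<beta> * y\<^sup>2" by auto
  then show ?thesis by (metis diff_add_cancel)
qed

text \<open>Multiplication by an element \<open>u\<close> other than 0 and 1 permutes the field and
  multiplies the sum by \<open>u\<close>. Inversion, with \<open>inverse 0 = 0\<close>, is a
  permutation as well.\<close>

lemma sum_UNIV_eq_0:
  assumes "CARD('a::{field,finite}) > 2"
  shows "(\<Sum>x\<in>UNIV. x :: 'a::{field,finite}) = 0"
    "(\<Sum>x\<in>UNIV. inverse x :: 'a::{field,finite}) = 0"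
proof -
  have "card {0, 1::'a} < CARD('a)" using assms by simp
  then obtain u :: 'a where u: "u \<notin> {0, 1}" by (metis UNIV_eq_I less_irrefl)
  have "(\<Sum>x\<in>UNIV. u * x) = (\<Sum>x\<in>UNIV. x)"
    using u by (intro sum.reindex_bij_witness[of _ "\<lambda>x. x / u" "\<lambda>x. u * x"]) auto
  then have "u * (\<Sum>x\<in>UNIV. x) = (\<Sum>x\<in>UNIV. x)" by (simp add: sum_distrib_left)
  then have "(u - 1) * (\<Sum>x\<in>UNIV. x) = 0" by (simp add: left_diff_distrib)
  then show "(\<Sum>x\<in>UNIV. x :: 'a) = 0" using u by simp
  moreover have "(\<Sum>x\<in>UNIV. inverse x :: 'a) = (\<Sum>x\<in>UNIV. x)"
    by (rule sum.reindex_bij_witness[of _ inverse inverse]) auto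
  ultimately show "(\<Sum>x\<in>UNIV. inverse x :: 'a) = 0" by simp
qed

lemma card_UNIV_obtain:
  assumes "finite A" "card A < CARD('a::finite)"
  obtains x :: "'a::finite" where "x \<notin> A"
  using assms by (metis UNIV_eq_I less_irrefl)

lemma card_quadratic_roots_le: "card {x::'a::{field,finite}. x\<^sup>2 + b * x + c = 0} \<le> 2"
proof (cases "\<exists>r. r\<^sup>2 + b * r + c = 0")
  case True
  then obtain r where r: "r\<^sup>2 + b * r + c = 0" by blast
  have "x = r \<or> x = - b - r" if "x\<^sup>2 + b * x + c = 0" for x
  proof -
    have "(x - r) * (x - (- b - r)) = (x\<^sup>2 + b * x + c) - (r\<^sup>2 + b * r + c)"
      by (simp add: algebra_simps power2_eq_square)
    with that r show ?thesis by auto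
  qed
  then have "{x. x\<^sup>2 + b * x + c = 0} \<subseteq> {r, - b - r}" by auto
  then have "card {x. x\<^sup>2 + b * x + c = 0} \<le> card {r, - b - r}" by (intro card_mono) auto
  also have "\<dots> \<le> 2" using card_insert_le_m1[of 2 "{- b - r}" r] by simp
  finally show ?thesis .
qed auto

text \<open>The set splits into pairs \<open>{x, x + h}\<close>, each with sum \<open>h\<close>.\<close>

lemma sum_translation_invariant:
  fixes S :: "'a::{field,finite} set"
  assumes "(2::'a) = 0" "h \<noteq> 0" "\<And>x. x \<in> S \<Longrightarrow> x + h \<in> S"
  shows "\<exists>n. card S = 2 * n \<and> \<Sum>S = of_nat n * h"
proof -
  have "finite S" by simp
  then show ?thesis using assms(3)
  proof (induction S rule: finite_psubset_induct)
    case (psubset S)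
    show ?case
    proof (cases "S = {}")
      case False
      then obtain x where x: "x \<in> S" by auto
      have hh: "h + h = 0" using assms(1) by (metis mult_2 mult_zero_left)
      have xx: "x + x = 0" using assms(1) by (metis mult_2 mult_zero_left)
      let ?T = "S - {x, x + h}"
      have "?T \<subset> S" using x by auto
      moreover have "y + h \<in> ?T" if "y \<in> ?T" for y
      proof -
        have "y + h \<noteq> x + h" "y + h \<noteq> x"
          using that hh by (auto simp: add.assoc)
        then show ?thesis using that psubset.prems by simp
      qed
      ultimately obtain n where n: "card ?T = 2 * n" "\<Sum>?T = of_nat n * h"
        using psubset.IH by blast
      have ne: "x \<noteq> x + h" using assms(2) by simp
      have sub: "{x, x + h} \<subseteq> S" using x psubset.prems by auto
      have "card S = card ?T + 2" using card_Diff_subset[OF _ sub] card_mono[OF _ sub] ne by simp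
      moreover have "\<Sum>S = \<Sum>?T + h"
        using sum.subset_diff[OF sub, of "\<lambda>x. x"] ne xx by (simp add: add.assoc[symmetric])
      ultimately show ?thesis using n by (intro exI[of _ "Suc n"]) (simp add: algebra_simps)
    qed (auto intro: exI[of _ 0])
  qed
qed

subsection \<open>Sums of points of a hyperbola\<close>

definition hyperbola :: "('a::field \<times> 'a) set" where
  "hyperbola = {(x, inverse x) | x. x \<noteq> 0}"

text \<open>The products \<open>u * v\<close> for sums \<open>(u, v)\<close> of two points of the hyperbola; \<open>s\<close> is the ratio of their
  first coordinates, and \<open>s = -1\<close> would give the zero vector.\<close>

definition chord_levels :: "'a::field set" where
  "chord_levels = (\<lambda>s. (1 + s)\<^sup>2 / s) ` (- {0, -1})"

lemma chord_levels_eq: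
  assumes "s \<noteq> (0::'a::field)" shows "(1 + s)\<^sup>2 / s = 2 + s + inverse s"
proof -
  have "(1 + s)\<^sup>2 * inverse s = inverse s + (s * inverse s + s * inverse s) + s * (s * inverse s)"
    by (simp only: algebra_simps power2_eq_square mult_1_left mult_1_right)
  then show ?thesis using assms by (simp add: divide_inverse)
qed

lemma chord_level_inverse:
  assumes "(s::'a::field) \<noteq> 0" shows "(1 + inverse s)\<^sup>2 / inverse s = (1 + s)\<^sup>2 / s"
proof -
  have "inverse s \<noteq> 0" using assms by simp
  then show ?thesis unfolding chord_levels_eq[OF assms] using chord_levels_eq[of "inverse s"] by simp
qed

text \<open>The difference of the cross-multiplied levels factors as
  \<open>(t - s) * (s * t - 1)\<close>. Thus levels are orbits of inversion, the involution used for
  counting them.\<close>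

lemma chord_level_eq_iff:
  assumes "s \<noteq> (0::'a::field)" "t \<noteq> 0" "(1 + s)\<^sup>2 / s = (1 + t)\<^sup>2 / t"
  shows "t = s \<or> t = inverse s"
proof -
  have "(1 + s)\<^sup>2 * t = (1 + t)\<^sup>2 * s" using assms by (simp add: divide_eq_eq eq_divide_eq)
  moreover have "(t - s) * (s * t - 1) = (1 + t)\<^sup>2 * s - (1 + s)\<^sup>2 * t"
    by (simp add: algebra_simps power2_eq_square)
  ultimately have "(t - s) * (s * t - 1) = 0" by simp
  then have "t = s \<or> s * t = 1" by simp
  then show ?thesis by (metis inverse_unique)
qed

lemma chord_levelsI: "s \<noteq> 0 \<Longrightarrow> s \<noteq> -1 \<Longrightarrow> (1 + s)\<^sup>2 / s \<in> chord_levels"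
  unfolding chord_levels_def by (rule imageI) simp

lemma chord_levels_1_plus: "s \<noteq> -1 \<Longrightarrow> 1 + s \<noteq> (0::'a::field)"
  by (simp add: add_eq_0_iff)

lemma zero_notin_chord_levels: "0 \<notin> chord_levels"
  unfolding chord_levels_def using chord_levels_1_plus by fastforce

lemma hyperbola_ksum_1:
  assumes "u * v = 1" shows "(u, v) \<in> ksum hyperbola 1"
proof -
  have "u \<noteq> 0" "v = inverse u" using assms inverse_unique by auto
  then show ?thesis unfolding ksum_1 hyperbola_def by blast
qed

lemma hyperbola_ksum_2:
  assumes "u * v \<in> chord_levels" shows "(u, v) \<in> ksum hyperbola 2"
proof -
  from assms obtain s where s: "s \<noteq> 0" "s \<noteq> -1" "u * v = (1 + s)\<^sup>2 / s"
    by (auto simp: chord_levels_def)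
  have s1: "1 + s \<noteq> 0" using s(2) by (rule chord_levels_1_plus)
  then have u: "u \<noteq> 0" using s by auto
  have v: "v = (1 + s)\<^sup>2 / (s * u)" using s u by (simp add: field_simps)
  let ?x = "u / (1 + s)" and ?y = "s * u / (1 + s)"
  have "u = ?x + ?y" using s1 by (simp add: divide_simps) (simp add: algebra_simps)
  moreover have "v = inverse ?x + inverse ?y"
    unfolding v using s u s1 by (simp add: divide_simps power2_eq_square)
      (simp add: algebra_simps)
  ultimately have "(u, v) = (?x, inverse ?x) + (?y, inverse ?y)" by simp
  moreover have "?x \<noteq> 0" "?y \<noteq> 0" using s u s1 by auto
  ultimately show ?thesis unfolding ksum_2 hyperbola_def by blast
qed

text \<open>Two points whose first coordinates cancel have second coordinates that cancel too. This
  is the source of the lower bound 3 for hyperbolic planes.\<close>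

lemma hyperbola_null_ksum:
  assumes "v \<noteq> 0" "j < 3" shows "(0, v) \<notin> ksum hyperbola j"
proof -
  have "(0, v) \<notin> ksum hyperbola 2"
  proof
    assume "(0, v) \<in> ksum hyperbola 2"
    then obtain x z where "0 = x + z" "v = inverse x + inverse z"
      unfolding ksum_2 hyperbola_def by auto
    then have "z = - x" "v = inverse x + inverse z" by (simp_all add: add_eq_0_iff eq_commute[of 0])
    then show False using assms(1) by simp
  qed
  moreover have "(0, v) \<notin> ksum hyperbola 1" unfolding ksum_1 hyperbola_def by simp
  moreover have "(0, v) \<notin> ksum hyperbola 0" using assms(1) by (simp add: zero_prod_def)
  moreover have "j = 0 \<or> j = 1 \<or> j = 2" using assms(2) by linarith
  ultimately show ?thesis by metis
qed

text \<open>With the level of \<open>(u, v)\<close> being \<open>u * v\<close>, a vector of level \<open>c\<close> is a sum of vectors of levels \<open>d\<close> and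
  \<open>e\<close> with first coordinates in ratio \<open>t : 1 - t\<close> exactly when \<open>c = d / t + e / (1 - t)\<close>.\<close>

lemma hyperbola_ksum_4:
  assumes "d \<in> insert 1 chord_levels" "(1 - t) * (c - d / t) \<in> chord_levels" "t \<noteq> 0"
    and "u * v = c" "c \<noteq> 0"
  shows "\<exists>j\<le>4. (u, v) \<in> ksum hyperbola j"
proof -
  let ?e = "(1 - t) * (c - d / t)"
  have t: "1 - t \<noteq> 0" using assms(2) zero_notin_chord_levels by auto
  have u: "u \<noteq> 0" using assms by auto
  \<comment> \<open>A single hyperbola point already has level 1, so \<open>d = 1\<close> costs one
    summand instead of two.\<close>
  obtain i where i: "i \<le> 2" "(t * u, d / (t * u)) \<in> ksum hyperbola i"
  proof (cases "d = 1")
    case True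
    then show ?thesis using that[of 1] hyperbola_ksum_1[of "t * u" "d / (t * u)"] assms(3) u by simp
  next
    case False
    then show ?thesis
      using that[of 2] hyperbola_ksum_2[of "t * u" "d / (t * u)"] assms(1,3) u by simp
  qed
  have "((1 - t) * u, ?e / ((1 - t) * u)) \<in> ksum hyperbola 2"
    using assms(2) t u by (intro hyperbola_ksum_2) simp
  with i(2) have "(t * u, d / (t * u)) + ((1 - t) * u, ?e / ((1 - t) * u)) \<in> ksum hyperbola (i + 2)"
    by (rule ksum_add)
  moreover have "(t * u, d / (t * u)) + ((1 - t) * u, ?e / ((1 - t) * u)) = (u, v)"
  proof -
    have "v = c / u" using assms u by (simp add: field_simps)
    moreover have "d / (t * u) + ?e / ((1 - t) * u) = c / u"
      using t u assms(3) by (simp add: divide_simps)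
    moreover have "t * u + (1 - t) * u = u" by (simp add: algebra_simps)
    ultimately show ?thesis by (simp only: add_Pair)
  qed
  ultimately show ?thesis using i(1) by (intro exI[of _ "i + 2"]) auto
qed

text \<open>Vectors of levels \<open>d\<close> and \<open>e\<close> with opposite first coordinates
  \<open>?u\<close> and \<open>- ?u\<close> add up to \<open>(0, (d - e) / ?u)\<close>, which
  dictates the choice of \<open>?u\<close>. The second claim exchanges the coordinates.\<close>

lemma hyperbola_ksum_4_null:
  fixes d e v :: "'a::field"
  assumes "d \<in> chord_levels" "e \<in> chord_levels" "d \<noteq> e" "v \<noteq> 0"
  shows "(0, v) \<in> ksum hyperbola 4" and "(v, 0) \<in> ksum hyperbola 4"
proof -
  let ?u = "(d - e) / v"
  have u: "?u \<noteq> 0" using assms by simp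
  have "(?u, d / ?u) + (- ?u, e / (- ?u)) \<in> ksum hyperbola (2 + 2)"
    using assms u by (intro ksum_add hyperbola_ksum_2) auto
  moreover have "d / ?u + e / (- ?u) = v"
  proof -
    have "d / w + e / (- w) = (d - e) / w" for w by (simp add: diff_divide_distrib)
    from this[of ?u] show ?thesis using assms by simp
  qed
  ultimately show "(0, v) \<in> ksum hyperbola 4" by simp
  have "(d / ?u, ?u) + (e / (- ?u), - ?u) \<in> ksum hyperbola (2 + 2)"
    using assms u by (intro ksum_add hyperbola_ksum_2) auto
  moreover have "d / ?u + e / (- ?u) = v"
  proof -
    have "d / w + e / (- w) = (d - e) / w" for w by (simp add: diff_divide_distrib)
    from this[of ?u] show ?thesis using assms by simp
  qed
  ultimately show "(v, 0) \<in> ksum hyperbola 4" by simp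
qed

section \<open>The hyperbola in odd characteristic\<close>

lemma chord_levels_odd:
  assumes "(2::'a::{field,finite}) \<noteq> 0" "CARD('a) > 3"
  shows "2 * card (chord_levels :: 'a set) = CARD('a) - 1" "\<Sum>(chord_levels :: 'a set) = 1"
proof -
  let ?A = "- {0, -1 :: 'a}" and ?g = "\<lambda>s::'a. (1 + s)\<^sup>2 / s"
  have m1: "(1::'a) \<noteq> -1"
    using assms(1) by (metis add.right_inverse one_add_one)
  \<comment> \<open>With \<open>-1\<close> removed, 1 is the only fixed point of inversion, so the
    \<open>|F| - 2\<close> ratios form \<open>(|F| - 1) / 2\<close> orbits.\<close>
  have fixed: "{s \<in> ?A. inverse s = s} = {1}"
  proof -
    have "s = 1" if "s \<noteq> 0" "s \<noteq> -1" "inverse s = s" for s :: 'a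
    proof -
      have "s * s = 1" using that by (metis right_inverse)
      then have "(s - 1) * (s + 1) = 0" by (simp add: algebra_simps)
      then show ?thesis using that(2) by (auto simp: eq_neg_iff_add_eq_0)
    qed
    then show ?thesis using m1 by auto
  qed
  have inv: "inverse x \<in> ?A" if "x \<in> ?A" for x
    using that by auto (metis inverse_inverse_eq inverse_minus_eq inverse_1)
  have "2 * card (?g ` ?A) = card ?A + card {s \<in> ?A. inverse s = s}"
  proof (rule card_orbit_image)
    show "y = x \<or> y = inverse x" if "x \<in> ?A" "y \<in> ?A" "?g x = ?g y" for x y
      using chord_level_eq_iff that by auto
  qed (use inv chord_level_inverse in auto)
  moreover have "card ?A = CARD('a) - 2" by (simp add: card_Diff_subset Compl_eq_Diff_UNIV)
  ultimately show "2 * card (chord_levels :: 'a set) = CARD('a) - 1"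
    unfolding fixed chord_levels_def using assms(2) by simp
  have "(\<Sum>y\<in>?g ` ?A. y + y) = (\<Sum>x\<in>?A. ?g x) + (\<Sum>x\<in>{s \<in> ?A. inverse s = s}. ?g x)"
  proof (rule sum_orbit_image[where h = "\<lambda>y. y"])
    show "y = x \<or> y = inverse x" if "x \<in> ?A" "y \<in> ?A" "?g x = ?g y" for x y
      using chord_level_eq_iff that by auto
  qed (use inv chord_level_inverse in auto)
  moreover have "(\<Sum>x\<in>?A. ?g x) = -2"
  proof -
    have "(\<Sum>x\<in>?A. ?g x) = (\<Sum>x\<in>?A. 2 + x + inverse x)"
      by (rule sum.cong) (auto simp: chord_levels_eq)
    \<comment> \<open>Since \<open>inverse 0 = 0\<close>, extending the sum to the whole field adds
      2 at the point 0 and nothing at \<open>-1\<close>; the full sum vanishes. The fixed point 1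
      later contributes 4, which leaves 2 for twice the sum of the levels.\<close>
    also have "\<dots> = (\<Sum>x\<in>UNIV. 2 + x + inverse x) - (\<Sum>x\<in>{0, -1}. 2 + x + inverse x)"
      by (simp add: Compl_eq_Diff_UNIV sum_diff)
    also have "(\<Sum>x\<in>UNIV. 2 + x + inverse x :: 'a) = 0"
      using sum_UNIV_eq_0[where 'a='a] assms(2) of_nat_CARD_eq_0[where 'a='a] by (simp add: sum.distrib)
    also have "(\<Sum>x\<in>{0, -1}. 2 + x + inverse x :: 'a) = 2" by (simp add: inverse_minus_eq)
    finally show ?thesis by simp
  qed
  moreover have "?g 1 = 4" by (simp add: power2_eq_square)
  ultimately have "(\<Sum>y\<in>?g ` ?A. y + y) = 2" unfolding fixed by simp
  then have "2 * \<Sum>(?g ` ?A) = 2 * 1" unfolding sum.distrib mult_2 by simp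
  then show "\<Sum>(chord_levels :: 'a set) = 1" unfolding chord_levels_def
    using assms(1) by (simp only: mult_cancel_left simp_thms)
qed

text \<open>Expanded, \<open>(1 - t) * (c - d / t)\<close> is \<open>c + d - c * t - d / t\<close>,
  so the involution \<open>t \<mapsto> d / (c * t)\<close> swaps the last two terms. That
  \<open>c * d\<close> is a square provides its two fixed points, and these raise the size from
  \<open>(|F| - 1) / 2\<close> to \<open>(|F| + 1) / 2\<close>, just enough to complement the set of
  levels.\<close>

lemma translated_chord_levels_odd:
  fixes c d r :: "'a::{field,finite}"
  assumes "(2::'a) \<noteq> 0" "CARD('a) > 3" "c \<noteq> 0" "d \<noteq> 0" "c * d = r\<^sup>2"
  defines "E \<equiv> (\<lambda>t. (1 - t) * (c - d / t)) ` (- {0})"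
  shows "2 * card E = CARD('a) + 1" "2 * \<Sum>E = c + d"
proof -
  let ?A = "- {0 :: 'a}" and ?g = "\<lambda>t::'a. (1 - t) * (c - d / t)" and ?\<iota> = "\<lambda>t. d / (c * t)"
  have r: "r \<noteq> 0" using assms by auto
  have fixed: "{t \<in> ?A. ?\<iota> t = t} = {r / c, - r / c}"
  proof -
    have "t = r / c \<or> t = - r / c" if "t \<noteq> 0" "?\<iota> t = t" for t
    proof -
      have "d = t * (c * t)" using that assms by (simp add: field_simps)
      then have "(c * t - r) * (c * t + r) = 0" using assms(5)
        by (simp add: algebra_simps power2_eq_square)
      then have "c * t = r \<or> c * t = - r" by (auto simp: eq_neg_iff_add_eq_0)
      then show ?thesis using assms(3) by (auto simp: field_simps)
    qed
    moreover have "?\<iota> (r / c) = r / c" "?\<iota> (- r / c) = - r / c"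
      using assms r by (auto simp: field_simps power2_eq_square)
    ultimately show ?thesis using assms r by auto
  qed
  have ne: "r / c \<noteq> - r / c"
    using assms(1,3) r by (simp add: divide_simps)
  have fib: "y = x \<or> y = ?\<iota> x" if "x \<in> ?A" "y \<in> ?A" "?g x = ?g y" for x y
  proof -
    have e: "?g z * z = (1 - z) * (c * z - d)" if "z \<noteq> 0" for z
      using that unfolding mult.assoc left_diff_distrib[of c] by simp
    have xy: "x \<noteq> 0" "y \<noteq> 0" using that by auto
    have "(1 - x) * (c * x - d) * y = (?g x * x) * y" using e xy by metis
    also have "\<dots> = (?g y * y) * x" using that(3) by (simp only: ac_simps)
    also have "\<dots> = (1 - y) * (c * y - d) * x" using e xy by metis
    finally have "(1 - x) * (c * x - d) * y = (1 - y) * (c * y - d) * x" .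
    moreover have "(y - x) * (c * (x * y) - d) = (1 - x) * (c * x - d) * y - (1 - y) * (c * y - d) * x"
      by (simp add: algebra_simps)
    ultimately have "y = x \<or> c * (x * y) = d" by auto
    moreover have "y = ?\<iota> x" if "c * (x * y) = d"
      using that[symmetric] xy assms(3) by simp
    ultimately show ?thesis by blast
  qed
  have gi: "?g (?\<iota> x) = ?g x" if "x \<in> ?A" for x
    using that assms by (simp add: divide_simps) (simp add: left_diff_distrib)
  have ii: "?\<iota> x \<in> ?A" "?\<iota> (?\<iota> x) = x" if "x \<in> ?A" for x
    using that assms(3,4) by auto
  have "2 * card (?g ` ?A) = card ?A + card {t \<in> ?A. ?\<iota> t = t}"
  proof (rule card_orbit_image)
    show "finite ?A" by simp
  qed (fact ii gi fib)+
  moreover have "card ?A = CARD('a) - 1" by (simp add: card_Diff_subset Compl_eq_Diff_UNIV)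
  ultimately show "2 * card E = CARD('a) + 1"
    unfolding fixed E_def using assms(2) ne by simp
  have "(\<Sum>y\<in>?g ` ?A. y + y) = (\<Sum>x\<in>?A. ?g x) + (\<Sum>x\<in>{t \<in> ?A. ?\<iota> t = t}. ?g x)"
  proof (rule sum_orbit_image[where h = "\<lambda>y. y"])
    show "finite ?A" by simp
  qed (fact ii gi fib)+
  moreover have "(\<Sum>x\<in>?A. ?g x) = - (c + d)"
  proof -
    have "(\<Sum>x\<in>?A. ?g x) = (\<Sum>x\<in>?A. (c + d) - c * x - d * inverse x)"
      by (rule sum.cong) (auto simp: field_simps)
    also have "\<dots> = (\<Sum>x\<in>UNIV. (c + d) - c * x - d * inverse x) - (\<Sum>x\<in>{0}. (c + d) - c * x - d * inverse x)"
      by (simp add: Compl_eq_Diff_UNIV sum_diff)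
    also have "(\<Sum>x\<in>UNIV. (c + d) - c * x - d * inverse x) = 0"
      using sum_UNIV_eq_0[where 'a='a] assms(2) of_nat_CARD_eq_0[where 'a='a]
      by (simp add: sum_subtractf sum_distrib_left[symmetric])
    finally show ?thesis by simp
  qed
  moreover have "?g (r / c) + ?g (- r / c) = 2 * (c + d)"
  proof -
    have "?g (r / c) + ?g (- r / c) = 2 * c + 2 * (c * d * r) / (c * r)"
      using r assms(3) by (simp add: field_simps)
    also have "\<dots> = 2 * (c + d)" using r assms(3) by (simp add: field_simps)
    finally show ?thesis .
  qed
  ultimately have "(\<Sum>y\<in>?g ` ?A. y + y) = c + d" unfolding fixed using ne by simp
  then show "2 * \<Sum>E = c + d" unfolding E_def mult_2 sum.distrib .
qed

lemma hyperbola_reach_null: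
  fixes w :: "'a::{field,finite} \<times> 'a"
  assumes "2 \<le> card (chord_levels :: 'a set)" "fst w * snd w = 0"
  shows "\<exists>j\<le>4. w \<in> ksum hyperbola j"
proof -
  have "\<not> card (chord_levels :: 'a set) \<le> Suc 0" using assms(1) by simp
  then obtain d e :: 'a where de: "d \<in> chord_levels" "e \<in> chord_levels" "d \<noteq> e"
    using card_le_Suc0_iff_eq[of "chord_levels :: 'a set"] by auto
  obtain u v where w: "w = (u, v)" by fastforce
  consider "w = 0" | "u = 0" "v \<noteq> 0" | "v = 0" "u \<noteq> 0"
    using assms(2) w by (auto simp: zero_prod_def)
  then show ?thesis
  proof cases
    case 1
    then show ?thesis by (intro exI[of _ 0]) simp
  qed (use w hyperbola_ksum_4_null[OF de] in blast)+
qed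

lemma hyperbola_reach_odd:
  fixes w :: "'a::{field,finite} \<times> 'a"
  assumes two: "(2::'a) \<noteq> 0" and Q: "CARD('a) \<ge> 5"
  shows "\<exists>j\<le>4. w \<in> ksum hyperbola j"
proof (rule ccontr)
  assume unreachable: "\<not> ?thesis"
  let ?S = "chord_levels :: 'a set"
  obtain u v where w: "w = (u, v)" by fastforce
  define c where "c = u * v"
  have Q3: "CARD('a) > 3" using Q by simp
  note S = chord_levels_odd[OF two Q3]
  have "2 \<le> card ?S" using S(1) Q by simp
  then have "c \<noteq> 0" using hyperbola_reach_null[of w] unreachable unfolding w c_def fst_conv snd_conv by metis
  have avoid: "(1 - t) * (c - d / t) \<notin> ?S" if "d \<in> insert 1 ?S" "t \<noteq> 0" for d t
  proof
    assume "(1 - t) * (c - d / t) \<in> ?S"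
    from hyperbola_ksum_4[OF that(1) this that(2) c_def[symmetric] \<open>c \<noteq> 0\<close>]
    show False using unreachable unfolding w by (rule notE[rotated])
  qed
  \<comment> \<open>The sizes add up to \<open>|F|\<close>, so disjointness already forces a
    partition. The sum of all field elements is 0, and twice the sums of the two parts are
    \<open>c + d\<close> and 2.\<close>
  have key: "c + d + 2 = 0" if d: "d \<in> insert 1 ?S" and r: "c * d = r\<^sup>2" for d r
  proof -
    let ?E = "(\<lambda>t. (1 - t) * (c - d / t)) ` (- {0})"
    have "d \<noteq> 0" using d zero_notin_chord_levels by auto
    note E = translated_chord_levels_odd[OF two Q3 \<open>c \<noteq> 0\<close> this r]
    have disj: "?E \<inter> ?S = {}" using avoid[OF d] by auto
    then have "card (?E \<union> ?S) = card ?E + card ?S" by (intro card_Un_disjoint) auto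
    also have "\<dots> = CARD('a)" using E(1) S(1) Q by linarith
    finally have "?E \<union> ?S = UNIV" by (intro card_subset_eq) auto
    then have "\<Sum>?E + \<Sum>?S = 0"
      using sum.union_disjoint[of ?E ?S "\<lambda>x. x"] disj sum_UNIV_eq_0(1)[where 'a='a] Q3 by simp
    then have "2 * \<Sum>?E + 2 * \<Sum>?S = 0" by (metis distrib_left mult_zero_right)
    then show ?thesis using E(2) S(2) by simp
  qed
  \<comment> \<open>For a square \<open>c\<close> both \<open>d = 1\<close> and \<open>d = 4\<close>
    are admissible, the latter being the level of ratio 1. The two resulting equations combine to
    \<open>c = 0\<close>.\<close>
  have nonsquare: False if "c = r\<^sup>2" for r
  proof -
    have "c + 1 + 2 = 0" using key[of 1 r] that by simp
    moreover have "c + 4 + 2 = 0"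
    proof (rule key)
      have "1 \<noteq> (-1::'a)" using two by (metis add.right_inverse one_add_one)
      from chord_levelsI[OF one_neq_zero this] show "4 \<in> insert 1 ?S" by simp
      show "c * 4 = (2 * r)\<^sup>2" using that by (simp add: power2_eq_square)
    qed
    moreover have "c = 2 * (c + 1 + 2) - (c + 4 + 2)" by simp
    ultimately show False using \<open>c \<noteq> 0\<close> by simp
  qed
  \<comment> \<open>The level \<open>?d\<close> of a ratio \<open>s\<close> in the square class of
    \<open>c\<close> makes \<open>c * ?d\<close> a square, so \<open>key\<close> turns into a
    quadratic equation for \<open>s\<close> with coefficients depending on \<open>c\<close>
    only.\<close>
  have quadratic: "s\<^sup>2 + (c + 4) * s + 1 = 0" if s: "s = c * r\<^sup>2" "s \<noteq> 0" "s \<noteq> -1" for s r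
  proof -
    let ?d = "(1 + s)\<^sup>2 / s"
    have "r \<noteq> 0" using s by auto
    have "c + ?d + 2 = 0"
    proof (rule key)
      show "?d \<in> insert 1 ?S" using chord_levelsI[OF s(2,3)] by simp
      show "c * ?d = ((1 + s) / r)\<^sup>2"
        unfolding s(1) using \<open>c \<noteq> 0\<close> \<open>r \<noteq> 0\<close> by (simp add: power_divide)
    qed
    then have "s * (c + (2 + s + inverse s) + 2) = 0" using chord_levels_eq[OF s(2)] by simp
    moreover have "s * (c + (2 + s + inverse s) + 2) = s\<^sup>2 + (c + 4) * s + s * inverse s"
      by (simp add: algebra_simps power2_eq_square)
    ultimately show ?thesis using s(2) by simp
  qed
  \<comment> \<open>The set of all \<open>c * r * r\<close> has \<open>(|F| + 1) / 2\<close>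
    elements, all of them among \<open>0\<close>, \<open>-1\<close> and at most two roots.\<close>
  have "CARD('a) < 9"
  proof (rule ccontr)
    assume large: "\<not> CARD('a) < 9"
    let ?R = "{s::'a. s\<^sup>2 + (c + 4) * s + 1 = 0}"
    have sub: "(\<lambda>t. c * t) ` range (\<lambda>x. x\<^sup>2) \<subseteq> {0, -1} \<union> ?R" 
    proof
      fix s assume "s \<in> (\<lambda>t. c * t) ` range (\<lambda>x. x\<^sup>2)"
      then obtain r where "s = c * r\<^sup>2" by blast
      then show "s \<in> {0, -1} \<union> ?R" using quadratic[of s r] by blast
    qed
    have "card (range (\<lambda>x::'a. x\<^sup>2)) = card ((\<lambda>t. c * t) ` range (\<lambda>x. x\<^sup>2))"
      using \<open>c \<noteq> 0\<close> by (intro card_image[symmetric]) (auto simp: inj_on_def)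
    also have "\<dots> \<le> card ({0, -1} \<union> ?R)" using sub by (intro card_mono) auto
    also have "\<dots> \<le> card {0, -1 :: 'a} + card ?R" by (rule card_Un_le)
    also have "\<dots> \<le> 4" using card_quadratic_roots_le[of "c + 4" 1] by simp
    finally show False using card_squares[OF two] large by linarith
  qed
  moreover have "odd CARD('a)" using odd_CARD[OF two] .
  ultimately have "CARD('a) = 5 \<or> CARD('a) = 7" using Q by presburger
  then show False
  proof
    assume "CARD('a) = 5"
    then have five: "(5::'a) = 0" using of_nat_CARD_eq_0[where 'a='a] by simp
    have four: "4 = (-1::'a)" using five by (metis add.commute add_eq_0_iff numeral_plus_one semiring_norm(5) one_plus_numeral add_num_simps(1) numeral_One)
    \<comment> \<open>Here \<open>s = 4 * c\<close> equals \<open>- c\<close>. Its quadratic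
      collapses to \<open>1 + c = 0\<close>, which makes \<open>c\<close> the square of 2.\<close>
    have "4 * c \<noteq> -1" using nonsquare[of 1] unfolding four by auto
    moreover have "4 * c \<noteq> 0" using \<open>c \<noteq> 0\<close> unfolding four by simp
    ultimately have "(4 * c)\<^sup>2 + (c + 4) * (4 * c) + 1 = 0"
      using quadratic[of "4 * c" 2] by (simp add: mult.commute)
    then have "1 + c = 0" unfolding four by (simp add: algebra_simps power2_eq_square)
    then have "c = 2\<^sup>2" using four by (simp add: add_eq_0_iff)
    then show False by (rule nonsquare)
  next
    assume "CARD('a) = 7"
    then have seven: "(7::'a) = 0" using of_nat_CARD_eq_0[where 'a='a] by simp
    show False
    \<comment> \<open>The natural choice \<open>s = c\<close> is forbidden for
      \<open>c = -1\<close>. In that case \<open>s = -4\<close>, which is \<open>c\<close> times the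
      square of 2, replaces it, and the quadratic evaluates to 5.\<close>
    proof (cases "c = -1")
      case True
      have "(4::'a) \<noteq> 1"
      proof
        assume "(4::'a) = 1"
        moreover have "(7::'a) = 2 * 4 - 1" by simp
        ultimately have "(7::'a) = 2 * 1 - 1" by metis
        then show False using seven by simp
      qed
      moreover have "(4::'a) \<noteq> 0" using two by (metis mult_2_right mult_eq_0_iff numeral_Bit0)
      ultimately have "(-4)\<^sup>2 + (c + 4) * (-4) + 1 = 0"
        using quadratic[of "-4" 2] True by simp
      then have "(5::'a) = 0" using True by simp
      moreover have "(2::'a) = 7 - 5" by simp
      ultimately have "(2::'a) = 0 - 0" using seven by metis
      then show False using two by simp
    next
      case False
      then have "c\<^sup>2 + (c + 4) * c + 1 = 0" using quadratic[of c 1] \<open>c \<noteq> 0\<close> by simp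
      \<comment> \<open>Modulo 7, multiplication by 4 makes the leading coefficient 2 monic and the
        polynomial splits. Both roots, 1 and \<open>-3 = 4\<close>, are squares.\<close>
      moreover have "(c - 1) * (c + 3) = 4 * (c\<^sup>2 + (c + 4) * c + 1) - 7 * (c\<^sup>2 + 2 * c + 1)"
        by (simp add: algebra_simps power2_eq_square)
      ultimately have "(c - 1) * (c + 3) = 0" using seven by simp
      then have "c = 1 \<or> c = - 3" by (auto simp: eq_neg_iff_add_eq_0)
      moreover have "(- 3 :: 'a) = 2\<^sup>2"
      proof -
        have "(2::'a)\<^sup>2 = 7 - 3" by simp
        then show ?thesis using seven by simp
      qed
      ultimately show False using nonsquare[of 1] nonsquare[of 2] by auto
    qed
  qed
qed

section \<open>The hyperbola in characteristic 2\<close>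

lemma char2_add_self: "(2::'a::field) = 0 \<Longrightarrow> x + x = (0::'a)"
  by (metis mult_2 mult_zero_left)

lemma sum_square_char2:
  fixes A :: "'a::{field,finite} set"
  assumes "(2::'a) = 0"
  shows "(\<Sum>x\<in>A. (f x)\<^sup>2) = (\<Sum>x\<in>A. f x :: 'a)\<^sup>2"
proof -
  have "finite A" by simp
  then show ?thesis
    by (induction A rule: finite_induct) (simp_all add: power2_sum assms)
qed

text \<open>Over a finite field of characteristic 2 this is the kernel of the absolute trace. As an
  image it is visibly closed under addition and squaring, and no trace has to be introduced.\<close>

definition artin_schreier :: "'a::field set" where
  "artin_schreier = range (\<lambda>z. z\<^sup>2 + z)"

lemma artin_schreier_0: "0 \<in> artin_schreier"
  unfolding artin_schreier_def by (rule range_eqI[of _ _ 0]) simp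

lemma artin_schreier_add:
  assumes "(2::'a::field) = 0" "(x::'a) \<in> artin_schreier" "y \<in> artin_schreier"
  shows "x + y \<in> artin_schreier"
proof -
  obtain u v where "x = u\<^sup>2 + u" "y = v\<^sup>2 + v" using assms(2,3) unfolding artin_schreier_def by blast
  then have "x + y = (u + v)\<^sup>2 + (u + v)" using assms(1) by (simp add: power2_sum)
  then show ?thesis unfolding artin_schreier_def by (rule range_eqI)
qed

lemma artin_schreier_square:
  assumes "(2::'a::field) = 0" "(x::'a) \<in> artin_schreier"
  shows "x\<^sup>2 \<in> artin_schreier"
proof -
  obtain u where "x = u\<^sup>2 + u" using assms(2) unfolding artin_schreier_def by blast
  then have "x\<^sup>2 = (u\<^sup>2)\<^sup>2 + u\<^sup>2" using assms(1) by (simp add: power2_sum)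
  then show ?thesis unfolding artin_schreier_def by (rule range_eqI)
qed

lemma card_compl_artin_schreier:
  assumes "(2::'a::{field,finite}) = 0"
  shows "card (- artin_schreier :: 'a set) = card (artin_schreier :: 'a set)"
  using card_artin_schreier[OF assms] card_Diff_subset[of "artin_schreier :: 'a set" UNIV]
  by (simp add: artin_schreier_def Compl_eq_Diff_UNIV)

text \<open>By cardinality the coset of \<open>x\<close> fills the complement of the subgroup, so
  \<open>y\<close> lies in it and \<open>x + y\<close> is in the subgroup.\<close>

lemma artin_schreier_index2:
  fixes x y :: "'a::{field,finite}"
  assumes two: "(2::'a) = 0" and xy: "x \<notin> artin_schreier" "y \<notin> artin_schreier"
  shows "x + y \<in> artin_schreier"
proof -
  let ?H = "artin_schreier :: 'a set"
  have cancel: "x + (x + z) = z" for z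
    using char2_add_self[OF two, of x] by (simp add: add.assoc[symmetric])
  have "(\<lambda>h. x + h) ` ?H \<subseteq> - ?H"
  proof
    fix z assume "z \<in> (\<lambda>h. x + h) ` ?H"
    then obtain h where h: "h \<in> ?H" "z = x + h" by blast
    have "z \<notin> ?H"
    proof
      assume "z \<in> ?H"
      then have "z + h \<in> ?H" using h artin_schreier_add[OF two] by blast
      moreover have "z + h = x" using h(2) char2_add_self[OF two, of h] by (simp add: add.assoc)
      ultimately show False using xy by simp
    qed
    then show "z \<in> - ?H" by simp
  qed
  moreover have "card ((\<lambda>h. x + h) ` ?H) = card (- ?H)"
    unfolding card_compl_artin_schreier[OF two] by (intro card_image) (simp add: inj_on_def)
  ultimately have "(\<lambda>h. x + h) ` ?H = - ?H" by (intro card_subset_eq) auto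
  then have "y \<in> (\<lambda>h. x + h) ` ?H" using xy by simp
  then show ?thesis using cancel by auto
qed

text \<open>The substitution \<open>z = 1 / (1 + s)\<close> turns
  \<open>s / ((1 + s) * (1 + s))\<close>, the inverse of the level, into \<open>z * z + z\<close>.
  Conversely \<open>s = (z + 1) / z\<close>.\<close>

lemma chord_levels_char2:
  assumes two: "(2::'a::field) = 0"
  shows "(d::'a) \<in> chord_levels \<longleftrightarrow> d \<noteq> 0 \<and> inverse d \<in> artin_schreier"
proof
  assume d: "d \<in> chord_levels"
  then obtain s where s: "s \<noteq> 0" "s \<noteq> -1" "d = (1 + s)\<^sup>2 / s" unfolding chord_levels_def by auto
  have s1: "1 + s \<noteq> 0" using s(2) by (rule chord_levels_1_plus)
  have "(inverse (1 + s))\<^sup>2 + inverse (1 + s) = (1 + (1 + s)) / (1 + s)\<^sup>2"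
    using s1 by (simp add: power2_eq_square divide_simps)
  also have "1 + (1 + s) = s" using two by (simp add: add.assoc[symmetric])
  also have "s / (1 + s)\<^sup>2 = inverse d" using s(3) by simp
  finally have "inverse d \<in> artin_schreier"
    unfolding artin_schreier_def by (intro range_eqI) (rule sym)
  then show "d \<noteq> 0 \<and> inverse d \<in> artin_schreier" using d zero_notin_chord_levels by blast
next
  assume d: "d \<noteq> 0 \<and> inverse d \<in> artin_schreier"
  then obtain z where z: "inverse d = z\<^sup>2 + z" unfolding artin_schreier_def by auto
  then have "z * (z + 1) \<noteq> 0" using d by (metis distrib_left mult.right_neutral
        nonzero_imp_inverse_nonzero power2_eq_square)
  then have z0: "z \<noteq> 0" "z + 1 \<noteq> 0" by auto
  let ?s = "(z + 1) / z"
  have s1: "1 + ?s = inverse z"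
  proof -
    have "1 + ?s = (2 * z + 1) / z" using z0 by (simp add: divide_simps)
    then show ?thesis using two by (simp add: inverse_eq_divide)
  qed
  have "?s \<noteq> -1"
  proof
    assume "?s = -1"
    then have "1 + ?s = 0" by simp
    then show False using s1 z0 by simp
  qed
  moreover have "?s \<noteq> 0" using z0 by simp
  moreover have "(1 + ?s)\<^sup>2 / ?s = d"
  proof -
    have "(1 + ?s)\<^sup>2 / ?s = inverse (z * (z + 1))"
      unfolding s1 using z0 by (simp add: power2_eq_square divide_simps)
    also have "z * (z + 1) = inverse d" using z by (simp add: power2_eq_square distrib_left)
    finally show ?thesis by simp
  qed
  ultimately show "d \<in> chord_levels" using chord_levelsI[of ?s] by simp
qed

lemma hyperbola_reach_even:
  fixes w :: "'a::{field,finite} \<times> 'a"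
  assumes two: "(2::'a) = 0" and Q: "8 dvd CARD('a)"
  shows "\<exists>j\<le>4. w \<in> ksum hyperbola j"
proof (rule ccontr)
  assume unreachable: "\<not> ?thesis"
  let ?S = "chord_levels :: 'a set" and ?H = "artin_schreier :: 'a set"
  have Q8: "CARD('a) \<ge> 8" using Q by (intro dvd_imp_le) auto
  have H0: "0 \<in> ?H" by (rule artin_schreier_0)
  have H: "2 * card ?H = CARD('a)" unfolding artin_schreier_def by (rule card_artin_schreier[OF two])
  have S_iff: "d \<in> ?S \<longleftrightarrow> d \<noteq> 0 \<and> inverse d \<in> ?H" for d by (rule chord_levels_char2[OF two])
  have S_eq: "?S = inverse ` (?H - {0})"
  proof (intro equalityI subsetI)
    fix d assume "d \<in> ?S"
    then have "inverse d \<in> ?H - {0}" "d = inverse (inverse d)" using S_iff by simp_all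
    then show "d \<in> inverse ` (?H - {0})" by (rule rev_image_eqI)
  next
    fix d assume "d \<in> inverse ` (?H - {0})"
    then obtain h where "d = inverse h" "h \<in> ?H" "h \<noteq> 0" by blast
    then show "d \<in> ?S" using S_iff[of d] by simp
  qed
  have cardS: "card ?S = card ?H - 1"
    unfolding S_eq using H0 by (subst card_image) (simp_all add: inj_on_def card_Diff_singleton)
  obtain u v where w: "w = (u, v)" by fastforce
  define c where "c = u * v"
  have "2 \<le> card ?S" using cardS H Q8 by simp
  then have c0: "c \<noteq> 0" using hyperbola_reach_null[of w] unreachable unfolding w c_def fst_conv snd_conv by metis
  have cS: "c \<notin> ?S"
  proof
    assume "c \<in> ?S"
    then have "w \<in> ksum hyperbola 2" unfolding w c_def by (rule hyperbola_ksum_2)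
    then show False using unreachable by (meson one_le_numeral numeral_le_iff semiring_norm)
  qed
  have c1: "c \<noteq> 1"
  proof
    assume "c = 1"
    then have "w \<in> ksum hyperbola 1" unfolding w c_def by (rule hyperbola_ksum_1)
    then show False using unreachable by (meson one_le_numeral numeral_le_iff semiring_norm)
  qed
  have avoid: "c + d \<notin> ?S" if d: "d \<in> ?S" for d
  proof
    assume cd: "c + d \<in> ?S"
    have "d \<noteq> 0" using d S_iff by blast
    \<comment> \<open>This \<open>t\<close> is the fixed point of
      \<open>t \<mapsto> d / (c * t)\<close>; there the two terms \<open>c * t\<close> and
      \<open>d / t\<close> coincide and cancel, leaving \<open>c + d\<close>.\<close>
    obtain t where t: "t\<^sup>2 = d / c" using surj_square_char2[OF two] by (metis surjD)
    have "t \<noteq> 0" using t \<open>d \<noteq> 0\<close> c0 by auto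
    have dt: "d / t = c * t"
    proof -
      have "d = c * t\<^sup>2" using t c0 by simp
      then show ?thesis using \<open>t \<noteq> 0\<close> by (simp add: power2_eq_square)
    qed
    have "(1 - t) * (c - d / t) = c + c * t\<^sup>2 - 2 * (c * t)"
      unfolding dt by (simp add: algebra_simps power2_eq_square)
    also have "\<dots> = c + d" using t c0 two by simp
    finally have "(1 - t) * (c - d / t) \<in> ?S" using cd by simp
    from hyperbola_ksum_4[OF insertI2[OF d] this \<open>t \<noteq> 0\<close> c_def[symmetric] c0]
    show False using unreachable unfolding w by (rule notE[rotated])
  qed
  define k where "k = inverse c"
  have k0: "k \<noteq> 0" using c0 k_def by simp
  have kH: "k \<notin> ?H" using cS c0 S_iff k_def by simp
  \<comment> \<open>The element \<open>y + k\<close> lies in \<open>?H\<close> and its inverse is a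
    level \<open>d\<close>. The inverse of \<open>c + d\<close> works out to
    \<open>k + k * k / y\<close>, so avoidance of \<open>c + d\<close> decides membership of
    \<open>k * k / y\<close>.\<close>
  have dual: "k\<^sup>2 / y \<in> ?H" if y: "y \<notin> ?H" "y \<noteq> k" for y
  proof (rule ccontr)
    assume nH: "k\<^sup>2 / y \<notin> ?H"
    let ?h = "y + k"
    have y0: "y \<noteq> 0" using y H0 by auto
    have "?h \<in> ?H" using y(1) kH by (rule artin_schreier_index2[OF two])
    moreover have h0: "?h \<noteq> 0"
    proof
      assume "?h = 0"
      then have "y = k" using char2_add_self[OF two, of k] by (metis add_right_cancel)
      then show False using y by simp
    qed
    ultimately have "inverse ?h \<in> ?S" using S_iff by simp
    then have "c + inverse ?h \<notin> ?S" by (rule avoid)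
    moreover have e: "c + inverse ?h = y / (?h * k)"
    proof -
      have "c + inverse ?h = (y + 2 * k) / (?h * k)"
        unfolding k_def using c0 h0[unfolded k_def] by (simp add: divide_simps) (simp add: algebra_simps)
      then show ?thesis using two by simp
    qed
    moreover have "y / (?h * k) \<noteq> 0" using y0 h0 k0 by simp
    ultimately have "inverse (y / (?h * k)) \<notin> ?H" using S_iff by metis
    moreover have "inverse (y / (?h * k)) = k + k\<^sup>2 / y"
      using y0 h0 k0 by (simp add: divide_simps power2_eq_square) (simp add: algebra_simps)
    moreover have "k + k\<^sup>2 / y \<in> ?H" using kH nH by (rule artin_schreier_index2[OF two])
    ultimately show False by simp
  qed
  have swap1: "k / z \<in> ?H" if "z \<noteq> 0" "z \<noteq> 1" "k * z \<notin> ?H" for z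
    using dual[of "k * z"] that k0 by (simp add: power2_eq_square)
  \<comment> \<open>The point 1 has to be removed because \<open>k\<close> is outside
    \<open>?H\<close>, the point 0 because it is inside. Both sets then have
    \<open>card ?H - 1\<close> elements, so inversion, which maps \<open>?A1\<close> into
    \<open>?A2\<close>, is onto.\<close>
  let ?A1 = "{z. k * z \<notin> ?H} - {1}" and ?A2 = "{z. k * z \<in> ?H} - {0}"
  have cardA: "card ?A1 = card ?A2"
  proof -
    have e: "{z. k * z \<in> X} = (\<lambda>h. h / k) ` X" for X :: "'a set"
    proof (intro equalityI subsetI)
      fix z assume "z \<in> {z. k * z \<in> X}"
      then show "z \<in> (\<lambda>h. h / k) ` X" using k0 by (intro rev_image_eqI[of "k * z"]) simp_all
    next
      fix z assume "z \<in> (\<lambda>h. h / k) ` X"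
      then obtain h where "h \<in> X" "z = h / k" by blast
      then show "z \<in> {z. k * z \<in> X}" using k0 by simp
    qed
    have i: "inj_on (\<lambda>h. h / k) X" for X using k0 by (simp add: inj_on_def)
    have "card {z. k * z \<in> ?H} = card {z. k * z \<in> - ?H}"
      unfolding e card_image[OF i] card_compl_artin_schreier[OF two] ..
    then show ?thesis using kH H0 by (simp add: card_Diff_singleton)
  qed
  have "inverse ` ?A1 = ?A2"
  proof (rule card_subset_eq)
    show "inverse ` ?A1 \<subseteq> ?A2"
    proof
      fix x assume "x \<in> inverse ` ?A1"
      then obtain z where z: "x = inverse z" "k * z \<notin> ?H" "z \<noteq> 1" by blast
      moreover have "z \<noteq> 0" using z(2) H0 by auto
      ultimately show "x \<in> ?A2" using swap1[of z] by (simp add: divide_inverse)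
    qed
    show "card (inverse ` ?A1) = card ?A2"
      unfolding cardA[symmetric] by (rule card_image) (simp add: inj_on_def)
  qed simp
  then have swap2: "k / z \<notin> ?H" if "z \<noteq> 0" "k * z \<in> ?H" for z
  proof -
    have "z \<in> ?A2" using that by simp
    then obtain z' where "z = inverse z'" "k * z' \<notin> ?H" using \<open>inverse ` ?A1 = ?A2\<close> by blast
    then show ?thesis by (simp add: divide_inverse)
  qed
  \<comment> \<open>For \<open>d = s + 1 / s\<close> exactly one of \<open>k * s\<close> and
    \<open>k / s\<close> lies in \<open>?H\<close>, by \<open>swap1\<close> and
    \<open>swap2\<close>. Their sum \<open>k * d\<close> therefore does not.\<close>
  have kS: "k * d \<notin> ?H" if d: "d \<in> ?S" for d
  proof
    assume kd: "k * d \<in> ?H"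
    obtain s where s: "s \<noteq> 0" "s \<noteq> -1" "d = (1 + s)\<^sup>2 / s" using d unfolding chord_levels_def by auto
    have "d = s + inverse s" unfolding s(3) chord_levels_eq[OF s(1)] using two by simp
    then have e: "k * d = k * s + k / s" by (simp add: distrib_left divide_inverse)
    have "s \<noteq> 1" using s(2) two by (metis add_eq_0_iff one_add_one)
    have "k / s = k * s + k * d" 
      unfolding e add.assoc[symmetric] char2_add_self[OF two] by simp
    moreover have "k * s = k / s + k * d" 
      unfolding e add.left_commute[of "k / s" "k * s"] char2_add_self[OF two] by simp
    ultimately show False
      using swap1[of s] swap2[of s] kd s(1) \<open>s \<noteq> 1\<close> artin_schreier_add[OF two] by metis
  qed
  let ?kS = "(\<lambda>d. k * d) ` ?S"
  have sub: "?kS \<subseteq> - ?H" using kS by auto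
  have inj_k: "inj_on (\<lambda>d. k * d) X" for X using k0 by (simp add: inj_on_def)
  \<comment> \<open>There is one level fewer than there are elements in the complement; the leftover
    element \<open>a\<close> is identified as \<open>k\<close> by summation.\<close>
  have "card (- ?H - ?kS) = 1"
    using card_Diff_subset[OF _ sub] card_image[OF inj_k, of ?S] card_compl_artin_schreier[OF two] cardS H Q8
    by simp
  then obtain a where a: "- ?H - ?kS = {a}" by (rule card_1_singletonE)
  then have compl: "- ?H = insert a ?kS" "a \<notin> ?kS" "a \<notin> ?H" using sub by auto
  have sumH: "\<Sum>?H = 0"
  proof -
    have "\<not> card ?H \<le> Suc 0" using H Q8 by simp
    then obtain x y where "x \<in> ?H" "y \<in> ?H" "x \<noteq> y" using card_le_Suc0_iff_eq[of ?H] by auto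
    then obtain h where h: "h \<in> ?H" "h \<noteq> 0" by metis
    obtain n where n: "card ?H = 2 * n" "\<Sum>?H = of_nat n * h"
      using sum_translation_invariant[OF two h(2), of ?H] artin_schreier_add[OF two _ h(1)] by blast
    \<comment> \<open>This is where divisibility by 8 enters: \<open>n\<close> is a quarter of
      \<open>|F|\<close> and has to vanish in the field.\<close>
    have "even n" using n(1) H Q by presburger
    then have "of_nat n = (0::'a)" using two by (auto elim!: evenE)
    then show ?thesis using n by simp
  qed
  have sum_compl: "\<Sum>(- ?H) = 0"
    using sum.subset_diff[of ?H UNIV "\<lambda>x. x"] sum_UNIV_eq_0(1)[where 'a='a] sumH Q8
    by (simp add: Compl_eq_Diff_UNIV)
  \<comment> \<open>Squaring permutes the levels, so their sum is fixed by Frobenius and is 0 or 1.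
    The value 0 would give \<open>a = 0\<close>, which lies in \<open>?H\<close>.\<close>
  have "(\<Sum>d\<in>?S. d\<^sup>2) = \<Sum>?S"
  proof -
    have inj: "inj (\<lambda>x::'a. x\<^sup>2)" using surj_square_char2[OF two] by (simp add: finite_UNIV_surj_inj)
    have "(\<lambda>d. d\<^sup>2) ` ?S \<subseteq> ?S"
      using S_iff artin_schreier_square[OF two] by (auto simp: power_inverse[symmetric])
    then have "(\<lambda>d. d\<^sup>2) ` ?S = ?S"
      using inj by (intro endo_inj_surj) (auto intro: inj_on_subset)
    then show ?thesis using sum.reindex[of "\<lambda>d. d\<^sup>2" ?S "\<lambda>d. d"] inj_on_subset[OF inj, of ?S] by simp
  qed
  then have "(\<Sum>?S)\<^sup>2 = \<Sum>?S" using sum_square_char2[OF two, of "\<lambda>d. d" ?S] by simp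
  then have "\<Sum>?S * (\<Sum>?S - 1) = 0" by (simp add: power2_eq_square right_diff_distrib)
  then have "\<Sum>?S = 0 \<or> \<Sum>?S = 1" by auto
  moreover have "a = k * \<Sum>?S"
  proof -
    have "\<Sum>(- ?H) = a + k * \<Sum>?S"
      unfolding compl(1) using compl(2) sum.reindex[OF inj_k, of "\<lambda>x. x" ?S] by (simp add: sum_distrib_left)
    then have "a + k * \<Sum>?S = k * \<Sum>?S + k * \<Sum>?S" unfolding sum_compl char2_add_self[OF two] by simp
    then show ?thesis by (rule add_right_imp_eq)
  qed
  ultimately have "a = k" using compl(3) H0 by auto
  \<comment> \<open>Inverting \<open>k * d\<close> for a level \<open>d\<close> gives
    \<open>c\<close> times a nonzero element of \<open>?H\<close>, and these cancel in the sum; only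
    the inverse of \<open>k\<close> survives. Invariance of the complement under squaring makes this
    sum idempotent.\<close>
  have "(\<Sum>x\<in>- ?H. inverse x) = c"
  proof -
    have "(\<Sum>x\<in>- ?H. inverse x) = c + (\<Sum>d\<in>?S. c * inverse d)"
      unfolding compl(1) using compl(2) sum.reindex[OF inj_k, of inverse ?S]
      by (simp add: \<open>a = k\<close> k_def mult.commute)
    also have "(\<Sum>d\<in>?S. c * inverse d) = c * (\<Sum>h\<in>?H - {0}. h)"
      unfolding S_eq by (subst sum.reindex) (auto simp: inj_on_def sum_distrib_left)
    also have "(\<Sum>h\<in>?H - {0}. h) = 0" using sumH H0 by (simp add: sum_diff1)
    finally show ?thesis by simp
  qed
  moreover have "(\<Sum>x\<in>- ?H. (inverse x)\<^sup>2) = (\<Sum>x\<in>- ?H. inverse x)"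
  proof -
    have inj: "inj (\<lambda>x::'a. x\<^sup>2)" using surj_square_char2[OF two] by (simp add: finite_UNIV_surj_inj)
    have "(\<lambda>d. d\<^sup>2) ` ?H = ?H"
      using inj artin_schreier_square[OF two] by (intro endo_inj_surj) (auto intro: inj_on_subset)
    then have "(\<lambda>d. d\<^sup>2) ` (- ?H) = - ?H"
      using bij_image_Compl_eq[of "\<lambda>x::'a. x\<^sup>2" ?H] inj surj_square_char2[OF two] by (simp add: bij_def)
    then show ?thesis
      using sum.reindex[of "\<lambda>d. d\<^sup>2" "- ?H" inverse] inj_on_subset[OF inj, of "- ?H"]
      by (simp add: power_inverse)
  qed
  ultimately have "c\<^sup>2 = c" using sum_square_char2[OF two, of inverse "- ?H"] by simp
  then show False using c0 c1 by (simp add: power2_eq_square)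
qed

section \<open>Fields with at most four elements\<close>

lemma card_4_field:
  fixes x :: "'a::{field,finite}"
  assumes Q: "CARD('a) = 4" and x: "x \<noteq> 0" "x \<noteq> 1"
  shows "x\<^sup>2 = x + 1" "(2::'a) = 0"
proof -
  have "(2::'a) * 2 = 0" using of_nat_CARD_eq_0[where 'a='a] Q by simp
  then show two: "(2::'a) = 0" by (simp only: mult_eq_0_iff simp_thms)
  have "x + 1 \<noteq> 0"
  proof
    assume "x + 1 = 0"
    then have "x + 1 = 1 + 1" using char2_add_self[OF two, of 1] by simp
    then show False using x by simp
  qed
  then have "card {0, 1, x, x + 1} = CARD('a)" using x Q by simp
  then have U: "{0, 1, x, x + 1} = UNIV" by (intro card_subset_eq) auto
  have "x\<^sup>2 \<noteq> 1"
  proof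
    assume "x\<^sup>2 = 1"
    then have "(x - 1)\<^sup>2 = 0" using two by (simp add: power2_diff)
    then show False using x by simp
  qed
  moreover have "x\<^sup>2 \<noteq> 0" "x\<^sup>2 \<noteq> x" using x by (simp_all add: power2_eq_square)
  moreover have "x\<^sup>2 \<in> {0, 1, x, x + 1}" unfolding U by simp
  ultimately show "x\<^sup>2 = x + 1" by simp
qed

lemma card_3_field:
  fixes x :: "'a::{field,finite}"
  assumes Q: "CARD('a) = 3"
  shows "(2::'a) \<noteq> 0" and "x = 0 \<or> x = 1 \<or> x = -1"
proof -
  show two: "(2::'a) \<noteq> 0" using even_CARD[where 'a='a] Q by auto
  have "1 \<noteq> (-1::'a)" using two by (metis add.right_inverse one_add_one)
  then have "card {0, 1, -1::'a} = CARD('a)" using Q by simp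
  then have "{0, 1, -1::'a} = UNIV" by (intro card_subset_eq) auto
  then show "x = 0 \<or> x = 1 \<or> x = -1" by blast
qed

lemma card_2_field:
  fixes x :: "'a::{field,finite}"
  assumes Q: "CARD('a) = 2"
  shows "x = 0 \<or> x = (1::'a)"
proof -
  have "card {0, 1::'a} = CARD('a)" using Q by simp
  then have "{0, 1::'a} = UNIV" by (intro card_subset_eq) auto
  then show ?thesis by blast
qed

lemma CARD_field_ge_2: "CARD('a::{field,finite}) \<ge> 2"
proof -
  have "card {0, 1::'a} \<le> CARD('a)" by (intro card_mono) auto
  then show ?thesis by simp
qed

text \<open>On nonzero elements inversion is the identity for 2 or 3 elements, and for 4 elements it
  is the Frobenius map, because there \<open>x * x * x = 1\<close>.\<close>

lemma inverse_additive_small_field: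
  assumes "CARD('a::{field,finite}) \<le> 4"
  obtains \<psi> :: "'a::{field,finite} \<Rightarrow> 'a" where "\<And>x y. \<psi> (x + y) = \<psi> x + \<psi> y" "\<And>x. x \<noteq> 0 \<Longrightarrow> inverse x = \<psi> x"
proof -
  have "CARD('a) = 2 \<or> CARD('a) = 3 \<or> CARD('a) = 4"
    using assms CARD_field_ge_2[where 'a='a] by linarith
  then consider (23) "CARD('a) = 2 \<or> CARD('a) = 3" | (4) "CARD('a) = 4" by blast
  then show thesis
  proof cases
    case 23
    have "inverse x = x" if "x \<noteq> 0" for x :: 'a
      using 23 card_2_field[of x] card_3_field(2)[of x] that by auto
    then show thesis using that[of "\<lambda>x. x"] by simp
  next
    case 4
    have two: "(2::'a) = 0" if "(x::'a) \<noteq> 0" "x \<noteq> 1" for x using card_4_field[OF 4 that] by simp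
    obtain x :: 'a where "x \<notin> {0, 1}" using card_UNIV_obtain[of "{0, 1::'a}"] 4 by auto
    then have two: "(2::'a) = 0" using two[of x] by simp
    have "inverse x = x\<^sup>2" if "x \<noteq> 0" for x :: 'a
    proof (cases "x = 1")
      case False
      have "x * x\<^sup>2 = x\<^sup>2 + x"
        unfolding card_4_field(1)[OF 4 that False] by (simp add: distrib_left power2_eq_square[symmetric])
          (simp add: card_4_field(1)[OF 4 that False])
      also have "\<dots> = 1"
        unfolding card_4_field(1)[OF 4 that False] using char2_add_self[OF two, of x]
        by (simp add: add.commute add.left_commute)
      finally show ?thesis by (rule inverse_unique)
    qed simp
    then show thesis using that[of "\<lambda>x. x\<^sup>2"] two by (simp add: power2_sum)
  qed
qed

text \<open>All sums of hyperbola points stay on the graph of the additive map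
  \<open>\<psi>\<close>, which meets the vertical axis only in the origin.\<close>

lemma hyperbola_unreachable:
  assumes "CARD('a::{field,finite}) \<le> 4"
  shows "(0, 1 :: 'a::{field,finite}) \<notin> ksum hyperbola k"
proof -
  obtain \<psi> :: "'a \<Rightarrow> 'a" where \<psi>: "\<And>x y. \<psi> (x + y) = \<psi> x + \<psi> y" "\<And>x. x \<noteq> 0 \<Longrightarrow> inverse x = \<psi> x"
    using inverse_additive_small_field[OF assms] by blast
  have "\<psi> 0 + 0 = \<psi> 0 + \<psi> 0" using \<psi>(1)[of 0 0] by (simp only: add_0_right)
  then have \<psi>0: "\<psi> 0 = 0" unfolding add_left_cancel by (rule sym)
  have "snd w = \<psi> (fst w)" if "w \<in> ksum hyperbola k" for w
    using that
  proof (induction k arbitrary: w)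
    case 0
    then show ?case using \<psi>0 by (simp add: zero_prod_def)
  next
    case (Suc k)
    then obtain x z where "x \<noteq> 0" "z \<in> ksum hyperbola k" "w = (x, inverse x) + z"
      unfolding ksum.simps hyperbola_def by blast
    then show ?case using Suc.IH[of z] \<psi> by (simp add: plus_prod_def)
  qed
  from this[of "(0, 1)"] show ?thesis using \<psi>0 by auto
qed

section \<open>Transfer to hyperbolic planes\<close>

lemma enat_3_4:
  assumes "enat 3 \<le> x" "x \<le> enat 4" shows "x \<in> {3, 4}"
proof -
  obtain n where "x = enat n" using assms(2) by (cases x) auto
  then show ?thesis using assms by (auto simp: numeral_eq_enat)
qed

lemma diameter_of_hyperbola:
  fixes q :: "'v::ab_group_add \<Rightarrow> 'a::{field,finite}" and \<phi> :: "'a \<times> 'a \<Rightarrow> 'v"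
  assumes \<phi>: "\<And>x y. \<phi> (x + y) = \<phi> x + \<phi> y" "bij \<phi>"
    and C: "connection_set q a = \<phi> ` hyperbola"
  shows "CARD('a) \<le> 4 \<Longrightarrow> representation_diameter q a = \<infinity>"
    and "CARD('a) \<ge> 5 \<Longrightarrow> (2::'a) \<noteq> 0 \<or> 8 dvd CARD('a) \<Longrightarrow> representation_diameter q a \<in> {3, 4}"
proof -
  have k: "\<phi> w \<in> ksum (connection_set q a) j \<longleftrightarrow> w \<in> ksum hyperbola j" for w j
    unfolding C ksum_image[OF \<phi>(1)] using \<phi>(2) by (simp add: bij_is_inj inj_image_mem_iff)
  show "representation_diameter q a = \<infinity>" if "CARD('a) \<le> 4"
    using hyperbola_unreachable[OF that] by (intro diameter_infinity[of "\<phi> (0, 1)"]) (simp add: k)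
  show "representation_diameter q a \<in> {3, 4}" if Q: "CARD('a) \<ge> 5" "(2::'a) \<noteq> 0 \<or> 8 dvd CARD('a)"
  proof (rule enat_3_4)
    show "enat 3 \<le> representation_diameter q a"
      using hyperbola_null_ksum[of "1::'a"] by (intro diameter_ge[of _ "\<phi> (0, 1)"]) (simp add: k)
    show "representation_diameter q a \<le> enat 4"
    proof (rule diameter_le)
      fix w
      obtain z where "w = \<phi> z" using \<phi>(2) by (meson bij_pointE)
      moreover have "\<exists>j\<le>4. z \<in> ksum hyperbola j"
        using Q hyperbola_reach_odd[of z] hyperbola_reach_even[of z] by blast
      ultimately show "\<exists>j\<le>4. w \<in> ksum (connection_set q a) j" using k by simp
    qed
  qed
qed

lemma hyperbolic_plane_diameter:
  fixes q :: "'v::ab_group_add \<Rightarrow> 'a::{field,finite}"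
  assumes iso: "isometric scale q plane_scale hyperbolic_plane" and a: "a \<noteq> 0" and q0: "q 0 = 0"
  shows "CARD('a) \<le> 4 \<Longrightarrow> representation_diameter q a = \<infinity>"
    and "CARD('a) \<ge> 5 \<Longrightarrow> (2::'a) \<noteq> 0 \<or> 8 dvd CARD('a) \<Longrightarrow> representation_diameter q a \<in> {3, 4}"
proof -
  obtain f where f: "Vector_Spaces.linear scale plane_scale f" "bij f" "\<And>x. hyperbolic_plane (f x) = q x"
    using iso unfolding isometric_def by blast
  interpret f: Vector_Spaces.linear scale plane_scale f by fact
  define g where "g = inv_into UNIV f"
  \<comment> \<open>Rescaling the second coordinate by \<open>a\<close> turns the curve of value 1
    into the curve of value \<open>a\<close>.\<close>
  define \<phi> where "\<phi> z = g (fst z, a * snd z)" for z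
  have ff: "f (g z) = z" for z unfolding g_def using f(2) by (simp add: bij_is_surj surj_f_inv_f)
  have "inj f" using f(2) by (rule bij_is_inj)
  then have gf: "g (f v) = v" for v unfolding g_def by simp
  have "\<phi> (x + y) = \<phi> x + \<phi> y" for x y
    by (rule injD[OF \<open>inj f\<close>]) (simp add: \<phi>_def f.add ff distrib_left)
  moreover have "bij \<phi>"
  proof (rule o_bij)
    show "(\<lambda>v. (fst (f v), snd (f v) / a)) \<circ> \<phi> = id" using a by (auto simp: \<phi>_def ff)
    show "\<phi> \<circ> (\<lambda>v. (fst (f v), snd (f v) / a)) = id"
      using a by (auto simp: \<phi>_def gf)
  qed
  moreover have "connection_set q a = \<phi> ` hyperbola"
  proof (intro equalityI subsetI)
    fix v assume "v \<in> connection_set q a"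
    then have "fst (f v) * snd (f v) = a"
      using f(3)[of v] by (simp add: connection_set_def hyperbolic_plane_def binary_form_def)
    then have x: "fst (f v) \<noteq> 0" "snd (f v) = a * inverse (fst (f v))" using a by (auto simp: field_simps)
    have "v = \<phi> (fst (f v), inverse (fst (f v)))"
      unfolding \<phi>_def fst_conv snd_conv x(2)[symmetric] by (simp add: gf)
    then show "v \<in> \<phi> ` hyperbola" using x(1) unfolding hyperbola_def by blast
  next
    fix v assume "v \<in> \<phi> ` hyperbola"
    then obtain x where x: "x \<noteq> 0" "v = \<phi> (x, inverse x)" unfolding hyperbola_def by blast
    then have "f v = (x, a * inverse x)" by (simp add: \<phi>_def ff)
    then have "q v = a" using f(3)[of v] x(1)
      by (simp add: hyperbolic_plane_def binary_form_def mult.left_commute[of x])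
    then show "v \<in> connection_set q a" using a q0 by (auto simp: connection_set_def)
  qed
  ultimately show "CARD('a) \<le> 4 \<Longrightarrow> representation_diameter q a = \<infinity>"
    "CARD('a) \<ge> 5 \<Longrightarrow> (2::'a) \<noteq> 0 \<or> 8 dvd CARD('a) \<Longrightarrow> representation_diameter q a \<in> {3, 4}"
    using diameter_of_hyperbola by blast+
qed

subsection \<open>Quadratic spaces\<close>

locale quad_space = finite_dimensional_vector_space scale Basis
  for scale :: "'a::{field,finite} \<Rightarrow> 'v::ab_group_add \<Rightarrow> 'v" (infixr "*s" 75) and Basis +
  fixes q :: "'v \<Rightarrow> 'a"
  assumes quad: "quadratic_form (*s) q" and nondeg: "nondegenerate q"
begin

abbreviation "b \<equiv> polar_form q"

lemma q_scale [simp]: "q (c *s x) = c\<^sup>2 * q x"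
  using quad unfolding quadratic_form_def by blast

lemma b_right: "b x (y + z) = b x y + b x z" "b x (c *s y) = c * b x y"
proof -
  interpret l: Vector_Spaces.linear "(*s)" "(*)" "b x" using quad unfolding quadratic_form_def by blast
  show "b x (y + z) = b x y + b x z" "b x (c *s y) = c * b x y" by (rule l.add, rule l.scale)
qed

lemma b_sym: "b x y = b y x"
  by (simp add: polar_form_def add.commute)

lemma b_left: "b (y + z) x = b y x + b z x" "b (c *s y) x = c * b y x"
  using b_right by (metis b_sym)+

lemma b_0 [simp]: "b 0 x = 0" "b x 0 = 0"
  using b_left(2)[of 0 0 x] b_right(2)[of x 0 0] by simp_all

lemma b_minus [simp]: "b (- y) x = - b y x" "b x (- y) = - b x y"
  using b_left(2)[of "-1" y x] b_right(2)[of x "-1" y] by simp_all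

lemma b_diff: "b (y - z) x = b y x - b z x" "b x (y - z) = b x y - b x z"
  using b_left(1)[of y "- z" x] b_right(1)[of x y "- z"] by simp_all

lemmas b_simps = b_left b_right b_diff

lemma q_add: "q (x + y) = q x + q y + b x y"
  by (simp add: polar_form_def)

lemma q_minus [simp]: "q (- x) = q x"
  using q_scale[of "-1" x] by simp

lemma q_0 [simp]: "q 0 = 0"
  using q_scale[of 0 0] by simp

lemma q_diff: "q (x - y) = q x + q y - b x y"
  using q_add[of x "- y"] by simp

lemma b_self: "b x x = 2 * q x"
proof -
  have "q (2 *s x) = 4 * q x" by simp
  moreover have "2 *s x = x + x" using scale_left_distrib[of 1 1 x] by simp
  ultimately have "b x x = 4 * q x - q x - q x" by (simp add: polar_form_def)
  then show ?thesis by simp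
qed

lemma nondeg_b:
  assumes "x \<noteq> 0" obtains y where "b x y = 1"
proof -
  obtain y where "b x y \<noteq> 0" using nondeg assms unfolding nondegenerate_def by blast
  then have "b x (inverse (b x y) *s y) = 1" by (simp add: b_right)
  then show thesis by (rule that)
qed

lemma ksum_2I:
  assumes "a \<noteq> 0" "q v = a" "b w v = q w"
  shows "w \<in> ksum (connection_set q a) 2"
proof -
  have "q (w - v) = a" using assms by (simp add: q_diff)
  then have "v \<in> connection_set q a" "w - v \<in> connection_set q a"
    using assms by (auto simp: connection_set_def)
  moreover have "w = v + (w - v)" by simp
  ultimately show ?thesis unfolding ksum_2 by blast
qed

lemma scale_in_span: "c *s x \<in> span {x}"
  by (intro span_scale span_base) simp

lemma not_spanned:
  assumes "finite S" "card S < dim UNIV" obtains v where "v \<notin> span S"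
proof -
  have "\<not> UNIV \<subseteq> span S" using dim_le_card[OF _ assms(1), of UNIV] assms(2) by linarith
  then show thesis using that by blast
qed

lemma ex_nonzero: "1 \<le> dim UNIV \<Longrightarrow> \<exists>v::'v. v \<noteq> 0"
proof -
  assume "1 \<le> dim UNIV"
  then obtain v where "v \<notin> span {}" using not_spanned[of "{}"] by auto
  then show ?thesis by (intro exI[of _ v]) auto
qed

lemma ex_anisotropic_vector:
  assumes "subspace W" "x \<in> W" "y \<in> W" "b x y \<noteq> 0"
  shows "\<exists>z\<in>W. q z \<noteq> 0"
proof (rule ccontr)
  assume "\<not> ?thesis"
  then have "q x = 0" "q y = 0" "q (x + y) = 0" using assms subspace_add by blast+
  then show False using assms(4) by (simp add: q_add)
qed

text \<open>In characteristic 2 every field element is a square, so multiples of one vector of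
  nonzero value suffice. Otherwise two orthogonal vectors of nonzero value reduce the claim to a
  binary diagonal form. The vectors \<open>e\<close> and \<open>e'\<close> express that the
  dimension of \<open>W\<close> is at least 2 without reference to a basis of
  \<open>W\<close>.\<close>

lemma universal_on_subspace:
  assumes W: "subspace W" and nd: "\<And>x. x \<in> W \<Longrightarrow> x \<noteq> 0 \<Longrightarrow> \<exists>y\<in>W. b x y \<noteq> 0"
    and e: "e \<in> W" "e \<noteq> 0" "e' \<in> W" "e' \<notin> span {e}"
  shows "\<exists>g\<in>W. q g = c"
proof -
  obtain x where x: "x \<in> W" "q x \<noteq> 0" using nd[OF e(1,2)] ex_anisotropic_vector[OF W e(1)] by blast
  show ?thesis
  proof (cases "(2::'a) = 0")
    case True
    obtain t where "t\<^sup>2 = c / q x" using surj_square_char2[OF True] by (metis surjD)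
    then have "q (t *s x) = c" using x by simp
    then show ?thesis using x W subspace_scale by blast
  next
    case two: False
    define \<pi> where "\<pi> u = u - (b u x / (2 * q x)) *s x" for u
    have \<pi>W: "\<pi> u \<in> W" if "u \<in> W" for u
      unfolding \<pi>_def using that x W by (intro subspace_diff subspace_scale)
    have \<pi>x: "b (\<pi> u) x = 0" for u unfolding \<pi>_def using x two by (simp add: b_simps b_self)
    obtain u0 where u0: "u0 \<in> W" "u0 \<notin> span {x}"
    proof (cases "e \<in> span {x}")
      case True
      have "e' \<notin> span {x}"
      proof
        assume "e' \<in> span {x}"
        then obtain \<alpha> \<beta> where ab: "e = \<alpha> *s x" "e' = \<beta> *s x" using True by (auto simp: span_singleton)
        then have "\<alpha> \<noteq> 0" using e(2) by auto
        then have "e' = (\<beta> / \<alpha>) *s e" using ab by simp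
        then show False using e(4) scale_in_span by metis
      qed
      then show thesis using e(3) that by blast
    qed (use e(1) that in blast)
    let ?u = "\<pi> u0"
    have "?u \<noteq> 0"
    proof
      assume "?u = 0"
      then have "u0 = (b u0 x / (2 * q x)) *s x" unfolding \<pi>_def by simp
      then show False using u0(2) scale_in_span by metis
    qed
    then obtain z where z: "z \<in> W" "b ?u z \<noteq> 0" using nd \<pi>W u0 by blast
    have "b ?u (\<pi> z) = b ?u z" unfolding \<pi>_def[of z] b_diff b_right \<pi>x by simp
    then have uz: "b ?u (\<pi> z) \<noteq> 0" using z by simp
    have sub: "subspace {v \<in> W. b v x = 0}"
      using W by (auto simp: subspace_def b_simps)
    obtain y where y: "y \<in> W" "b y x = 0" "q y \<noteq> 0"
      using ex_anisotropic_vector[OF sub _ _ uz] \<pi>W \<pi>x u0 z by blast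
    obtain s t where st: "q x * s\<^sup>2 + q y * t\<^sup>2 = c"
      using binary_diagonal_universal[OF two x(2) y(3)] by blast
    have "q (s *s x + t *s y) = c" using st y(2) by (simp add: q_add b_simps b_sym[of x y] mult.commute)
    moreover have "s *s x + t *s y \<in> W" using x(1) y(1) W by (intro subspace_add subspace_scale)
    ultimately show ?thesis by (intro bexI)
  qed
qed

lemma universal:
  assumes "2 \<le> dim UNIV" shows "\<exists>g. q g = c"
proof -
  obtain e :: 'v where e: "e \<noteq> 0" using ex_nonzero assms by auto
  obtain e' where "e' \<notin> span {e}" using not_spanned[of "{e}"] assms by auto
  with e show ?thesis
    using universal_on_subspace[OF subspace_UNIV, of e e' c] nondeg_b by (metis UNIV_I zero_neq_one)
qed

lemma ex_nonzero_value:
  assumes "1 \<le> dim UNIV" shows "\<exists>x. q x \<noteq> 0"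
proof -
  obtain e :: 'v where e: "e \<noteq> 0" using ex_nonzero[OF assms] by auto
  obtain y where "b e y = 1" using e by (rule nondeg_b)
  then show ?thesis using ex_anisotropic_vector[OF subspace_UNIV, of e y] by auto
qed

lemma universal_perp:
  assumes two: "(2::'a) \<noteq> 0" and n: "3 \<le> dim UNIV" and x: "q x \<noteq> 0"
  shows "\<exists>g. b g x = 0 \<and> q g = c"
proof -
  define \<pi> where "\<pi> u = u - (b u x / (2 * q x)) *s x" for u
  let ?W = "{v. b v x = 0}"
  have \<pi>x: "\<pi> u \<in> ?W" for u unfolding \<pi>_def using x two by (simp add: b_simps b_self)
  have W: "subspace ?W" by (auto simp: subspace_def b_simps)
  have nd: "\<exists>y\<in>?W. b u y \<noteq> 0" if u: "u \<in> ?W" "u \<noteq> 0" for u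
  proof -
    obtain y where "b u y = 1" using u(2) by (rule nondeg_b)
    then have "b u (\<pi> y) \<noteq> 0" using u unfolding \<pi>_def by (simp add: b_simps)
    then show ?thesis using \<pi>x by blast
  qed
  have in_span: "u \<in> span S" if "\<pi> u \<in> span S" "x \<in> S" for u S
  proof -
    have "u = \<pi> u + (b u x / (2 * q x)) *s x" unfolding \<pi>_def by simp
    then show ?thesis using that by (metis span_add span_base span_scale)
  qed
  obtain e where e: "e \<notin> span {x}" using not_spanned[of "{x}"] n by auto
  have "card {x, \<pi> e} < dim UNIV" using card_insert_le_m1[of 2 "{\<pi> e}" x] n by simp
  then obtain e' where e': "e' \<notin> span {x, \<pi> e}" using not_spanned[of "{x, \<pi> e}"] by auto
  have "\<pi> e \<noteq> 0" using e in_span[of e "{x}"] by (metis insertI1 span_zero)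
  moreover have "\<pi> e' \<notin> span {\<pi> e}"
    using e' in_span[of e' "{x, \<pi> e}"] span_mono[of "{\<pi> e}" "{x, \<pi> e}"] by blast
  ultimately show ?thesis using universal_on_subspace[OF W nd, of "\<pi> e" "\<pi> e'" c] \<pi>x by blast
qed

text \<open>Only the polar form is constrained, not the values of \<open>q\<close>. This covers
  hyperbolic pairs in every characteristic and, in characteristic 2, also pairs of vectors of
  nonzero value.\<close>

definition alternating_pair where
  "alternating_pair w w' \<longleftrightarrow> b w w = 0 \<and> b w' w' = 0 \<and> b w w' = 1"

text \<open>Orthogonal projection onto the complement of the plane of the pair. The coefficients are
  crossed because \<open>w\<close> and \<open>w'\<close> are dual to each other; the signs fit since
  an alternating \<open>b w w\<close> vanishes while \<open>b\<close> stays symmetric.\<close>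

definition pair_proj where
  "pair_proj w w' v = v - b v w' *s w - b v w *s w'"

lemma pair_proj:
  assumes "alternating_pair w w'"
  shows "b (pair_proj w w' v) w = 0" "b (pair_proj w w' v) w' = 0"
    and "b u w = 0 \<Longrightarrow> b u w' = 0 \<Longrightarrow> b u (pair_proj w w' v) = b u v"
    and "pair_proj w w' v \<in> span S \<Longrightarrow> w \<in> S \<Longrightarrow> w' \<in> S \<Longrightarrow> v \<in> span S"
proof -
  have p: "b w w = 0" "b w' w' = 0" "b w w' = 1" "b w' w = 1"
    using assms b_sym[of w w'] unfolding alternating_pair_def by auto
  show "b (pair_proj w w' v) w = 0" "b (pair_proj w w' v) w' = 0"
    and "b u w = 0 \<Longrightarrow> b u w' = 0 \<Longrightarrow> b u (pair_proj w w' v) = b u v"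
    unfolding pair_proj_def using p by (simp_all add: b_simps)
  assume S: "pair_proj w w' v \<in> span S" "w \<in> S" "w' \<in> S"
  have "v = pair_proj w w' v + b v w' *s w + b v w *s w'" unfolding pair_proj_def by simp
  then show "v \<in> span S" using S by (metis span_add span_base span_scale)
qed

lemma pair_complement_universal:
  assumes p: "alternating_pair w w'" and n: "4 \<le> dim UNIV"
  shows "\<exists>g. b g w = 0 \<and> b g w' = 0 \<and> q g = c"
proof -
  let ?W = "{v. b v w = 0 \<and> b v w' = 0}" and ?\<pi> = "pair_proj w w'"
  have W: "subspace ?W" by (auto simp: subspace_def b_simps)
  have nd: "\<exists>y\<in>?W. b u y \<noteq> 0" if u: "u \<in> ?W" "u \<noteq> 0" for u
  proof -
    obtain y where "b u y = 1" using u(2) by (rule nondeg_b)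
    then have "b u (?\<pi> y) \<noteq> 0" using pair_proj(3)[OF p, of u y] u by simp
    then show ?thesis using pair_proj(1,2)[OF p] by blast
  qed
  have "card {w, w'} < dim UNIV" using card_insert_le_m1[of 2 "{w'}" w] n by simp
  then obtain e where e: "e \<notin> span {w, w'}" using not_spanned[of "{w, w'}"] by auto
  have "card {w, w', ?\<pi> e} < dim UNIV"
    using card_insert_le_m1[of 3 "{w', ?\<pi> e}" w] card_insert_le_m1[of 2 "{?\<pi> e}" w'] n by simp
  then obtain e' where e': "e' \<notin> span {w, w', ?\<pi> e}" using not_spanned[of "{w, w', ?\<pi> e}"] by auto
  have "?\<pi> e \<noteq> 0" using e pair_proj(4)[OF p, of e "{w, w'}"] span_zero by auto
  moreover have "?\<pi> e' \<notin> span {?\<pi> e}"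
    using e' pair_proj(4)[OF p, of e' "{w, w', ?\<pi> e}"] span_mono[of "{?\<pi> e}" "{w, w', ?\<pi> e}"] by blast
  ultimately show ?thesis
    using universal_on_subspace[OF W nd, of "?\<pi> e" "?\<pi> e'" c] pair_proj(1,2)[OF p] by blast
qed

lemma hyperbolic_pair:
  assumes "w \<noteq> 0" "q w = 0"
  obtains w' where "q w' = 0" "b w w' = 1" "alternating_pair w w'"
proof -
  obtain y where y: "b w y = 1" using assms(1) by (rule nondeg_b)
  let ?w' = "y - q y *s w"
  have "q ?w' = 0" using y assms by (simp add: q_diff b_simps b_sym[of y w])
  moreover have "b w ?w' = 1" using y assms by (simp add: b_simps b_self)
  ultimately show thesis using that[of ?w'] assms by (simp add: alternating_pair_def b_self)
qed

text \<open>In odd characteristic the value \<open>- q x\<close> occurs in the complement of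
  \<open>x\<close>. In characteristic 2 a vector \<open>y\<close> orthogonal to \<open>x\<close> and
  independent of it can be scaled to the value \<open>q x\<close>, and then the sum has value
  \<open>2 * q x = 0\<close>.\<close>

lemma isotropic_vector:
  assumes n: "3 \<le> dim UNIV" shows "\<exists>w. w \<noteq> 0 \<and> q w = 0"
proof -
  obtain x :: 'v where x: "x \<noteq> 0" using ex_nonzero n by auto
  show ?thesis
  proof (cases "q x = 0")
    case qx: False
    show ?thesis
    proof (cases "(2::'a) = 0")
      case False
      then obtain g where g: "b g x = 0" "q g = - q x" using universal_perp[OF _ n qx] by blast
      have "q (x + g) = 0" using g by (simp add: q_add b_sym[of x g])
      moreover have "x + g \<noteq> 0"
      proof
        assume "x + g = 0"
        then have "b (x + g) x = 0" by simp
        then show False using g False qx by (simp add: b_simps b_self)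
      qed
      ultimately show ?thesis by blast
    next
      case two: True
      obtain e where e: "e \<notin> span {x}" using not_spanned[of "{x}"] n by auto
      have "card {x, e} < dim UNIV" using card_insert_le_m1[of 2 "{e}" x] n by simp
      then obtain e' where e': "e' \<notin> span {x, e}" using not_spanned[of "{x, e}"] by auto
      obtain y where y: "b x y = 0" "y \<notin> span {x}"
      proof (cases "b x e = 0")
        case False
        let ?y = "e' - (b x e' / b x e) *s e"
        have "?y \<notin> span {x}"
        proof
          assume "?y \<in> span {x}"
          then have "?y \<in> span {x, e}" using span_mono[of "{x}" "{x, e}"] by auto
          moreover have "(b x e' / b x e) *s e \<in> span {x, e}" by (intro span_scale span_base) simp
          ultimately have "?y + (b x e' / b x e) *s e \<in> span {x, e}" by (rule span_add)
          then show False using e' by simp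
        qed
        moreover have "b x ?y = 0" using False by (simp add: b_simps)
        ultimately show thesis using that by blast
      qed (use e that in blast)
      show ?thesis
      proof (cases "q y = 0")
        case True
        then show ?thesis using y(2) span_zero by metis
      next
        case False
        obtain t where t: "t\<^sup>2 = q x / q y" using surj_square_char2[OF two] by (metis surjD)
        have "q (x + t *s y) = 2 * q x" using t False y by (simp add: q_add b_simps)
        moreover have "x + t *s y \<noteq> 0"
        proof
          assume z: "x + t *s y = 0"
          have "t \<noteq> 0" using t qx False by auto
          have "y = (- inverse t) *s x"
          proof -
            have "inverse t *s (x + t *s y) = 0" using z by simp
            then have "inverse t *s x + y = 0" using \<open>t \<noteq> 0\<close> by (simp add: scale_right_distrib)
            then show ?thesis by (simp add: add_eq_0_iff)
          qed
          then show False using y(2) scale_in_span by metis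
        qed
        ultimately show ?thesis using two by (intro exI[of _ "x + t *s y"]) simp
      qed
    qed
  qed (use x in blast)
qed

section \<open>Value zero, and dimension at least four\<close>

lemma not_ksum_less_2:
  assumes "w \<noteq> 0" "q w \<noteq> a" "j < 2" shows "w \<notin> ksum (connection_set q a) j"
proof -
  have "j = 0 \<or> j = 1" using assms(3) by linarith
  moreover have "w \<notin> ksum (connection_set q a) 0" using assms by auto
  moreover have "w \<notin> ksum (connection_set q a) 1" unfolding ksum_1 using assms by (simp add: connection_set_def)
  ultimately show ?thesis by metis
qed

text \<open>For \<open>q w \<noteq> 0\<close> it suffices to find an isotropic \<open>v\<close> not
  orthogonal to \<open>w\<close>: the multiple of \<open>v\<close> with \<open>b w v = q w\<close>
  leaves an isotropic remainder.\<close>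

lemma diameter_isotropic_0:
  assumes "isotropic q" and n: "1 \<le> dim UNIV"
  shows "representation_diameter q 0 = enat 2"
proof -
  let ?C = "connection_set q 0"
  obtain u where u: "u \<noteq> 0" "q u = 0" using assms(1) unfolding isotropic_def by blast
  obtain u' where u': "q u' = 0" "b u u' = 1" "alternating_pair u u'" using hyperbolic_pair[OF u] .
  have reach: "\<exists>j\<le>2. w \<in> ksum ?C j" for w
  proof (cases "q w = 0")
    case True
    then have "w = 0 \<or> w \<in> ?C" by (simp add: connection_set_def)
    then show ?thesis
    proof
      assume "w \<in> ?C" then show ?thesis using ksum_1[of ?C] by (intro exI[of _ 1]) simp
    qed (auto intro: exI[of _ 0])
  next
    case False
    have "\<exists>v. q v = 0 \<and> b w v \<noteq> 0"
    proof (rule ccontr)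
      assume neg: "\<not> ?thesis"
      then have wu: "b w u = 0" "b w u' = 0" using u u' by auto
      have "w \<noteq> 0" using False by auto
      then obtain y where y: "b w y = 1" by (rule nondeg_b)
      let ?y = "pair_proj u u' y"
      \<comment> \<open>The vector \<open>u - q ?y *s u'\<close> of the hyperbolic plane has value
        \<open>- q ?y\<close> and is orthogonal to \<open>w\<close>. It makes \<open>?y\<close>
        isotropic without changing the product with \<open>w\<close>.\<close>
      let ?v = "?y + (u - q ?y *s u')"
      have "b w ?y = 1" using pair_proj(3)[OF u'(3), of w y] wu y by simp
      then have "b w ?v = 1" using wu by (simp add: b_simps)
      moreover have "q ?v = 0"
        using u u' pair_proj(1,2)[OF u'(3), of y] by (simp add: q_add q_diff b_simps)
      ultimately show False using neg by (metis zero_neq_one)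
    qed
    then obtain v where v: "q v = 0" "b w v \<noteq> 0" by blast
    let ?v = "(q w / b w v) *s v"
    have "q ?v = 0" "q (w - ?v) = 0" using v by (simp_all add: q_diff b_simps)
    moreover have "?v \<noteq> 0" using False v by auto
    moreover have "w - ?v \<noteq> 0"
    proof
      assume "w - ?v = 0"
      then have "q w = q ?v" by simp
      then show False using False \<open>q ?v = 0\<close> by simp
    qed
    ultimately have "?v \<in> ?C" "w - ?v \<in> ?C" by (simp_all add: connection_set_def)
    moreover have "w = ?v + (w - ?v)" by simp
    ultimately have "w \<in> ksum ?C 2" unfolding ksum_2 by blast
    then show ?thesis by blast
  qed
  obtain w where w: "q w \<noteq> 0" using ex_nonzero_value[OF n] by blast
  then have "w \<noteq> 0" by auto
  then have "w \<notin> ksum ?C j" if "j < 2" for j using w that by (rule not_ksum_less_2)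
  with reach show ?thesis by (rule diameter_eq)
qed

lemma diameter_anisotropic_0:
  assumes "anisotropic q" and n: "1 \<le> dim UNIV"
  shows "representation_diameter q 0 = \<infinity>"
proof -
  have "connection_set q 0 = {}" using assms(1) unfolding connection_set_def isotropic_def by auto
  moreover obtain w :: 'v where "w \<noteq> 0" using ex_nonzero[OF n] by blast
  ultimately show ?thesis using ksum_empty by (intro diameter_infinity[of w]) auto
qed

text \<open>The symmetric decomposition of \<open>w\<close> into \<open>w / 2 + g\<close> and
  \<open>w / 2 - g\<close> with \<open>g\<close> orthogonal to \<open>w\<close> leaves only the
  value of \<open>g\<close> to be prescribed.\<close>

lemma ksum_2_odd:
  assumes two: "(2::'a) \<noteq> 0" and n: "3 \<le> dim UNIV" and a: "a \<noteq> 0" and w: "q w \<noteq> 0"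
  shows "w \<in> ksum (connection_set q a) 2"
proof -
  obtain g where g: "b g w = 0" "q g = a - q w / 4" using universal_perp[OF two n w] by blast
  have four: "(4::'a) = 2\<^sup>2" by simp
  let ?v = "(1 / 2) *s w + g"
  have "q ?v = a" unfolding q_add using g two by (simp add: b_simps b_sym[of w g] power_divide)
  moreover have "b w ?v = q w" using g two by (simp add: b_simps b_sym[of w g] b_self)
  ultimately show ?thesis by (rule ksum_2I[OF a])
qed

lemma diameter_dim_ge_4:
  assumes n: "4 \<le> dim UNIV" and a: "a \<noteq> 0"
  shows "representation_diameter q a = enat 2"
proof -
  obtain u where u: "u \<noteq> 0" "q u = 0" using isotropic_vector n by auto
  show ?thesis
  proof (rule diameter_eq)
    show "u \<notin> ksum (connection_set q a) j" if "j < 2" for j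
      using not_ksum_less_2[OF u(1) _ that] u a by simp
    fix w
    have "w = 0 \<or> w \<in> ksum (connection_set q a) 2"
    proof (rule disjCI)
      assume w0: "\<not> w \<in> ksum (connection_set q a) 2"
      show "w = 0"
      proof (rule ccontr)
        assume "w \<noteq> 0"
        have "2 * q w = 0"
          using w0 ksum_2_odd[OF _ _ a, of w] n by auto
        then have ww: "b w w = 0" by (simp add: b_self)
        obtain w' where "b w w' = 1" and w': "b w' w' = 0"
        proof (cases "q w = 0")
          case True
          then show thesis using hyperbolic_pair[OF \<open>w \<noteq> 0\<close>] that by (metis alternating_pair_def)
        next
          case False
          then have "(2::'a) = 0" using \<open>2 * q w = 0\<close> by simp
          then show thesis using nondeg_b[OF \<open>w \<noteq> 0\<close>] that by (metis b_self mult_zero_left)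
        qed
        then have p: "alternating_pair w w'" using ww by (simp add: alternating_pair_def)
        obtain g where g: "b g w = 0" "b g w' = 0" "q g = a - (q w)\<^sup>2 * q w'"
          using pair_complement_universal[OF p n] by blast
        \<comment> \<open>The multiple of \<open>w'\<close> puts \<open>?v\<close> on the required
          affine hyperplane, and \<open>g\<close>, orthogonal to both \<open>w\<close> and
          \<open>w'\<close>, corrects its value to \<open>a\<close>.\<close>
        let ?v = "q w *s w' + g"
        have "q ?v = a" using g by (simp add: q_add b_simps b_sym[of w' g])
        moreover have "b w ?v = q w" using g \<open>b w w' = 1\<close> by (simp add: b_simps b_sym[of w g])
        ultimately show False using w0 ksum_2I[OF a] by blast
      qed
    qed
    then show "\<exists>j\<le>2. w \<in> ksum (connection_set q a) j"
    proof
      assume "w = 0" then show ?thesis by (intro exI[of _ 0]) simp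
    qed blast
  qed
qed

end

subsection \<open>Planes\<close>

lemma ksum_invariant:
  assumes f: "\<And>x y. f (x + y) = f x + f y" "\<And>x. x \<in> C \<Longrightarrow> f x \<in> C"
  shows "x \<in> ksum C k \<Longrightarrow> f x \<in> ksum C k"
proof (induction k arbitrary: x)
  case 0
  have "f 0 + 0 = f 0 + f 0" using f(1)[of 0 0] by (simp only: add_0_right)
  then have "f 0 = 0" unfolding add_left_cancel by (rule sym)
  then show ?case using 0 by simp
next
  case (Suc k)
  then obtain c y where "x = c + y" "c \<in> C" "y \<in> ksum C k" by auto
  then have "f x = f c + f y" "f c \<in> C" "f y \<in> ksum C k" using f Suc.IH by simp_all
  then show ?case unfolding ksum.simps by blast
qed

lemma vector_space_plane_scale: "vector_space plane_scale"
  by unfold_locales (simp_all add: plane_scale_def algebra_simps)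

text \<open>The ratio \<open>t\<close> serves to build a value
  \<open>a * ((1 + t) * (1 + t) / t)\<close>: \<open>t \<noteq> -1\<close> makes it nonzero and the
  last condition makes it differ from \<open>a\<close>. Five excluded elements are too many to count
  around in the field of 5 elements, where \<open>t = 2\<close> works.\<close>

lemma ex_generic_ratio:
  assumes "CARD('a::{field,finite}) \<ge> 5"
  obtains t :: "'a::{field,finite}" where "t \<noteq> 0" "t \<noteq> 1" "t \<noteq> -1" "t\<^sup>2 + t + 1 \<noteq> 0"
proof (cases "CARD('a) = 5")
  case True
  then have five: "(5::'a) = 0" using of_nat_CARD_eq_0[where 'a='a] by simp
  have two: "(2::'a) \<noteq> 0" using even_CARD[where 'a='a] True by auto
  have three: "(3::'a) \<noteq> 0"
  proof
    assume "(3::'a) = 0"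
    moreover have "(2::'a) = 5 - 3" by simp
    ultimately have "(2::'a) = 0 - 0" using five by metis
    then show False using two by simp
  qed
  have "(2::'a) \<noteq> -1"
  proof
    assume "(2::'a) = -1"
    moreover have "(3::'a) = 2 + 1" by simp
    ultimately have "(3::'a) = -1 + 1" by metis
    then show False using three by simp
  qed
  moreover have "(2::'a)\<^sup>2 + 2 + 1 \<noteq> 0"
  proof
    assume "(2::'a)\<^sup>2 + 2 + 1 = 0"
    moreover have "(2::'a)\<^sup>2 + 2 + 1 = 5 + 2" by simp
    ultimately have "(0::'a) + 2 = 0" using five by metis
    then show False using two by simp
  qed
  moreover have "(2::'a) \<noteq> 1" by (metis add_left_cancel add_0_right one_add_one zero_neq_one)
  ultimately show thesis using that[of 2] two by blast
next
  case False
  let ?R = "{s::'a. s\<^sup>2 + 1 * s + 1 = 0}"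
  have "card ({0, 1, -1} \<union> ?R) \<le> card {0, 1, -1::'a} + card ?R" by (rule card_Un_le)
  also have "\<dots> \<le> 3 + 2"
    using card_quadratic_roots_le[of "1::'a" 1]
      card_insert_le_m1[of 3 "{1, -1}" "0::'a"] card_insert_le_m1[of 2 "{-1}" "1::'a"]
    by (intro add_mono) simp_all
  also have "\<dots> < CARD('a)" using assms False by simp
  finally obtain t where "t \<notin> {0, 1, -1} \<union> ?R" using card_UNIV_obtain[of "{0, 1, -1} \<union> ?R"] by auto
  then show thesis using that[of t] by simp
qed

context quad_space
begin

lemma coefficient_eq_0:
  assumes "u \<notin> span {w}" "\<alpha> *s u = \<beta> *s w" shows "\<alpha> = 0"
proof (rule ccontr)
  assume "\<alpha> \<noteq> 0"
  then have "u = inverse \<alpha> *s (\<alpha> *s u)" by simp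
  also have "\<dots> = (inverse \<alpha> * \<beta>) *s w" unfolding assms(2) by simp
  finally show False using assms(1) scale_in_span by metis
qed

lemma span_pair:
  assumes "v \<in> span {e, f}" obtains x y where "v = x *s e + y *s f"
proof -
  obtain x where "v - x *s e \<in> span {f}" using assms span_breakdown_eq[of v e "{f}"] by blast
  then obtain y where "v - x *s e = y *s f" by (auto simp: span_singleton)
  then have "v = x *s e + y *s f" by (simp add: algebra_simps)
  then show thesis by (rule that)
qed

lemma plane_coordinates:
  assumes n: "dim UNIV = 2" and e: "e \<noteq> 0" "f \<notin> span {e}"
  obtains x y where "v = x *s e + y *s f"
proof -
  have i: "independent {f, e}" using e by (intro independent_insertI) (simp_all add: dependent_def)
  have "f \<noteq> e" using e span_base[of e "{e}"] by auto
  then have "card {f, e} = 2" by simp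
  then have "UNIV \<subseteq> span {f, e}" using n by (intro card_ge_dim_independent[OF _ i]) simp_all
  then have "v \<in> span {e, f}" by (simp add: insert_commute subset_eq)
  then show thesis using span_pair that by blast
qed

lemma isotropic_plane_isometric:
  assumes n: "dim UNIV = 2" and "isotropic q"
  shows "isometric (*s) q plane_scale hyperbolic_plane"
proof -
  obtain w where w: "w \<noteq> 0" "q w = 0" using assms(2) unfolding isotropic_def by blast
  obtain w' where w': "q w' = 0" "b w w' = 1" "alternating_pair w w'" using hyperbolic_pair[OF w] .
  have p: "b w w = 0" "b w' w' = 0" "b w' w = 1"
    using w' b_sym[of w w'] unfolding alternating_pair_def by auto
  have "w' \<notin> span {w}"
  proof
    assume "w' \<in> span {w}"
    then obtain c where "w' = c *s w" by (auto simp: span_singleton)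
    then show False using w'(2) p(1) by (simp add: b_simps)
  qed
  note coords = plane_coordinates[OF n w(1) this]
  define f where "f v = (b v w', b v w)" for v
  have fv: "f (x *s w + y *s w') = (x, y)" for x y
    unfolding f_def using p w' by (simp add: b_simps)
  have "Vector_Spaces.linear (*s) plane_scale f"
    unfolding Vector_Spaces.linear_iff using vector_space_plane_scale vector_space_axioms
    by (auto simp: f_def b_simps plane_scale_def)
  moreover have "bij f"
  proof (rule bijI)
    show "inj f"
    proof (rule injI)
      fix u v assume eq: "f u = f v"
      obtain x y where u: "u = x *s w + y *s w'" using coords .
      obtain x' y' where v: "v = x' *s w + y' *s w'" using coords .
      show "u = v" using eq unfolding u v fv by simp
    qed
    show "surj f" unfolding surj_def
    proof
      fix z show "\<exists>v. z = f v" using fv[of "fst z" "snd z"] by (intro exI) (auto simp: eq_commute)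
    qed
  qed
  moreover have "hyperbolic_plane (f v) = q v" for v
  proof -
    obtain x y where v: "v = x *s w + y *s w'" using coords .
    show ?thesis unfolding v fv using w w' by (simp add: hyperbolic_plane_def binary_form_def q_add b_simps)
  qed
  ultimately show ?thesis unfolding isometric_def by blast
qed

definition reflection where
  "reflection u x = x - (b x u / q u) *s u"

lemma reflection_add: "reflection u (x + y) = reflection u x + reflection u y"
  by (simp add: reflection_def b_simps add_divide_distrib scale_left_distrib)

lemma q_reflection:
  assumes "q u \<noteq> 0" shows "q (reflection u x) = q x"
  unfolding reflection_def q_diff using assms by (simp add: b_simps power_divide) (simp add: power2_eq_square)

text \<open>For equal values \<open>b x (x - y) = q (x - y)\<close>, so the coefficient in the
  reflection is 1. Dividing by \<open>q u\<close> rather than by \<open>b u u\<close> keeps this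
  valid in characteristic 2.\<close>

lemma reflection_swap:
  assumes "q x = q y" "q (x - y) \<noteq> 0" shows "reflection (x - y) x = y"
proof -
  have "b x (x - y) = q (x - y)" using assms(1) by (simp add: q_diff b_simps b_self)
  then show ?thesis using assms(2) by (simp add: reflection_def)
qed

end

section \<open>Anisotropic planes\<close>

locale anisotropic_plane = quad_space scale Basis q
  for scale :: "'a::{field,finite} \<Rightarrow> 'v::ab_group_add \<Rightarrow> 'v" (infixr "*s" 75) and Basis q +
  assumes dim2: "dim UNIV = 2" and aniso: "\<And>v. q v = 0 \<Longrightarrow> v = 0"
begin

text \<open>Anisotropy makes the reflection along any nonzero difference available, so membership in
  \<open>ksum\<close> depends on the value of the vector only.\<close>

lemma ksum_same_value:
  assumes "x \<in> ksum (connection_set q a) k" "q x = q y"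
  shows "y \<in> ksum (connection_set q a) k"
proof (cases "x = y")
  case False
  then have u: "q (x - y) \<noteq> 0" using aniso[of "x - y"] by auto
  have "reflection (x - y) v \<in> connection_set q a" if "v \<in> connection_set q a" for v
    using that q_reflection[OF u, of v] aniso[of v] by (auto simp: connection_set_def)
  from ksum_invariant[of "reflection (x - y)", OF reflection_add this assms(1)]
  show ?thesis using reflection_swap[OF assms(2) u] by simp
qed (use assms in simp)

lemma perp_line:
  assumes "w \<noteq> 0" "b w g = 0" "g \<noteq> 0" "b w h = 0" obtains c where "h = c *s g"
proof (cases "h \<in> span {g}")
  case True
  then show thesis using that by (auto simp: span_singleton)
next
  case False
  obtain y where y: "b w y = 1" using assms(1) by (rule nondeg_b)
  obtain s t where "y = s *s g + t *s h" using plane_coordinates[OF dim2 assms(3) False] .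
  then have "b w y = 0" using assms by (simp add: b_simps)
  then show thesis using y by simp
qed

text \<open>Prescribing \<open>q (w - v)\<close> prescribes \<open>b w v\<close>, which confines
  \<open>v\<close> to a line. Restricted to it, \<open>q v = a\<close> is a quadratic equation with
  nonzero leading coefficient \<open>q ?g\<close>; with two solutions at the parameters 0 and 1
  there is no third.\<close>

lemma level_fibre:
  assumes w: "w \<noteq> 0" and P: "\<And>v. v \<in> P \<Longrightarrow> q v = a"
  shows "card {v \<in> P. q (w - v) = y} \<le> 2"
proof -
  let ?F = "{v \<in> P. q (w - v) = y}"
  have bw: "b w v = q w + a - y" if "v \<in> ?F" for v
    using that P[of v] by (auto simp: q_diff algebra_simps)
  show ?thesis
  proof (cases "\<exists>v0 v1. v0 \<in> ?F \<and> v1 \<in> ?F \<and> v0 \<noteq> v1")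
    case True
    then obtain v0 v1 where v: "v0 \<in> ?F" "v1 \<in> ?F" "v0 \<noteq> v1" by blast
    let ?g = "v1 - v0"
    have g: "?g \<noteq> 0" "b w ?g = 0" using v bw[of v0] bw[of v1] by (simp_all add: b_simps)
    have "q (v0 + ?g) = a" using v P by simp
    then have e1: "q ?g + b v0 ?g = 0" using v P unfolding q_add by simp
    have "v \<in> {v0, v1}" if vF: "v \<in> ?F" for v
    proof -
      have "b w (v - v0) = 0" using bw[OF vF] bw[OF v(1)] by (simp add: b_simps)
      then obtain c where c: "v - v0 = c *s ?g" using perp_line[OF w g(2,1)] by blast
      then have vc: "v = v0 + c *s ?g" by (simp add: algebra_simps)
      have "q v = a" "q v0 = a" using vF v(1) P by auto
      then have "c\<^sup>2 * q ?g + c * b v0 ?g = 0" unfolding vc q_add b_simps q_scale by simp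
      moreover have "b v0 ?g = - q ?g" using e1 by (simp add: eq_neg_iff_add_eq_0 add.commute)
      ultimately have "c * (c - 1) * q ?g = 0" by (simp add: algebra_simps power2_eq_square)
      moreover have "q ?g \<noteq> 0" using aniso[of ?g] g(1) by blast
      ultimately have "c = 0 \<or> c = 1" by simp
      then show ?thesis using vc by auto
    qed
    then have "card ?F \<le> card {v0, v1}" by (intro card_mono) auto
    then show ?thesis using v(3) by simp
  next
    case False
    then have "?F = {} \<or> (\<exists>v. ?F = {v})" by blast
    then show ?thesis
    proof
      assume "\<exists>v. ?F = {v}"
      then obtain v where e: "?F = {v}" by blast
      show ?thesis unfolding e by simp
    next
      assume e: "?F = {}"
      show ?thesis unfolding e by simp
    qed
  qed
qed

text \<open>The points of value \<open>a\<close> are produced as mirror images of \<open>w\<close>: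
  the directions \<open>u + x *s w\<close> give one for each field element \<open>x\<close>, and the
  direction \<open>w\<close> gives \<open>- w\<close>. A repetition forces equal coefficients
  \<open>\<kappa>\<close>, and \<open>\<kappa>\<close> vanishes at most once: never in
  characteristic 2, where \<open>b w u \<noteq> 0\<close>, and otherwise only where
  \<open>b w u + 2 * a * x = 0\<close>.\<close>

lemma many_vectors:
  assumes a: "a \<noteq> 0" and w: "q w = a"
  obtains P where "finite P" "\<And>v. v \<in> P \<Longrightarrow> q v = a" "card P = CARD('a) + 1"
proof -
  have w0: "w \<noteq> 0" using a w by auto
  obtain e where e: "e \<notin> span {w}" using not_spanned[of "{w}"] dim2 by auto
  obtain u where u: "u \<notin> span {w}" "(2::'a) \<noteq> 0 \<Longrightarrow> b w u = 0" "(2::'a) = 0 \<Longrightarrow> b w u \<noteq> 0"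
  proof (cases "(2::'a) = 0")
    case True
    have "b w e \<noteq> 0"
    proof
      assume we: "b w e = 0"
      obtain y where y: "b w y = 1" using w0 by (rule nondeg_b)
      obtain s t where "y = s *s w + t *s e" using plane_coordinates[OF dim2 w0 e] .
      then have "b w y = 0" using we True by (simp add: b_simps b_self)
      then show False using y by simp
    qed
    then show thesis using that[of e] e True by simp
  next
    case False
    let ?u = "e - (b w e / (2 * a)) *s w"
    have "?u \<notin> span {w}"
    proof
      assume "?u \<in> span {w}"
      then have "?u + (b w e / (2 * a)) *s w \<in> span {w}" by (intro span_add scale_in_span)
      then show False using e by simp
    qed
    moreover have "b w ?u = 0" using False a w by (simp add: b_simps b_self)
    ultimately show thesis using that[of ?u] False by simp
  qed
  define \<kappa> where "\<kappa> x = b w (u + x *s w) / q (u + x *s w)" for x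
  define f where "f x = reflection (u + x *s w) w" for x
  have f_eq: "f x = w - (\<kappa> x *s u + (\<kappa> x * x) *s w)" for x
    unfolding f_def reflection_def \<kappa>_def[symmetric] by (simp add: scale_right_distrib)
  have qne: "q (u + x *s w) \<noteq> 0" for x
  proof
    assume "q (u + x *s w) = 0"
    then have "u = (- x) *s w" using aniso[of "u + x *s w"] by (simp add: eq_neg_iff_add_eq_0)
    then show False using u(1) scale_in_span by metis
  qed
  have qf: "q (f x) = a" for x unfolding f_def q_reflection[OF qne] by (rule w)
  have \<kappa>0: "b w u + 2 * a * x = 0" if "\<kappa> x = 0" for x
    using that qne[of x] w unfolding \<kappa>_def by (simp add: b_simps b_self mult.commute)
  have \<kappa>_two: "\<kappa> x \<noteq> 0" if "(2::'a) = 0" for x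
    using \<kappa>0[of x] u(3)[OF that] that by auto
  have "inj f"
  proof (rule injI)
    fix x y assume "f x = f y"
    then have eq: "\<kappa> x *s u + (\<kappa> x * x) *s w = \<kappa> y *s u + (\<kappa> y * y) *s w"
      unfolding f_eq diff_conv_add_uminus add_left_cancel neg_equal_iff_equal .
    then have "(\<kappa> x - \<kappa> y) *s u = (\<kappa> y * y - \<kappa> x * x) *s w" by (simp add: algebra_simps)
    then have k: "\<kappa> x = \<kappa> y" using coefficient_eq_0[OF u(1)] by fastforce
    then have "\<kappa> x * x = \<kappa> x * y" using eq w0 by simp
    then show "x = y"
    proof (cases "\<kappa> x = 0")
      case True
      then have "2 * a * x = 2 * a * y" using \<kappa>0[of x] \<kappa>0[of y] k by (metis add_left_cancel)
      then show ?thesis using True \<kappa>_two a by auto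
    qed simp
  qed
  moreover have "- w \<notin> range f"
  proof
    assume "- w \<in> range f"
    then obtain x where "- w = f x" by blast
    then have "\<kappa> x *s u + (\<kappa> x * x) *s w = 2 *s w"
      unfolding f_eq using scale_left_distrib[of 1 1 w] by (simp add: algebra_simps)
    then have eq: "\<kappa> x *s u = (2 - \<kappa> x * x) *s w" by (simp add: algebra_simps)
    then have k: "\<kappa> x = 0" using coefficient_eq_0[OF u(1)] by blast
    then have "(2::'a) = 0" using eq w0 by simp
    then show False using \<kappa>_two k by blast
  qed
  ultimately have "card (insert (- w) (range f)) = CARD('a) + 1" by (simp add: card_image)
  moreover have "q v = a" if "v \<in> insert (- w) (range f)" for v using that qf w by auto
  ultimately show thesis using that[of "insert (- w) (range f)"] by simp
qed

lemma connection_setI: "a \<noteq> 0 \<Longrightarrow> q v = a \<Longrightarrow> v \<in> connection_set q a"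
  by (auto simp: connection_set_def)

lemma ksum_2_add: "a \<noteq> 0 \<Longrightarrow> q u = a \<Longrightarrow> q v = a \<Longrightarrow> u + v \<in> ksum (connection_set q a) 2"
  unfolding ksum_2 using connection_setI by blast

lemma reach_3:
  assumes a: "a \<noteq> 0" and w: "w \<noteq> 0" shows "w \<in> ksum (connection_set q a) 3"
proof -
  obtain w0 where w0: "q w0 = a" using universal[of a] dim2 by auto
  obtain P where P: "finite P" "\<And>v. v \<in> P \<Longrightarrow> q v = a" "card P = CARD('a) + 1"
    using many_vectors[OF a w0] by blast
  have half: "CARD('a) + 1 \<le> 2 * card ((\<lambda>v. q (x - v)) ` P)" if "x \<noteq> 0" for x
    using card_le_fibres[OF P(1) level_fibre[OF that P(2)]] P(3) by simp
  \<comment> \<open>Up to a sign, which \<open>q\<close> ignores, \<open>- w0 - v\<close> is a sum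
    of two vectors of value \<open>a\<close>. A common value of the two maps lets
    \<open>w - v\<close> inherit this.\<close>
  let ?A = "(\<lambda>v. q (w - v)) ` P" and ?B = "(\<lambda>v. q (- w0 - v)) ` P"
  have "- w0 \<noteq> 0" using w0 a by auto
  then have "CARD('a) < card ?A + card ?B" using half[OF w] half[of "- w0"] by linarith
  moreover have "card (?A \<union> ?B) \<le> CARD('a)" by (intro card_mono) auto
  ultimately have "?A \<inter> ?B \<noteq> {}" using card_Un_disjoint[of ?A ?B] P(1) by auto
  then obtain v v' where v: "v \<in> P" "v' \<in> P" "q (w - v) = q (- w0 - v')" by auto
  have "- w0 - v' = - (w0 + v')" by simp
  then have "q (w0 + v') = q (w - v)" using v(3) by (metis q_minus)
  with ksum_2_add[OF a w0 P(2)[OF v(2)]] have "w - v \<in> ksum (connection_set q a) 2"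
    by (rule ksum_same_value)
  moreover have "v \<in> connection_set q a" using connection_setI[OF a P(2)[OF v(1)]] .
  moreover have "w = v + (w - v)" by simp
  moreover have "3 = Suc 2" by simp
  ultimately show ?thesis unfolding \<open>3 = Suc 2\<close> ksum.simps by blast
qed

text \<open>If \<open>v + v'\<close> had this value with \<open>q v = q v' = a\<close>, then \<open>q (x *s v + y *s v')\<close> would factor as
  \<open>a * (x + t * y) * (x + y / t)\<close>, contradicting anisotropy.\<close>

lemma split_level_not_ksum_2:
  assumes t: "t \<noteq> 0" "t \<noteq> 1" "t \<noteq> -1" and w: "q w = a * ((1 + t)\<^sup>2 / t)" and a: "a \<noteq> 0"
  shows "w \<notin> ksum (connection_set q a) 2"
proof
  assume "w \<in> ksum (connection_set q a) 2"
  then obtain v v' where v: "q v = a" "q v' = a" "w = v + v'"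
    unfolding ksum_2 connection_set_def by blast
  have "q w = a + a + b v v'" using v by (simp add: q_add)
  then have bv: "b v v' = a * (t + inverse t)" using w t(1) by (simp add: chord_levels_eq algebra_simps)
  have "q (v' - t *s v) = a + t\<^sup>2 * a - t * (a * (t + inverse t))"
    using v bv by (simp add: q_diff b_simps b_sym[of v' v])
  also have "\<dots> = 0" using t(1) by (simp add: algebra_simps power2_eq_square)
  finally have "v' = t *s v" using aniso[of "v' - t *s v"] by simp
  then have "t\<^sup>2 = 1" using v(1,2) a by simp
  then show False using t(2,3) by (simp add: power2_eq_1_iff)
qed

lemma diameter_large:
  assumes a: "a \<noteq> 0" and Q: "CARD('a) \<ge> 5"
  shows "representation_diameter q a = enat 3"
proof -
  obtain t :: 'a where t: "t \<noteq> 0" "t \<noteq> 1" "t \<noteq> -1" "t\<^sup>2 + t + 1 \<noteq> 0" using ex_generic_ratio[OF Q] .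
  obtain w where w: "q w = a * ((1 + t)\<^sup>2 / t)" using universal dim2 by auto
  have "1 + t \<noteq> 0" using t(3) by (rule chord_levels_1_plus)
  then have "q w \<noteq> 0" unfolding w using a t(1) by simp
  then have w0: "w \<noteq> 0" by auto
  have "q w \<noteq> a"
  proof
    assume "q w = a"
    then have "a * ((1 + t)\<^sup>2 / t) = a * 1" by (simp only: w mult_1_right)
    then have "(1 + t)\<^sup>2 / t = 1" using a by (simp only: mult_cancel_left simp_thms)
    then have "(1 + t)\<^sup>2 = t" using t(1) by simp
    moreover have "t\<^sup>2 + t + 1 = (1 + t)\<^sup>2 - t" by (simp add: algebra_simps power2_eq_square)
    ultimately show False using t(4) by simp
  qed
  have "w \<notin> ksum (connection_set q a) j" if "j < 3" for j
  proof (cases "j = 2")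
    case True
    then show ?thesis using split_level_not_ksum_2[OF t(1-3) w a] by simp
  next
    case False
    then show ?thesis using not_ksum_less_2[OF w0 \<open>q w \<noteq> a\<close>] that by simp
  qed
  moreover have "\<exists>j\<le>3. v \<in> ksum (connection_set q a) j" for v
  proof (cases "v = 0")
    case True
    then show ?thesis by (intro exI[of _ 0]) simp
  qed (use reach_3[OF a] in blast)
  ultimately show ?thesis by (intro diameter_eq)
qed

lemma diameter_2_field:
  assumes a: "a \<noteq> 0" and Q: "CARD('a) = 2"
  shows "representation_diameter q a = enat 1"
proof -
  obtain w :: 'v where "w \<noteq> 0" using ex_nonzero dim2 by auto
  then have "w \<notin> ksum (connection_set q a) j" if "j < 1" for j using that by simp
  moreover have "\<exists>j\<le>1. v \<in> ksum (connection_set q a) j" for v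
  proof (cases "v = 0")
    case True
    then show ?thesis by (intro exI[of _ 0]) simp
  next
    case False
    then have "q v = a" using aniso[of v] a card_2_field[OF Q, of "q v"] card_2_field[OF Q, of a] by auto
    then have "v \<in> ksum (connection_set q a) 1" unfolding ksum_1 by (rule connection_setI[OF a])
    then show ?thesis by blast
  qed
  ultimately show ?thesis by (intro diameter_eq)
qed

text \<open>Because reachability depends on the value only, each remaining value has to be attained
  by just one sum. Such a remaining value exists for more than two field elements and yields the
  lower bound.\<close>

lemma diameter_2I:
  assumes a: "a \<noteq> 0" and Q: "CARD('a) > 2"
    and sums: "\<And>c. c \<noteq> 0 \<Longrightarrow> c \<noteq> a \<Longrightarrow> \<exists>v v'. q v = a \<and> q v' = a \<and> q (v + v') = c"
  shows "representation_diameter q a = enat 2"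
proof -
  have "card {0, a} < CARD('a)" using Q a by simp
  then obtain c where "c \<notin> {0, a}" using card_UNIV_obtain[of "{0, a}"] by auto
  moreover obtain w where "q w = c" using universal dim2 by auto
  ultimately have "w \<noteq> 0" "q w \<noteq> a" by auto
  then have "w \<notin> ksum (connection_set q a) j" if "j < 2" for j using that by (rule not_ksum_less_2)
  moreover have "\<exists>j\<le>2. v \<in> ksum (connection_set q a) j" for v
  proof -
    consider "v = 0" | "q v = a" | "q v \<noteq> 0" "q v \<noteq> a" using aniso by blast
    then show ?thesis
    proof cases
      case 1
      then show ?thesis by (intro exI[of _ 0]) simp
    next
      case 2
      then have "v \<in> ksum (connection_set q a) 1" unfolding ksum_1 by (rule connection_setI[OF a])
      then show ?thesis by (intro exI[of _ 1]) simp
    next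
      case 3
      then obtain u u' where "q u = a" "q u' = a" "q (u + u') = q v" using sums by blast
      then have "v \<in> ksum (connection_set q a) 2" using ksum_same_value[OF ksum_2_add[OF a]] by blast
      then show ?thesis by blast
    qed
  qed
  ultimately show ?thesis by (intro diameter_eq)
qed

lemma diameter_3_field:
  assumes a: "a \<noteq> 0" and Q: "CARD('a) = 3"
  shows "representation_diameter q a = enat 2"
proof (rule diameter_2I[OF a])
  fix c :: 'a assume c: "c \<noteq> 0" "c \<noteq> a"
  have dich: "x = 0 \<or> x = a \<or> x = - a" for x
    using card_3_field(2)[OF Q, of x] card_3_field(2)[OF Q, of a] a by auto
  have three: "(3::'a) = 0" using of_nat_CARD_eq_0[where 'a='a] Q by simp
  obtain w where w: "q w = a" using universal[of a] dim2 by auto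
  obtain P where P: "finite P" "\<And>v. v \<in> P \<Longrightarrow> q v = a" "card P = CARD('a) + 1"
    using many_vectors[OF a w] by blast
  have "\<not> P \<subseteq> {w, - w}"
  proof
    assume "P \<subseteq> {w, - w}"
    then have "card P \<le> card {w, - w}" by (intro card_mono) auto
    also have "\<dots> \<le> 2" using card_insert_le_m1[of 2 "{- w}" w] by simp
    finally show False using P(3) Q by simp
  qed
  then obtain v where v: "v \<in> P" "v \<noteq> w" "v \<noteq> - w" by blast
  have "q (w + v) \<noteq> 0"
  proof
    assume "q (w + v) = 0"
    then have "w + v = 0" by (rule aniso)
    then show False using v(3) by (simp add: add_eq_0_iff)
  qed
  \<comment> \<open>Value \<open>a\<close> would give \<open>q (w - v)\<close> the value
    \<open>3 * a = 0\<close>.\<close>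
  moreover have "q (w + v) \<noteq> a"
  proof
    assume "q (w + v) = a"
    then have "b w v = - a" using w P(2)[OF v(1)] by (simp add: q_add add_eq_0_iff)
    then have "q (w - v) = 3 * a" using w P(2)[OF v(1)] by (simp add: q_diff)
    then show False using three v(2) aniso[of "w - v"] by simp
  qed
  ultimately have "q (w + v) = c" using dich[of c] dich[of "q (w + v)"] c by auto
  then show "\<exists>v v'. q v = a \<and> q v' = a \<and> q (v + v') = c" using w P(2)[OF v(1)] by blast
qed (use Q in simp)

lemma diameter_4_field:
  assumes a: "a \<noteq> 0" and Q: "CARD('a) = 4"
  shows "representation_diameter q a = enat 2"
proof (rule diameter_2I[OF a])
  fix c :: 'a assume c: "c \<noteq> 0" "c \<noteq> a"
  obtain x :: 'a where x: "x \<noteq> 0" "x \<noteq> 1" using card_UNIV_obtain[of "{0, 1::'a}"] Q by auto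
  note x2 = card_4_field(1)[OF Q x] and two = card_4_field(2)[OF Q x]
  obtain w where w: "q w = a" using universal[of a] dim2 by auto
  have w0: "- w \<noteq> 0" using a w by auto
  obtain P where P: "finite P" "\<And>v. v \<in> P \<Longrightarrow> q v = a" "card P = CARD('a) + 1"
    using many_vectors[OF a w] by blast
  let ?P = "P - {- w}" and ?f = "\<lambda>v. q (- w - v)"
  have f: "?f v = q (w + v)" for v
  proof -
    have "- w - v = - (w + v)" by simp
    then show ?thesis by (metis q_minus)
  qed
  have "card P - card {- w} \<le> card ?P" by (rule diff_card_le_card_Diff) simp
  then have "4 \<le> card ?P" using P(3) Q by simp
  also have "card ?P \<le> 2 * card (?f ` ?P)"
    using P(1,2) by (intro card_le_fibres level_fibre[OF w0]) auto
  finally have "2 \<le> card (?f ` ?P)" by simp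
  moreover have "0 \<notin> ?f ` ?P"
  proof
    assume "0 \<in> ?f ` ?P"
    then obtain v where v: "v \<in> ?P" "0 = q (- w - v)" by blast
    then have "v \<noteq> - w" "q (- w - v) = 0" by simp_all
    then have "- w - v = 0" by (intro aniso)
    then show False using \<open>v \<noteq> - w\<close> by simp
  qed
  \<comment> \<open>As \<open>x\<close> is a primitive cube root of unity, value \<open>a\<close>
    would give \<open>x *s w - v\<close> the value \<open>a * (x * x + x + 1) = 0\<close>.\<close>
  moreover have "a \<notin> ?f ` ?P"
  proof
    assume "a \<in> ?f ` ?P"
    then obtain v where v: "v \<in> P" "q (w + v) = a" unfolding f by auto
    then have "b w v = - a" using w P(2)[OF v(1)] by (simp add: q_add add_eq_0_iff)
    then have "q (x *s w - v) = a * (x\<^sup>2 + x + 1)"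
      using w P(2)[OF v(1)] by (simp add: q_diff b_simps algebra_simps)
    also have "x\<^sup>2 + x + 1 = 2 * (x + 1)" unfolding x2 by simp
    finally have "v = x *s w" using two aniso[of "x *s w - v"] by simp
    then have "x\<^sup>2 = 1" using P(2)[OF v(1)] w a by simp
    then show False using x2 x by simp
  qed
  ultimately have "c \<in> ?f ` ?P"
  proof -
    assume A: "2 \<le> card (?f ` ?P)" "0 \<notin> ?f ` ?P" "a \<notin> ?f ` ?P"
    have "card (- {0, a}) = 2" using a Q by (simp add: Compl_eq_Diff_UNIV card_Diff_subset)
    then have "?f ` ?P = - {0, a}" using A by (intro card_seteq) auto
    then show ?thesis using c by blast
  qed
  then obtain v where "v \<in> P" "q (w + v) = c" unfolding f by auto
  then show "\<exists>v v'. q v = a \<and> q v' = a \<and> q (v + v') = c" using w P(2) by blast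
qed (use Q in simp)

end

subsection \<open>Determinants and dimension three\<close>

lemma square_class_eq_iff:
  fixes x y :: "'a::field"
  shows "square_class x = square_class y \<longleftrightarrow> (\<exists>c. c \<noteq> 0 \<and> x = y * c\<^sup>2)"
proof
  assume "square_class x = square_class y"
  moreover have "x \<in> square_class x" unfolding square_class_def by (auto intro!: exI[of _ 1])
  ultimately show "\<exists>c. c \<noteq> 0 \<and> x = y * c\<^sup>2" unfolding square_class_def by auto
next
  assume "\<exists>c. c \<noteq> 0 \<and> x = y * c\<^sup>2"
  then obtain c where c: "c \<noteq> 0" "x = y * c\<^sup>2" by blast
  show "square_class x = square_class y"
  proof (intro equalityI subsetI)
    fix z assume "z \<in> square_class x"
    then obtain d where "d \<noteq> 0" "z = x * d\<^sup>2" unfolding square_class_def by blast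
    then have "z = y * (c * d)\<^sup>2" "c * d \<noteq> 0" using c by (simp_all add: power_mult_distrib)
    then show "z \<in> square_class y" unfolding square_class_def by blast
  next
    fix z assume "z \<in> square_class y"
    then obtain d where "d \<noteq> 0" "z = y * d\<^sup>2" unfolding square_class_def by blast
    then have "z = x * (d / c)\<^sup>2" "d / c \<noteq> 0" using c by (simp_all add: power_divide)
    then show "z \<in> square_class x" unfolding square_class_def by blast
  qed
qed

lemma image_square_class: "(\<lambda>d. a * d) ` square_class x = square_class (a * x)"
  unfolding square_class_def by (auto simp: image_iff mult.assoc)

context quad_space
begin

text \<open>Polarisation at two unit vectors. In odd characteristic this recovers the matrix from
  \<open>b\<close>.\<close>

lemma symmetric_matrix_entry:
  assumes A: "symmetric_matrix_of (*s) q vs A" and i: "i < length vs" and j: "j < length vs"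
  shows "2 * A $$ (i, j) = b (vs ! i) (vs ! j)"
proof -
  let ?n = "length vs"
  define L where "L x = (\<Sum>i<?n. (x $ i) *s (vs ! i))" for x
  have cA: "A \<in> carrier_mat ?n ?n" and sA: "transpose_mat A = A"
    and qL: "\<And>x. x \<in> carrier_vec ?n \<Longrightarrow> q (L x) = x \<bullet> (A *\<^sub>v x)"
    using A unfolding symmetric_matrix_of_def L_def by auto
  have L_add: "L (x + y) = L x + L y" if "x \<in> carrier_vec ?n" "y \<in> carrier_vec ?n" for x y
    unfolding L_def sum.distrib[symmetric]
    by (rule sum.cong) (use that in \<open>auto simp: scale_left_distrib\<close>)
  have L_unit: "L (unit_vec ?n k) = vs ! k" if "k < ?n" for k
  proof -
    have "L (unit_vec ?n k) = (\<Sum>i<?n. if i = k then vs ! i else 0)"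
      unfolding L_def by (rule sum.cong) (use that in auto)
    then show ?thesis using that by (simp add: sum.delta)
  qed
  let ?u = "unit_vec ?n :: nat \<Rightarrow> 'a vec"
  have uc: "?u k \<in> carrier_vec ?n" for k by simp
  have Au: "A *\<^sub>v ?u k \<in> carrier_vec ?n" for k using cA by simp
  have unit: "?u k \<bullet> (A *\<^sub>v ?u l) = A $$ (k, l)" if "k < ?n" "l < ?n" for k l
    using that cA Au[of l] by simp
  have "b (vs ! i) (vs ! j) = q (L (?u i + ?u j)) - q (L (?u i)) - q (L (?u j))"
    unfolding polar_form_def L_add[OF uc uc] L_unit[OF i] L_unit[OF j] ..
  also have "\<dots> = (?u i + ?u j) \<bullet> (A *\<^sub>v (?u i + ?u j)) - ?u i \<bullet> (A *\<^sub>v ?u i) - ?u j \<bullet> (A *\<^sub>v ?u j)"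
    by (simp add: qL)
  also have "A *\<^sub>v (?u i + ?u j) = A *\<^sub>v ?u i + A *\<^sub>v ?u j"
    by (rule mult_add_distrib_mat_vec[OF cA uc uc])
  also have "(?u i + ?u j) \<bullet> (A *\<^sub>v ?u i + A *\<^sub>v ?u j) =
      ?u i \<bullet> (A *\<^sub>v ?u i) + ?u i \<bullet> (A *\<^sub>v ?u j) + (?u j \<bullet> (A *\<^sub>v ?u i) + ?u j \<bullet> (A *\<^sub>v ?u j))"
    using add_scalar_prod_distrib[OF uc uc add_carrier_vec[OF Au Au]]
      scalar_prod_add_distrib[OF uc Au Au] by simp
  finally have "b (vs ! i) (vs ! j) = A $$ (i, j) + A $$ (j, i)"
    using i j by (simp only: unit) (simp add: algebra_simps)
  moreover have "A $$ (j, i) = A $$ (i, j)" using sA cA i j by (metis carrier_matD index_transpose_mat(1))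
  ultimately show ?thesis by simp
qed

lemma ordered_basis_length:
  assumes "ordered_basis (*s) vs" shows "length vs = dim UNIV"
proof -
  have "card (set vs) = dim UNIV"
    using assms unfolding ordered_basis_def by (intro basis_card_eq_dim) auto
  then show ?thesis using assms unfolding ordered_basis_def by (simp add: distinct_card)
qed

lemma ordered_basis_coordinates:
  assumes "ordered_basis (*s) vs" shows "\<exists>c. v = (\<Sum>i<length vs. c i *s (vs ! i))"
proof -
  have "v \<in> span (set vs)" using assms unfolding ordered_basis_def by simp
  then obtain u where "v = (\<Sum>x\<in>set vs. u x *s x)" unfolding span_finite[OF finite_set] by blast
  also have "\<dots> = (\<Sum>i<length vs. u (vs ! i) *s (vs ! i))"
    using assms unfolding ordered_basis_def
    by (intro sum.reindex_bij_betw[symmetric] bij_betw_nth) auto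
  finally show ?thesis by (rule exI[of _ "\<lambda>i. u (vs ! i)"])
qed

lemma b_sum_left: "b (\<Sum>i\<in>I. f i) y = (\<Sum>i\<in>I. b (f i) y)"
  by (induction I rule: infinite_finite_induct) (simp_all add: b_simps)

lemma b_sum_right: "b x (\<Sum>i\<in>I. f i) = (\<Sum>i\<in>I. b x (f i))"
  by (induction I rule: infinite_finite_induct) (simp_all add: b_simps)

lemma det_basis_change:
  assumes two: "(2::'a) \<noteq> 0"
    and vs: "ordered_basis (*s) vs" "symmetric_matrix_of (*s) q vs A"
    and us: "ordered_basis (*s) us" "symmetric_matrix_of (*s) q us A'"
  shows "\<exists>p. det A' = det A * p\<^sup>2"
proof -
  let ?n = "length vs"
  have n: "length us = ?n" using ordered_basis_length[OF vs(1)] ordered_basis_length[OF us(1)] by simp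
  have "\<forall>j. \<exists>c. us ! j = (\<Sum>i<?n. c i *s (vs ! i))" using ordered_basis_coordinates[OF vs(1)] by blast
  then obtain c where c: "\<And>j. us ! j = (\<Sum>i<?n. c j i *s (vs ! i))" by metis
  define P where "P = mat ?n ?n (\<lambda>(i, j). c j i)"
  have cA: "A \<in> carrier_mat ?n ?n" and cA': "A' \<in> carrier_mat ?n ?n"
    using vs(2) us(2) n unfolding symmetric_matrix_of_def by auto
  have cP: "P \<in> carrier_mat ?n ?n" "transpose_mat P \<in> carrier_mat ?n ?n" unfolding P_def by auto
  have "A' = transpose_mat P * (A * P)"
  proof (rule eq_matI)
    fix j l assume "j < dim_row (transpose_mat P * (A * P))" "l < dim_col (transpose_mat P * (A * P))"
    then have jl: "j < ?n" "l < ?n" using cP cA by auto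
    have "2 * A' $$ (j, l) = b (us ! j) (us ! l)" using symmetric_matrix_entry[OF us(2)] jl n by simp
    also have "\<dots> = (\<Sum>i<?n. \<Sum>k<?n. c j i * (c l k * b (vs ! i) (vs ! k)))"
      unfolding c[of j] c[of l] b_sum_left b_left b_sum_right b_right sum_distrib_left
      by (subst sum.swap, intro sum.cong refl) (simp add: mult.left_commute)
    also have "\<dots> = (\<Sum>i<?n. \<Sum>k<?n. 2 * (c j i * (A $$ (i, k) * c l k)))"
      by (intro sum.cong refl) (simp add: symmetric_matrix_entry[OF vs(2), symmetric])
    also have "\<dots> = 2 * (\<Sum>i<?n. c j i * (\<Sum>k<?n. A $$ (i, k) * c l k))"
      by (simp only: sum_distrib_left)
    also have "(\<Sum>i<?n. c j i * (\<Sum>k<?n. A $$ (i, k) * c l k)) = (transpose_mat P * (A * P)) $$ (j, l)"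
      using jl cA cP by (simp add: scalar_prod_def P_def atLeast0LessThan)
    finally show "A' $$ (j, l) = (transpose_mat P * (A * P)) $$ (j, l)" using two by simp
  qed (use cA' cA cP in auto)
  then have "det A' = det P * (det A * det P)"
    using det_mult[OF cP(2) mult_carrier_mat[OF cA cP(1)]] det_mult[OF cA cP(1)] det_transpose[OF cP(1)]
    by simp
  then show ?thesis by (intro exI[of _ "det P"]) (simp add: power2_eq_square)
qed

text \<open>Collapses the union in \<open>det_class\<close> to one class, so that a single
  convenient basis computes it.\<close>

lemma det_class_eq:
  assumes two: "(2::'a) \<noteq> 0" and vs: "ordered_basis (*s) vs" "symmetric_matrix_of (*s) q vs A"
    and nz: "det A \<noteq> 0"
  shows "det_class (*s) q = square_class (det A)"
proof -
  have "square_class (det A') = square_class (det A)"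
    if us: "ordered_basis (*s) us" "symmetric_matrix_of (*s) q us A'" for us A'
  proof -
    obtain p where p: "det A' = det A * p\<^sup>2" using det_basis_change[OF two vs us] by blast
    obtain r where r: "det A = det A' * r\<^sup>2" using det_basis_change[OF two us vs] by blast
    \<comment> \<open>Changing the basis in both directions rules out \<open>p = 0\<close> without
      discussing invertibility of the transition matrix.\<close>
    have "p \<noteq> 0" using p r nz by auto
    then show ?thesis unfolding square_class_eq_iff using p by blast
  qed
  then have "{square_class (det A') | A' us. ordered_basis (*s) us \<and> symmetric_matrix_of (*s) q us A'}
      = {square_class (det A)}"
    using vs by blast
  then show ?thesis unfolding det_class_def by simp
qed

lemma q_sum_orthogonal:
  fixes n :: nat
  assumes "\<And>i j. i < n \<Longrightarrow> j < n \<Longrightarrow> i \<noteq> j \<Longrightarrow> b (f i) (f j) = 0"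
  shows "q (\<Sum>i<n. c i *s f i) = (\<Sum>i<n. (c i)\<^sup>2 * q (f i))"
  using assms
proof (induction n)
  case (Suc n)
  have "b (\<Sum>i<n. c i *s f i) (c n *s f n) = 0"
    unfolding b_sum_left using Suc.prems by (intro sum.neutral) (simp add: b_simps)
  then show ?case using Suc by (simp add: q_add)
qed simp

lemma det_class_orthogonal:
  assumes two: "(2::'a) \<noteq> 0" and vs: "ordered_basis (*s) vs"
    and orth: "\<And>i j. i < length vs \<Longrightarrow> j < length vs \<Longrightarrow> i \<noteq> j \<Longrightarrow> b (vs ! i) (vs ! j) = 0"
    and nz: "\<And>v. v \<in> set vs \<Longrightarrow> q v \<noteq> 0"
  shows "det_class (*s) q = square_class (prod_list (map q vs))"
proof -
  let ?n = "length vs"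
  let ?A = "mat ?n ?n (\<lambda>(i, j). if i = j then q (vs ! i) else 0)"
  have sym: "symmetric_matrix_of (*s) q vs ?A"
    unfolding symmetric_matrix_of_def
  proof (intro conjI ballI)
    fix x :: "'a vec" assume x: "x \<in> carrier_vec ?n"
    have "(?A *\<^sub>v x) $ i = q (vs ! i) * x $ i" if "i < ?n" for i
    proof -
      have "(?A *\<^sub>v x) $ i = (\<Sum>j<?n. (if i = j then q (vs ! i) else 0) * x $ j)"
        using that x by (simp add: scalar_prod_def atLeast0LessThan)
      also have "\<dots> = (\<Sum>j<?n. if i = j then q (vs ! i) * x $ j else 0)"
        by (rule sum.cong) auto
      finally show ?thesis using that by (simp add: sum.delta')
    qed
    then have "x \<bullet> (?A *\<^sub>v x) = (\<Sum>i<?n. (x $ i)\<^sup>2 * q (vs ! i))"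
      unfolding scalar_prod_def
      by (auto simp: atLeast0LessThan power2_eq_square intro!: sum.cong)
    then show "q (\<Sum>i<?n. (x $ i) *s (vs ! i)) = x \<bullet> (?A *\<^sub>v x)"
      using q_sum_orthogonal[OF orth] by simp
  qed (auto intro!: eq_matI)
  have det: "det ?A = prod_list (map q vs)"
  proof -
    have "det ?A = prod_list (diag_mat ?A)"
      by (rule det_upper_triangular[of _ ?n]) (auto intro!: upper_triangularI)
    also have "diag_mat ?A = map q vs" by (rule nth_equalityI) (auto simp: diag_mat_def)
    finally show ?thesis .
  qed
  have "prod_list (map q vs) \<noteq> 0" using nz by (auto simp: prod_list_zero_iff)
  then show ?thesis using det_class_eq[OF two vs sym] unfolding det by simp
qed

lemma ordered_basisI:
  assumes "distinct vs" "length vs = dim UNIV" "span (set vs) = UNIV"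
  shows "ordered_basis (*s) vs"
proof -
  have "independent (set vs)"
    using assms by (intro card_le_dim_spanning[of _ UNIV]) (auto simp: distinct_card)
  then show ?thesis using assms unfolding ordered_basis_def by blast
qed

text \<open>A hyperbolic pair and a vector \<open>g\<close> orthogonal to it span the space. If
  \<open>b g g = 2 * q g\<close> were zero, then \<open>g\<close> would lie in the radical; so the
  characteristic is odd.\<close>

lemma dim3_decomposition:
  assumes n: "dim UNIV = 3" and w: "w \<noteq> 0" "q w = 0"
  obtains w' g where "q w' = 0" "b w w' = 1" "b g w = 0" "b g w' = 0" "q g \<noteq> 0" "(2::'a) \<noteq> 0"
    "\<And>v. \<exists>x y z. v = x *s w + y *s w' + z *s g"
    "det_class (*s) q = square_class (- q g)"
proof -
  obtain w' where w': "q w' = 0" "b w w' = 1" "alternating_pair w w'" using hyperbolic_pair[OF w] .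
  have p: "b w w = 0" "b w' w' = 0" "b w' w = 1"
    using w' b_sym[of w w'] unfolding alternating_pair_def by auto
  have "card {w, w'} < dim UNIV" using card_insert_le_m1[of 2 "{w'}" w] n by simp
  then obtain e where e: "e \<notin> span {w, w'}" using not_spanned[of "{w, w'}"] by auto
  define g where "g = pair_proj w w' e"
  have bg: "b g w = 0" "b g w' = 0" "b w g = 0" "b w' g = 0"
    unfolding g_def using pair_proj(1,2)[OF w'(3)] b_sym by metis+
  have g: "g \<notin> span {w, w'}" using e pair_proj(4)[OF w'(3), of e "{w, w'}"] unfolding g_def by blast
  have "w' \<notin> span {w}"
  proof
    assume "w' \<in> span {w}"
    then obtain c where "w' = c *s w" by (auto simp: span_singleton)
    then show False using w'(2) p(1) by (simp add: b_simps)
  qed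
  then have ind2: "independent {w', w}" using w(1) by (intro independent_insertI) (simp_all add: dependent_def)
  then have i: "independent {g, w', w}" 
    by (intro independent_insertI[OF _ ind2]) (use g in \<open>simp add: insert_commute\<close>)
  have "w \<noteq> w'" using w'(2) p(1) by auto
  moreover have "g \<noteq> w" "g \<noteq> w'" using g span_base[of g "{w, w'}"] by auto
  ultimately have "card {g, w', w} = 3" by simp
  then have span: "UNIV \<subseteq> span {g, w', w}" using n by (intro card_ge_dim_independent[OF _ i]) simp_all
  have coords: "\<exists>x y z. v = x *s w + y *s w' + z *s g" for v
  proof -
    obtain z where "v - z *s g \<in> span {w', w}" using span span_breakdown_eq[of v g "{w', w}"] by blast
    then obtain y x where "v - z *s g = y *s w' + x *s w" by (rule span_pair)
    then have "v = x *s w + y *s w' + z *s g" by (simp add: algebra_simps)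
    then show ?thesis by blast
  qed
  have bgg: "b g g \<noteq> 0"
  proof
    assume gg: "b g g = 0"
    have "g \<noteq> 0" using g span_zero by metis
    then obtain y where y: "b g y = 1" by (rule nondeg_b)
    obtain r s t where "y = r *s w + s *s w' + t *s g" using coords by blast
    then show False using y bg gg by (simp add: b_simps)
  qed
  then have two: "(2::'a) \<noteq> 0" and qg: "q g \<noteq> 0" by (auto simp: b_self)
  \<comment> \<open>Sum and difference of the hyperbolic pair are orthogonal with values 1 and
    \<open>-1\<close>; together with \<open>g\<close> they diagonalise the form.\<close>
  let ?vs = "[w + w', w - w', g]"
  have ip: "b (w + w') w = 1" "b (w - w') w = -1"
    using p by (simp_all add: b_simps)
  have m1: "(1::'a) \<noteq> -1" using two by (metis add.right_inverse one_add_one)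
  have "ordered_basis (*s) ?vs"
  proof (rule ordered_basisI)
    have "w + w' \<noteq> w - w'" using ip m1 by metis
    moreover have "w + w' \<noteq> g" "w - w' \<noteq> g" using ip bg(1) by auto
    ultimately show "distinct ?vs" by simp
    show "length ?vs = dim UNIV" using n by simp
    have ws: "w \<in> span (set ?vs)"
    proof -
      have "w = (1 / 2) *s ((w + w') + (w - w'))"
      proof -
        have "(w + w') + (w - w') = w + w" by simp
        also have "\<dots> = 2 *s w" using scale_left_distrib[of 1 1 w] by simp
        finally show ?thesis using two by simp
      qed
      moreover have "(1 / 2) *s ((w + w') + (w - w')) \<in> span (set ?vs)"
        by (intro span_scale span_add span_base) simp_all
      ultimately show ?thesis by metis
    qed
    have ws': "w' \<in> span (set ?vs)"
    proof -
      have "(w + w') - w \<in> span (set ?vs)" by (intro span_diff[OF span_base ws]) simp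
      then show ?thesis by simp
    qed
    have "x *s w + y *s w' + z *s g \<in> span (set ?vs)" for x y z
      by (intro span_add span_scale ws ws' span_base) simp
    then show "span (set ?vs) = UNIV" using coords by (metis UNIV_eq_I)
  qed
  then have "det_class (*s) q = square_class (prod_list (map q ?vs))"
  proof (rule det_class_orthogonal[OF two])
    have o: "b (w + w') (w - w') = 0" "b (w - w') (w + w') = 0"
      using p w'(2) by (simp_all add: b_simps)
    show "b (?vs ! i) (?vs ! j) = 0" if "i < length ?vs" "j < length ?vs" "i \<noteq> j" for i j
    proof -
      have "i = 0 \<or> i = 1 \<or> i = 2" "j = 0 \<or> j = 1 \<or> j = 2" using that by auto
      then show ?thesis using that(3) o bg by (auto simp: b_simps)
    qed
    show "q v \<noteq> 0" if "v \<in> set ?vs" for v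
      using that w w' qg by (auto simp: q_add q_diff)
  qed
  also have "prod_list (map q ?vs) = - q g" using w w' by (simp add: q_add q_diff)
  finally show thesis using that w' bg qg two coords by blast
qed

lemma diameter_dim_3:
  assumes n: "dim UNIV = 3" and a: "a \<noteq> 0"
  shows "representation_diameter q a = (if det_class (*s) q = square_class (- a) then enat 2 else enat 3)"
proof -
  let ?C = "connection_set q a"
  obtain w where w: "w \<noteq> 0" "q w = 0" using isotropic_vector n by auto
  have two: "(2::'a) \<noteq> 0" using dim3_decomposition[OF n w] by metis
  have iso_iff: "u \<in> ksum ?C 2 \<longleftrightarrow> det_class (*s) q = square_class (- a)" if u: "u \<noteq> 0" "q u = 0" for u
  proof -
    obtain u' g where d: "q u' = 0" "b u u' = 1" "b g u = 0" "b g u' = 0" "q g \<noteq> 0"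
      "\<And>v. \<exists>x y z. v = x *s u + y *s u' + z *s g" "det_class (*s) q = square_class (- q g)"
      using dim3_decomposition[OF n u] by metis
    have bu: "b u u = 0" "b u g = 0" using u d b_sym[of u g] by (simp_all add: b_self)
    have "u \<in> ksum ?C 2 \<longleftrightarrow> (\<exists>c. c \<noteq> 0 \<and> a = q g * c\<^sup>2)"
    proof
      assume "u \<in> ksum ?C 2"
      then obtain v v' where v: "q v = a" "q v' = a" "u = v + v'"
        unfolding ksum_2 connection_set_def by blast
      have "v' = u - v" using v(3) by simp
      \<comment> \<open>Both summands have value \<open>a\<close> and \<open>u\<close> has value 0,
        so \<open>v\<close> is orthogonal to \<open>u\<close>. It is then a combination of
        \<open>u\<close> and \<open>g\<close> only, with value \<open>q g\<close> times a
        square.\<close>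
      then have "b u v = 0" using v(1,2) u by (simp add: q_diff)
      moreover obtain x y z where xyz: "v = x *s u + y *s u' + z *s g" using d(6) by blast
      ultimately have "y = 0" using bu d(2) by (simp add: b_simps)
      then have "a = q g * z\<^sup>2" using v(1) u d(3) unfolding xyz
        by (simp add: q_add b_simps bu mult.commute)
      then show "\<exists>c. c \<noteq> 0 \<and> a = q g * c\<^sup>2" using a by (intro exI[of _ z]) auto
    next
      assume "\<exists>c. c \<noteq> 0 \<and> a = q g * c\<^sup>2"
      then obtain c where "a = q g * c\<^sup>2" by blast
      then have "q (c *s g) = a" "b u (c *s g) = q u" using bu u by (simp_all add: b_simps)
      then show "u \<in> ksum ?C 2" by (rule ksum_2I[OF a])
    qed
    also have "\<dots> \<longleftrightarrow> square_class (- a) = square_class (- q g)"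
      unfolding square_class_eq_iff by simp
    finally show ?thesis using d(7) by metis
  qed
  have less2: "w \<notin> ksum ?C j" if "j < 2" for j using not_ksum_less_2[OF w(1) _ that] w a by simp
  have nonzero: "v \<in> ksum ?C 2" if "q v \<noteq> 0" for v using ksum_2_odd[OF two _ a that] n by simp
  show ?thesis
  proof (cases "det_class (*s) q = square_class (- a)")
    case True
    have "\<exists>j\<le>2. v \<in> ksum ?C j" for v
    proof (cases "v = 0")
      case False
      then have "v \<in> ksum ?C 2" using nonzero[of v] iso_iff[of v] True by blast
      then show ?thesis by blast
    qed (auto intro: exI[of _ 0])
    then show ?thesis using diameter_eq[OF _ less2] True by simp
  next
    case False
    have less3: "w \<notin> ksum ?C j" if "j < 3" for j
    proof (cases "j = 2")
      case True
      then show ?thesis using iso_iff[OF w] False by simp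
    qed (use less2[of j] that in simp)
    have "\<exists>j\<le>3. v \<in> ksum ?C j" for v
    proof (cases "v = 0 \<or> q v \<noteq> 0")
      case True
      then show ?thesis
      proof
        assume "v = 0" then show ?thesis by (intro exI[of _ 0]) simp
      next
        assume "q v \<noteq> 0" then show ?thesis using nonzero[of v] by (intro exI[of _ 2]) simp
      qed
    next
      case False
      obtain x0 where x0: "q x0 = a" using universal[of a] n by auto
      have "a + a \<noteq> 0" using two a by (metis mult_2 mult_eq_0_iff)
      then have "a \<noteq> - a" by (simp add: eq_neg_iff_add_eq_0)
      \<comment> \<open>Of \<open>x0\<close> and \<open>- x0\<close> at least one has product
        different from \<open>a\<close> with \<open>v\<close>. Subtracting it from the isotropic
        \<open>v\<close> leaves a vector of nonzero value, a sum of two.\<close>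
      then obtain x where x: "q x = a" "b v x \<noteq> a" using x0 that by (cases "b v x0 = a") (auto intro: that[of "- x0"])
      have "q (v - x) \<noteq> 0" using False x by (simp add: q_diff)
      then have "v - x \<in> ksum ?C 2" by (rule nonzero)
      moreover have "x \<in> ?C" using x(1) a by (auto simp: connection_set_def)
      moreover have "v = x + (v - x)" by simp
      moreover have "3 = Suc 2" by simp
      ultimately have "v \<in> ksum ?C 3" unfolding \<open>3 = Suc 2\<close> ksum.simps by blast
      then show ?thesis by blast
    qed
    then show ?thesis using diameter_eq[OF _ less3] False by simp
  qed
qed

end

subsection \<open>Dimension one\<close>

text \<open>Expresses that the characteristic is \<open>p\<close>: \<open>p\<close> is nilpotent in
  the field, hence 0, and a Bezout identity excludes integers prime to \<open>p\<close>.\<close>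

lemma of_int_eq_0_iff_dvd:
  assumes p: "prime p" and Q: "CARD('a::{field,finite}) = p ^ m"
  shows "(of_int z :: 'a::{field,finite}) = 0 \<longleftrightarrow> int p dvd z"
proof -
  have "(of_nat p :: 'a) ^ m = 0" using of_nat_CARD_eq_0[where 'a='a] unfolding Q by simp
  then have p0: "(of_int (int p) :: 'a) = 0" by simp
  show ?thesis
  proof
    assume z: "(of_int z :: 'a) = 0"
    show "int p dvd z"
    proof (rule ccontr)
      assume "\<not> int p dvd z"
      then have "coprime (int p) z" using p by (intro prime_imp_coprime) auto
      then obtain u v where "u * int p + v * z = 1" using bezout_int[of "int p" z] by auto
      then have "(of_int (u * int p + v * z) :: 'a) = 1" by simp
      then show False using p0 z by simp
    qed
  next
    assume "int p dvd z"
    then obtain k where "z = int p * k" by blast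
    then show "(of_int z :: 'a) = 0" using p0 by simp
  qed
qed

lemma ksum_pm:
  assumes vs: "vector_space scale" and w: "w \<in> ksum {h, - h} k"
  shows "\<exists>i. \<bar>i\<bar> \<le> int k \<and> w = scale (of_int i) h"
proof -
  interpret vector_space scale by fact
  show ?thesis using w
  proof (induction k arbitrary: w)
    case (Suc k)
    then obtain c z where c: "c = h \<or> c = - h" and z: "z \<in> ksum {h, - h} k" "w = c + z" by auto
    then obtain i where i: "\<bar>i\<bar> \<le> int k" "z = scale (of_int i) h" using Suc.IH by blast
    from c show ?case
    proof
      assume "c = h"
      then have "w = scale (of_int (i + 1)) h" using i z by (simp add: scale_left_distrib add.commute)
      then show ?thesis using i by (intro exI[of _ "i + 1"]) auto
    next
      assume "c = - h"
      then have "w = scale (of_int (i - 1)) h" using i z by (simp add: scale_left_diff_distrib)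
      then show ?thesis using i by (intro exI[of _ "i - 1"]) auto
    qed
  qed simp
qed

lemma ksum_multiple:
  assumes vs: "vector_space scale" and h: "h \<in> C"
  shows "scale (of_nat k) h \<in> ksum C k"
proof -
  interpret vector_space scale by fact
  show ?thesis
  proof (induction k)
    case (Suc k)
    have "scale (of_nat (Suc k)) h = h + scale (of_nat k) h" by (simp add: scale_left_distrib)
    then show ?case using Suc h unfolding ksum.simps by blast
  qed simp
qed

context quad_space
begin

text \<open>Vectors reachable from 0 are the integer multiples of \<open>h\<close>, arranged in a
  cycle of length \<open>p\<close>. For \<open>m = 1\<close> and odd \<open>p\<close> this is the
  whole graph, and the point halfway round is at distance \<open>(p - 1) div 2\<close>. For
  \<open>m > 1\<close> the prime field is too small to reach everything.\<close>

lemma line_diameter: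
  assumes h: "h \<noteq> 0" "\<And>v. \<exists>x. v = x *s h" and C: "connection_set q a = {h, - h}"
    and p: "prime p" and Q: "CARD('a) = p ^ m"
  shows "m = 1 \<Longrightarrow> odd p \<Longrightarrow> representation_diameter q a = enat ((p - 1) div 2)"
    and "m > 1 \<Longrightarrow> representation_diameter q a = \<infinity>"
proof -
  note zero_iff = of_int_eq_0_iff_dvd[OF p Q]
  show "representation_diameter q a = enat ((p - 1) div 2)" if m: "m = 1" "odd p"
  proof (rule diameter_eq)
    have pk: "p = 2 * ((p - 1) div 2) + 1" using m(2) by presburger
    fix w
    have less: "(of_nat i :: 'a) \<noteq> of_nat j" if "i < j" "j < p" for i j
    proof
      assume "(of_nat i :: 'a) = of_nat j"
      then have "(of_int (int j - int i) :: 'a) = 0" by simp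
      then have "int p dvd int j - int i" by (rule iffD1[OF zero_iff])
      moreover have "0 < int j - int i" "int j - int i < int p" using that by linarith+
      ultimately show False using zdvd_not_zless by metis
    qed
    have "inj_on (of_nat :: nat \<Rightarrow> 'a) {..<p}"
    proof (rule inj_onI)
      fix i j assume ij: "i \<in> {..<p}" "j \<in> {..<p}" "(of_nat i :: 'a) = of_nat j"
      then show "i = j" using less[of i j] less[of j i] by (cases i j rule: linorder_cases) simp_all
    qed
    then have "card ((of_nat :: nat \<Rightarrow> 'a) ` {..<p}) = CARD('a)" using Q m by (simp add: card_image)
    then have img: "(of_nat :: nat \<Rightarrow> 'a) ` {..<p} = UNIV" by (intro card_subset_eq) auto
    obtain x where x: "w = x *s h" using h(2) by blast
    obtain j where j: "j < p" "x = of_nat j" using img by blast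
    show "\<exists>j\<le>(p - 1) div 2. w \<in> ksum (connection_set q a) j"
    proof (cases "j \<le> (p - 1) div 2")
      case True
      have "w \<in> ksum (connection_set q a) j"
        unfolding x j(2) by (rule ksum_multiple[OF vector_space_axioms]) (simp add: C)
      then show ?thesis using True by blast
    next
      case False
      \<comment> \<open>Past the halfway point the route in the opposite direction is the short
        one.\<close>
      have "of_nat (p - j) *s (- h) \<in> ksum (connection_set q a) (p - j)"
        by (rule ksum_multiple[OF vector_space_axioms]) (simp add: C)
      moreover have "of_nat (p - j) *s (- h) = w"
      proof -
        have "(of_int (int p) :: 'a) = 0" by (rule iffD2[OF zero_iff]) simp
        then show ?thesis unfolding x j(2) using j(1) by (simp add: of_nat_diff)
      qed
      moreover have "p - j \<le> (p - 1) div 2" using False pk by linarith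
      ultimately show ?thesis by metis
    qed
  next
    let ?k = "(p - 1) div 2"
    have pk: "p = 2 * ?k + 1" using m(2) by presburger
    fix j assume j: "j < ?k"
    show "of_nat ?k *s h \<notin> ksum (connection_set q a) j"
    proof
      assume "of_nat ?k *s h \<in> ksum (connection_set q a) j"
      then obtain i where i: "\<bar>i\<bar> \<le> int j" "of_nat ?k *s h = of_int i *s h"
        using ksum_pm[OF vector_space_axioms] unfolding C by blast
      then have "(of_int (int ?k - i) :: 'a) = 0" using h(1) by simp
      then have "int p dvd int ?k - i" by (rule iffD1[OF zero_iff])
      moreover have "0 < int ?k - i" "int ?k - i < int p" using i(1) j pk by linarith+
      ultimately show False using zdvd_not_zless by metis
    qed
  qed
  show "representation_diameter q a = \<infinity>" if m: "m > 1"
  proof -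
    have p0: "0 < p" using p by (rule prime_gt_0_nat)
    have "card ((of_nat :: nat \<Rightarrow> 'a) ` {..<p}) \<le> p" using card_image_le[of "{..<p}"] by simp
    also have "p < p ^ m" using m prime_gt_1_nat[OF p] power_strict_increasing[of 1 m p] by simp
    finally obtain x :: 'a where x: "x \<notin> of_nat ` {..<p}"
      using card_UNIV_obtain[of "(of_nat :: nat \<Rightarrow> 'a) ` {..<p}"] Q by auto
    have "x *s h \<notin> ksum (connection_set q a) j" for j
    proof
      assume "x *s h \<in> ksum (connection_set q a) j"
      then obtain i where "x *s h = of_int i *s h"
        using ksum_pm[OF vector_space_axioms] unfolding C by blast
      then have "x = of_int i" using h(1) by simp
      moreover have "(of_int (i - i mod int p) :: 'a) = 0"
        by (rule iffD2[OF zero_iff]) (simp add: minus_mod_eq_mult_div)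
      ultimately have "x = of_int (i mod int p)" unfolding of_int_diff by simp
      also have "i mod int p = int (nat (i mod int p))" using p0 by simp
      finally have "x = of_nat (nat (i mod int p))" by (simp only: of_int_of_nat_eq)
      moreover have "nat (i mod int p) < p" using p0 by (simp add: nat_less_iff)
      ultimately show False using x by blast
    qed
    then show ?thesis by (rule diameter_infinity)
  qed
qed

text \<open>The value \<open>a\<close> is represented precisely when it lies in the square class of
  \<open>q e\<close>, which is the determinant; multiplying by \<open>q e\<close> converts this into
  \<open>a * q e\<close> being a square. Non-degeneracy of a line forces odd characteristic.\<close>

lemma diameter_dim_1:
  assumes n: "dim UNIV = 1" and a: "a \<noteq> 0" and p: "prime p" and Q: "CARD('a) = p ^ m" and m: "m \<ge> 1"
  shows "representation_diameter q a =
    (if (\<lambda>d. a * d) ` det_class (*s) q = square_class 1 \<and> m = 1 then enat ((p - 1) div 2) else \<infinity>)"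
proof -
  obtain e :: 'v where e: "e \<noteq> 0" using ex_nonzero n by auto
  have ind: "independent {e}" using e by (intro independent_insertI) (simp_all add: dependent_def)
  have "UNIV \<subseteq> span {e}" using n by (intro card_ge_dim_independent[OF _ ind]) simp_all
  then have span: "\<exists>x. v = x *s e" for v by (auto simp: span_singleton)
  have bee: "b e e \<noteq> 0"
  proof
    assume ee: "b e e = 0"
    obtain y where y: "b e y = 1" using e by (rule nondeg_b)
    obtain x where "y = x *s e" using span by blast
    then show False using y ee by (simp add: b_simps)
  qed
  then have two: "(2::'a) \<noteq> 0" and qe: "q e \<noteq> 0" by (auto simp: b_self)
  have "odd (p ^ m)" using odd_CARD[OF two] Q by simp
  then have odd: "odd p" using m by auto
  have "ordered_basis (*s) [e]"
    using n \<open>UNIV \<subseteq> span {e}\<close> by (intro ordered_basisI) auto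
  from det_class_orthogonal[OF two this] have det: "det_class (*s) q = square_class (q e)"
    using qe by simp
  have cond: "(\<lambda>d. a * d) ` det_class (*s) q = square_class 1 \<longleftrightarrow> (\<exists>s. a = q e * s\<^sup>2)"
    unfolding det image_square_class square_class_eq_iff
  proof
    assume "\<exists>c. c \<noteq> 0 \<and> a * q e = 1 * c\<^sup>2"
    then obtain c where "a * q e = c\<^sup>2" by auto
    then have "a = q e * (c / q e)\<^sup>2" using qe by (simp add: power_divide field_simps power2_eq_square)
    then show "\<exists>s. a = q e * s\<^sup>2" by blast
  next
    assume "\<exists>s. a = q e * s\<^sup>2"
    then obtain s where s: "a = q e * s\<^sup>2" by blast
    then have "a * q e = 1 * (q e * s)\<^sup>2" by (simp add: power_mult_distrib power2_eq_square)
    moreover have "q e * s \<noteq> 0" using s a by auto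
    ultimately show "\<exists>c. c \<noteq> 0 \<and> a * q e = 1 * c\<^sup>2" by blast
  qed
  show ?thesis
  proof (cases "\<exists>s. a = q e * s\<^sup>2")
    case True
    then obtain s where s: "a = q e * s\<^sup>2" by blast
    then have s0: "s \<noteq> 0" using a by auto
    let ?h = "s *s e"
    have h0: "?h \<noteq> 0" using s0 e by simp
    have span_h: "\<exists>x. v = x *s ?h" for v
    proof -
      obtain x where "v = x *s e" using span by blast
      then have "v = (x / s) *s ?h" using s0 by simp
      then show ?thesis by blast
    qed
    have "connection_set q a = {?h, - ?h}"
    proof (intro equalityI subsetI)
      fix v assume "v \<in> connection_set q a"
      then have "q v = a" by (simp add: connection_set_def)
      moreover obtain x where x: "v = x *s e" using span by blast
      ultimately have "x\<^sup>2 = s\<^sup>2" using s qe by simp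
      then have "x = s \<or> x = - s" by (simp add: power2_eq_iff)
      then show "v \<in> {?h, - ?h}" unfolding x by auto
    next
      fix v assume "v \<in> {?h, - ?h}"
      then have "q v = a" "v \<noteq> 0" using s h0 by auto
      then show "v \<in> connection_set q a" by (simp add: connection_set_def)
    qed
    note D = line_diameter[OF h0 span_h this p Q]
    show ?thesis using D(1)[OF _ odd] D(2) m True unfolding cond by auto
  next
    case False
    have "connection_set q a = {}"
    proof (rule ccontr)
      assume "connection_set q a \<noteq> {}"
      then obtain v where v: "q v = a" unfolding connection_set_def by blast
      obtain x where "v = x *s e" using span by blast
      then have "a = q e * x\<^sup>2" using v by (simp add: mult.commute)
      then show False using False by blast
    qed
    then have "representation_diameter q a = \<infinity>"
      using ksum_empty e by (intro diameter_infinity[of e]) auto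
    then show ?thesis unfolding cond using False by simp
  qed
qed

lemma diameter_anisotropic_plane:
  assumes n: "dim UNIV = 2" and iso: "\<not> isometric (*s) q plane_scale hyperbolic_plane" and a: "a \<noteq> 0"
  shows "representation_diameter q a =
    (if CARD('a) = 2 then enat 1 else if CARD('a) \<in> {3, 4} then enat 2 else enat 3)"
proof -
  have "anisotropic q" using isotropic_plane_isometric[OF n] iso by blast
  then interpret anisotropic_plane "(*s)" Basis q
    by unfold_locales (use n in \<open>auto simp: isotropic_def\<close>)
  consider "CARD('a) = 2" | "CARD('a) = 3" | "CARD('a) = 4" | "CARD('a) \<ge> 5"
    using CARD_field_ge_2[where 'a='a] by linarith
  then show ?thesis
    using diameter_2_field[OF a] diameter_3_field[OF a] diameter_4_field[OF a] diameter_large[OF a]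
    by cases simp_all
qed

end

text \<open>A power of 2 that is at least 5 is at least 8; this provides the divisibility needed by
  the hyperbola argument in characteristic 2.\<close>

lemma eight_dvd_CARD:
  assumes p: "prime p" and Q: "CARD('a::{field,finite}) = p ^ m"
    and two: "(2::'a::{field,finite}) = 0" and large: "CARD('a::{field,finite}) \<ge> 5"
  shows "8 dvd CARD('a::{field,finite})"
proof -
  have "even (p ^ m)" using even_CARD[OF two] Q by simp
  then have "p = 2" using p by (metis even_power prime_odd_nat prime_ge_2_nat le_neq_implies_less)
  have "3 \<le> m"
  proof (rule ccontr)
    assume "\<not> 3 \<le> m"
    then have "(2::nat) ^ m \<le> 2 ^ 2" by (intro power_increasing) auto
    then show False using large Q \<open>p = 2\<close> by simp
  qed
  then have "(2::nat) ^ 3 dvd 2 ^ m" by (rule le_imp_power_dvd)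
  then show ?thesis using Q \<open>p = 2\<close> by simp
qed

theorem theorem3p1:
  fixes scale :: "'a::{field,finite} \<Rightarrow> 'v::ab_group_add \<Rightarrow> 'v"
    and B :: "'v set"
    and q :: "'v \<Rightarrow> 'a"
    and a :: 'a
    and p m n :: nat
  assumes "prime p" and "m \<ge> 1" and "CARD('a) = p ^ m"
    and "finite_dimensional_vector_space scale B"
    and "vector_space.dim scale (UNIV :: 'v set) = n" and "n \<ge> 1"
    and "quadratic_form scale q" and "nondegenerate q"
  shows
    "(a = 0 \<longrightarrow>
        (isotropic q \<longrightarrow> representation_diameter q a = 2) \<and>
        (anisotropic q \<longrightarrow> representation_diameter q a = \<infinity>)) \<and>
     (a \<noteq> 0 \<and> n = 1 \<longrightarrow>
        representation_diameter q a = (if (\<lambda>d. a * d) ` det_class scale q = square_class 1 \<and> m = 1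
                then enat ((p - 1) div 2) else \<infinity>)) \<and>
     (a \<noteq> 0 \<and> n = 2 \<and> isometric scale q plane_scale hyperbolic_plane \<longrightarrow>
        (CARD('a) \<le> 4 \<longrightarrow> representation_diameter q a = \<infinity>) \<and>
        (CARD('a) \<ge> 5 \<longrightarrow> representation_diameter q a \<in> {3, 4})) \<and>
     (a \<noteq> 0 \<and> n = 2 \<and> \<not> isometric scale q plane_scale hyperbolic_plane \<longrightarrow>
        representation_diameter q a = (if CARD('a) = 2 then 1 else if CARD('a) \<in> {3, 4} then 2 else 3)) \<and>
     (a \<noteq> 0 \<and> n = 3 \<longrightarrow>
        representation_diameter q a = (if det_class scale q = square_class (- a) then 2 else 3)) \<and>
     (a \<noteq> 0 \<and> n \<ge> 4 \<longrightarrow> representation_diameter q a = 2)"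
proof -
  interpret finite_dimensional_vector_space scale B by fact
  interpret quad_space scale B q by unfold_locales fact+
  note enats = one_enat_def numeral_eq_enat
  have n: "dim UNIV = n" by fact
  have n1: "1 \<le> dim UNIV" using n \<open>n \<ge> 1\<close> by simp
  have two: "(2::'a) \<noteq> 0 \<or> 8 dvd CARD('a)" if "CARD('a) \<ge> 5"
    using eight_dvd_CARD[OF assms(1,3) _ that] by blast
  have hyp: "representation_diameter q a \<in> {3, 4}"
    if "a \<noteq> 0" "isometric scale q plane_scale hyperbolic_plane" "CARD('a) \<ge> 5"
    
    by (rule hyperbolic_plane_diameter(2)[where scale = scale]) (use that two in simp_all)
  show ?thesis
  proof (intro conjI impI; (elim conjE)?)
    show "representation_diameter q a = 2" if "a = 0" "isotropic q"
      using diameter_isotropic_0[OF that(2) n1] that(1) by (simp add: enats)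
    show "representation_diameter q a = \<infinity>" if "a = 0" "anisotropic q"
      using diameter_anisotropic_0[OF that(2) n1] that(1) by simp
    show "representation_diameter q a = (if (\<lambda>d. a * d) ` det_class scale q = square_class 1 \<and> m = 1
        then enat ((p - 1) div 2) else \<infinity>)" if "a \<noteq> 0" "n = 1"
      using diameter_dim_1[OF _ that(1) assms(1,3,2)] that(2) n by blast
    show "representation_diameter q a = \<infinity>"
      if "CARD('a) \<le> 4" "a \<noteq> 0" "n = 2" "isometric scale q plane_scale hyperbolic_plane"
      by (rule hyperbolic_plane_diameter(1)[where scale = scale]) (use that in simp_all)
    show "representation_diameter q a \<in> {3, 4}"
      if "CARD('a) \<ge> 5" "a \<noteq> 0" "n = 2" "isometric scale q plane_scale hyperbolic_plane"
      using hyp that by blast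
    show "representation_diameter q a = (if CARD('a) = 2 then 1 else if CARD('a) \<in> {3, 4} then 2 else 3)"
      if "a \<noteq> 0" "n = 2" "\<not> isometric scale q plane_scale hyperbolic_plane"
      using diameter_anisotropic_plane[OF _ that(3,1)] that(2) n unfolding enats by blast
    show "representation_diameter q a = (if det_class scale q = square_class (- a) then 2 else 3)"
      if "a \<noteq> 0" "n = 3"
      using diameter_dim_3[OF _ that(1)] that(2) n unfolding enats by blast
    show "representation_diameter q a = 2" if "a \<noteq> 0" "n \<ge> 4"
      using diameter_dim_ge_4[OF _ that(1)] that(2) n unfolding enats by blast
  qed
qed

end
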